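(* Let $n\ge1$ and let $t_{i,j},s_{i,j}$ ($1\le i<j\le n$), $t_i$ ($1\le i\le n$) be independent variables, abbreviated $\mathbf t$. Consider the factorization, over the field of rational functions in these variables, $$X^{(n)}(-\mathbf t)\,\bar w_0^{(n)}=Y\cdot T\cdot X^{(n)}(\mathbf p)$$ in $Sp_{2n}$, with $Y$ lower triangular unipotent, $T$ diagonal, and $\mathbf p=(p_{i,j},q_{i,j},p_i)$ rational functions of $\mathbf t$. With $u_{i,j},r_{i,j}$ as in the context: a) for $1\le i<j\le n$ $$p_{i,j}=r_{i,j}\prod_{k<i}\frac{t_{k,j-1}}{s_{k,j-1}}\prod_{k<i}\frac{s_{k,j}}{t_{k,j}},\qquad q_{i,j}=r_{i,j}\prod_{k<i}\frac{t_{k,j-1}}{s_{k,j-1}}\prod_{k\le i}\frac{s_{k,j}}{t_{k,j}},$$ and for $1\le i\le n$ $$p_i=\frac{u_{i,n}^2}{t_i\,s_{i,n}^2}\prod_{k<i}\frac{t_{k,n}^2}{s_{k,n}^2};$$ b) $T=\sum_{k=1}^n\big(T_ke_{k,k}+T_k^{-1}e_{\hat k,\hat k}\big)$ with $$T_k=t_k\prod_{j<k}\frac{s_{j,k}}{t_{j,k}}\cdot\prod_{j>k}s_{k,j}t_{k,j};$$ c) the map $\mathbf t\mapsto\mathbf p$ preserves the measure: $\prod_{i<j}\frac{dt_{i,j}ds_{i,j}}{t_{i,j}s_{i,j}}\prod_k\frac{dt_k}{t_k}=\prod_{i<j}\frac{dp_{i,j}dq_{i,j}}{p_{i,j}q_{i,j}}\prod_k\frac{dp_k}{p_k}$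 (as measures on the positive orthant).
   Context: Let $e_{a,b}$ be the $2n\times2n$ matrix units, $\hat k=2n+1-k$. $Sp(2n,\mathbb{R})$ is the group preserving $\sum_{i=1}^n(x_iy_{\hat i}-x_{\hat i}y_i)$. Chevalley generators: $e_i=e_{i,i+1}-e_{2n-i,2n+1-i}$, $f_i=e_{i+1,i}-e_{2n+1-i,2n-i}$ for $1\le i\le n-1$; $e_n=e_{n,n+1}$, $f_n=e_{n+1,n}$. $X^{(n)}(\mathbf t)=R_nR_{n-1}\cdots R_1$ with $R_n=\exp(t_ne_n)$ and, for $i<n$, $$R_i=\exp(s_{i,i+1}e_i)\exp(s_{i,i+2}e_{i+1})\cdots\exp(s_{i,n}e_{n-1})\exp(t_ie_n)\exp(t_{i,n}e_{n-1})\cdots\exp(t_{i,i+2}e_{i+1})\exp(t_{i,i+1}e_i).$$ $X^{(n)}(\mathbf p)$ is the same product with $p_{i,j},q_{i,j},p_i$ in place of $t_{i,j},s_{i,j},t_i$. $\bar w_0^{(n)}$ is obtained from this product by replacing each factor $\exp(c\,e_j)$ by $\exp(e_j)\exp(-f_j)\exp(e_j)$. Set $s_{j,j}=t_{j,j}=u_{j,j}=1$, and for $1\le i<j\le n$: $u_{i,j}=t_{i,j}+s_{i,j}$, $r_{i,j}=\dfrac{u_{i,j-1}}{u_{i,j}\,s_{i,j-1}}$. *)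

theory Defs
  imports
    "HOL-Analysis.Finite_Product_Measure"
    "HOL-Analysis.Lebesgue_Measure"
    "HOL-Computational_Algebra.Fraction_Field"
    "HOL-Library.Poly_Mapping"
    "HOL-Library.Countable"
    "Jordan_Normal_Form.Matrix"
begin

text \<open>Names of the coordinates of a parameter tuple: for \<^bold>\<open>t\<close> they stand for
  \<open>t\<^sub>i\<^sub>,\<^sub>j\<close>, \<open>s\<^sub>i\<^sub>,\<^sub>j\<close>, \<open>t\<^sub>i\<close>, and for \<^bold>\<open>p\<close> they stand for
  \<open>p\<^sub>i\<^sub>,\<^sub>j\<close>, \<open>q\<^sub>i\<^sub>,\<^sub>j\<close>, \<open>p\<^sub>i\<close>, respectively.\<close>

datatype param = ParT nat nat | ParS nat nat | ParD nat

definition params :: "nat \<Rightarrow> param set" where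
  "params n = {ParT i j |i j. 1 \<le> i \<and> i < j \<and> j \<le> n}
            \<union> {ParS i j |i j. 1 \<le> i \<and> i < j \<and> j \<le> n}
            \<union> {ParD i |i. 1 \<le> i \<and> i \<le> n}"

text \<open>The linear order on names has no mathematical meaning: the library needs one to show that
  polynomials over an integral domain form an integral domain.\<close>

instance param :: countable
  by countable_datatype

instantiation param :: linorder
begin

definition less_eq_param :: "param \<Rightarrow> param \<Rightarrow> bool" where
  "(v::param) \<le> w \<longleftrightarrow> to_nat v \<le> to_nat w"

definition less_param :: "param \<Rightarrow> param \<Rightarrow> bool" where
  "(v::param) < w \<longleftrightarrow> to_nat v < to_nat w"

instance
  by standard (auto simp: less_eq_param_def less_param_def)

end

type_synonym mpolynomial = "(param \<Rightarrow>\<^sub>0 nat) \<Rightarrow>\<^sub>0 real"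
type_synonym ratfun = "mpolynomial fract"

definition Var :: "param \<Rightarrow> ratfun" where
  "Var v = Fract (Poly_Mapping.single (Poly_Mapping.single v 1) 1) 1"

definition poly_value :: "(param \<Rightarrow> real) \<Rightarrow> mpolynomial \<Rightarrow> real" where
  "poly_value x P = (\<Sum>m\<in>Poly_Mapping.keys P.
     Poly_Mapping.lookup P m * (\<Prod>v\<in>Poly_Mapping.keys m. x v ^ Poly_Mapping.lookup m v))"

text \<open>Unspecified at points where no representative has a nonvanishing denominator.\<close>

definition ratfun_value :: "(param \<Rightarrow> real) \<Rightarrow> ratfun \<Rightarrow> real" where
  "ratfun_value x r = (THE y. \<exists>P Q. Q \<noteq> 0 \<and> r = Fract P Q \<and> poly_value x Q \<noteq> 0 \<and>
                                  y = poly_value x P / poly_value x Q)"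

text \<open>Row and column indices \<open>a\<close>, \<open>b\<close> and coordinates of vectors run over \<open>1, \<dots>, 2n\<close>,
  as on paper; the library counts from \<open>0\<close>.\<close>

definition hat :: "nat \<Rightarrow> nat \<Rightarrow> nat" where
  "hat n k = 2 * n + 1 - k"

definition mat_unit :: "nat \<Rightarrow> nat \<Rightarrow> nat \<Rightarrow> 'a::field mat" where
  "mat_unit n a b = mat (2 * n) (2 * n) (\<lambda>(i, j). if i + 1 = a \<and> j + 1 = b then 1 else 0)"

definition symp_form :: "nat \<Rightarrow> 'a::field vec \<Rightarrow> 'a vec \<Rightarrow> 'a" where
  "symp_form n x y = (\<Sum>i=1..n. vec_index x (i - 1) * vec_index y (hat n i - 1)
                             - vec_index x (hat n i - 1) * vec_index y (i - 1))"

definition Sp :: "nat \<Rightarrow> 'a::field mat set" where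
  "Sp n = {A \<in> carrier_mat (2 * n) (2 * n).
     \<forall>x\<in>carrier_vec (2 * n). \<forall>y\<in>carrier_vec (2 * n).
       symp_form n (A *\<^sub>v x) (A *\<^sub>v y) = symp_form n x y}"

definition e_gen :: "nat \<Rightarrow> nat \<Rightarrow> 'a::field mat" where
  "e_gen n i = (if i < n then mat_unit n i (i + 1) - mat_unit n (2 * n - i) (2 * n + 1 - i)
                else mat_unit n n (n + 1))"

definition f_gen :: "nat \<Rightarrow> nat \<Rightarrow> 'a::field mat" where
  "f_gen n i = (if i < n then mat_unit n (i + 1) i - mat_unit n (2 * n + 1 - i) (2 * n - i)
                else mat_unit n (n + 1) n)"

text \<open>The exponential of a nilpotent matrix over a field of characteristic zero. For a nilpotent
  square matrix of size \<open>m\<close> the powers from the \<open>m\<close>-th on vanish, so the exponential series stops.\<close>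

definition nil_exp :: "'a::field mat \<Rightarrow> 'a mat" where
  "nil_exp A = mat (dim_row A) (dim_row A)
     (\<lambda>(i, j). \<Sum>k<dim_row A. (A ^\<^sub>m k) $$ (i, j) / of_nat (fact k))"

definition mat_prod :: "nat \<Rightarrow> 'a::field mat list \<Rightarrow> 'a mat" where
  "mat_prod n As = foldr (*) As (1\<^sub>m (2 * n))"

text \<open>The factors of \<open>R\<^sub>i\<close>, and of \<open>R\<^sub>n R\<^sub>n\<^sub>-\<^sub>1 \<dots> R\<^sub>1\<close>, in order: \<open>(v, k)\<close> is the factor
  \<open>exp (v e\<^sub>k)\<close>. For \<open>i = n\<close> only the middle factor is present.\<close>

definition R_word :: "nat \<Rightarrow> nat \<Rightarrow> (param \<times> nat) list" where
  "R_word n i = map (\<lambda>j. (ParS i j, j - 1)) [i + 1..<n + 1] @ [(ParD i, n)] @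
                map (\<lambda>j. (ParT i j, j - 1)) (rev [i + 1..<n + 1])"

definition X_word :: "nat \<Rightarrow> (param \<times> nat) list" where
  "X_word n = concat (map (R_word n) (rev [1..<n + 1]))"

definition X_mat :: "nat \<Rightarrow> (param \<Rightarrow> 'a) \<Rightarrow> 'a::field mat" where
  "X_mat n x = mat_prod n (map (\<lambda>(v, k). nil_exp (x v \<cdot>\<^sub>m e_gen n k)) (X_word n))"

definition w0_mat :: "nat \<Rightarrow> 'a::field mat" where
  "w0_mat n = mat_prod n
     (map (\<lambda>(v, k). nil_exp (e_gen n k) * nil_exp (- f_gen n k) * nil_exp (e_gen n k)) (X_word n))"

definition lower_unitriangular :: "'a::field mat \<Rightarrow> bool" where
  "lower_unitriangular Y \<longleftrightarrow>
     (\<forall>i<dim_row Y. Y $$ (i, i) = 1 \<and> (\<forall>j<dim_col Y. i < j \<longrightarrow> Y $$ (i, j) = 0))"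

definition torus_mat :: "nat \<Rightarrow> (nat \<Rightarrow> 'a) \<Rightarrow> 'a::field mat" where
  "torus_mat n c = mat (2 * n) (2 * n) (\<lambda>(a, b). \<Sum>k=1..n.
     c k * mat_unit n k k $$ (a, b) + inverse (c k) * mat_unit n (hat n k) (hat n k) $$ (a, b))"

definition factorization :: "nat \<Rightarrow> ratfun mat \<Rightarrow> ratfun mat \<Rightarrow> (param \<Rightarrow> ratfun) \<Rightarrow> bool" where
  "factorization n Y T p \<longleftrightarrow>
     Y \<in> Sp n \<and> lower_unitriangular Y \<and> T \<in> Sp n \<and> diagonal_mat T \<and>
     X_mat n (\<lambda>v. - Var v) * w0_mat n = Y * T * X_mat n p"

definition t_var :: "nat \<Rightarrow> nat \<Rightarrow> ratfun" where
  "t_var i j = (if i = j then 1 else Var (ParT i j))"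

definition s_var :: "nat \<Rightarrow> nat \<Rightarrow> ratfun" where
  "s_var i j = (if i = j then 1 else Var (ParS i j))"

definition u_fun :: "nat \<Rightarrow> nat \<Rightarrow> ratfun" where
  "u_fun i j = (if i = j then 1 else t_var i j + s_var i j)"

definition r_fun :: "nat \<Rightarrow> nat \<Rightarrow> ratfun" where
  "r_fun i j = u_fun i (j - 1) / (u_fun i j * s_var i (j - 1))"

text \<open>The product over all coordinates of the measure \<open>dx / x\<close> on \<open>(0, \<infinity>)\<close>; its underlying
  space is the positive orthant.\<close>

definition log_measure :: "nat \<Rightarrow> (param \<Rightarrow> real) measure" where
  "log_measure n =
     PiM (params n) (\<lambda>_. density (restrict_space lborel {0<..}) (\<lambda>x. ennreal (1 / x)))"

definition param_map :: "nat \<Rightarrow> (param \<Rightarrow> ratfun) \<Rightarrow> (param \<Rightarrow> real) \<Rightarrow> (param \<Rightarrow> real)" where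
  "param_map n p x = (\<lambda>v\<in>params n. ratfun_value x (p v))"

end

theory Submission
  imports Defs "HOL-Analysis.Lebesgue_Integral_Substitution"
begin

text \<open>Conjugation by \<open>w\<^sub>0\<close>, which is the matrix of the symplectic form up to sign, turns the factors
  \<open>exp (- t e\<^sub>k)\<close> into \<open>exp (t f\<^sub>k)\<close>. The factors are then treated one row at a time, from row \<open>n\<close> to
  row \<open>1\<close>. For a single row the entries of the product of exponentials are explicit, and the
  factorization is the Schur complement with respect to a corner entry; the lower factor lies in the
  unipotent radical of a parabolic subgroup whose Levi part contains all later rows, so that it can be
  moved to the left past them, while moving the torus factor to the left rescales their parameters.
  Uniqueness of the parameters follows by reading them off the first row of the matrix.

  The map \<open>\<^bold>t \<mapsto> \<^bold>p\<close> is a composition of maps that replace a single coordinate \<open>x\<close> by \<open>c x\<close> or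
  \<open>c / x\<close>, where \<open>c > 0\<close> depends on the other coordinates only. They preserve \<open>dx / x\<close>, because it
  is the image of the Lebesgue measure under \<open>exp\<close>.\<close>

section \<open>Entries of products with elementary matrices\<close>

text \<open>A matrix does not by itself determine the parameters of a word: when
  \<open>ParD i\<close> vanishes for \<open>i < n\<close>, the two factors around it have the same
  generator and merge. Uniqueness of \<open>p\<close> therefore rests on the nonvanishing of the
  explicit solution.

  The closed form for one row exists because products of the proposed parameters telescope in
  \<open>u / s\<close>. Strictly off the diagonal every entry of the hook matrices then splits into
  a row factor and a column factor, so that eliminating one pivot clears whole triangles at once.

  All matrix identities are proved over an arbitrary field, for parameters such that all coordinates
  and all sums \<open>t + s\<close> are nonzero. They are applied to the variables; the same
  nonvanishing at positive real points allows the rational functions in c) to be evaluated there.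

  The pair \<open>p_ij\<close>, \<open>q_ij\<close> depends on both \<open>t_ij\<close> and
  \<open>s_ij\<close> through their sum, so it is not itself a replacement of single coordinates;
  passing through the ratio \<open>s / t\<close> makes it one in three moves.\<close>

definition ent :: "'a mat \<Rightarrow> nat \<Rightarrow> nat \<Rightarrow> 'a" where
  "ent M a b = M $$ (a - 1, b - 1)"

definition mat_of :: "nat \<Rightarrow> (nat \<Rightarrow> nat \<Rightarrow> 'a) \<Rightarrow> 'a mat" where
  "mat_of n h = mat (2 * n) (2 * n) (\<lambda>(i, j). h (Suc i) (Suc j))"

(* case splits on all disequalities between indices are exponential *)
declare [[linarith_neq_limit = 4]]

lemma mat_of_carrier [simp]: "mat_of n h \<in> carrier_mat (2 * n) (2 * n)"
  by (simp add: mat_of_def)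

lemma ent_mat_of [simp]:
  "a \<in> {1..2 * n} \<Longrightarrow> b \<in> {1..2 * n} \<Longrightarrow> ent (mat_of n h) a b = h a b"
  by (auto simp: ent_def mat_of_def)

lemma mat_eqI_ent:
  assumes "A \<in> carrier_mat (2 * n) (2 * n)" "B \<in> carrier_mat (2 * n) (2 * n)"
    and eq: "\<And>a b. a \<in> {1..2 * n} \<Longrightarrow> b \<in> {1..2 * n} \<Longrightarrow> ent A a b = ent B a b"
  shows "A = B"
proof (rule eq_matI)
  fix i j assume "i < dim_row B" "j < dim_col B"
  then show "A $$ (i, j) = B $$ (i, j)"
    using eq[of "Suc i" "Suc j"] assms by (auto simp: ent_def)
qed (use assms in auto)

lemma mult_sq_carrier [simp]:
  "A \<in> carrier_mat N N \<Longrightarrow> B \<in> carrier_mat N N \<Longrightarrow> A * B \<in> carrier_mat N N"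
  by (rule mult_carrier_mat)

lemma mult_sq_assoc:
  "A \<in> carrier_mat N N \<Longrightarrow> B \<in> carrier_mat N N \<Longrightarrow> C \<in> carrier_mat N N \<Longrightarrow>
    (A * B) * C = A * (B * (C::'a::semiring_0 mat))"
  by (rule assoc_mult_mat)

lemma ent_mult:
  fixes A B :: "'a::field mat"
  assumes "A \<in> carrier_mat (2 * n) (2 * n)" "B \<in> carrier_mat (2 * n) (2 * n)"
    and "a \<in> {1..2 * n}" "b \<in> {1..2 * n}"
  shows "ent (A * B) a b = (\<Sum>c=1..2 * n. ent A a c * ent B c b)"
proof -
  have "ent (A * B) a b = (\<Sum>k<2 * n. A $$ (a - 1, k) * B $$ (k, b - 1))"
    using assms by (auto simp: ent_def scalar_prod_def lessThan_atLeast0)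
  also have "\<dots> = (\<Sum>c\<in>Suc ` {..<2 * n}. ent A a c * ent B c b)"
    by (subst sum.reindex) (auto simp: ent_def)
  also have "Suc ` {..<2 * n} = {1..2 * n}"
    by (simp add: image_Suc_lessThan)
  finally show ?thesis .
qed

lemma ent_one [simp]:
  "a \<in> {1..2 * n} \<Longrightarrow> b \<in> {1..2 * n} \<Longrightarrow> ent (1\<^sub>m (2 * n)) a b = (if a = b then 1 else 0)"
  by (auto simp: ent_def)

text \<open>The superdiagonal entry of \<open>c e_k\<close> in row \<open>a\<close>. For
  \<open>k < n\<close> there are two such entries, of opposite sign; for \<open>k = n\<close> both
  positions are \<open>n\<close>, and the order of the tests keeps \<open>c\<close> alone, as in
  \<open>e_n\<close>.\<close>

definition root_coeff :: "nat \<Rightarrow> nat \<Rightarrow> 'a::field \<Rightarrow> nat \<Rightarrow> 'a" where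
  "root_coeff n k c a = (if a = k then c else if a = 2 * n - k then - c else 0)"

text \<open>As \<open>e_k\<close> squares to zero, its exponential is \<open>1 + c e_k\<close>,
  which is this matrix (\<open>nil_exp_e_gen\<close>). In this form a factor acts by a row or column
  operation.\<close>

definition E_mat :: "nat \<Rightarrow> nat \<Rightarrow> 'a::field \<Rightarrow> 'a mat" where
  "E_mat n k c = mat_of n (\<lambda>a b. if a = b then 1 else if b = Suc a then root_coeff n k c a else 0)"

definition F_mat :: "nat \<Rightarrow> nat \<Rightarrow> 'a::field \<Rightarrow> 'a mat" where
  "F_mat n k c = mat_of n (\<lambda>a b. if a = b then 1 else if a = Suc b then root_coeff n k c b else 0)"

lemma E_mat_carrier [simp]: "E_mat n k c \<in> carrier_mat (2 * n) (2 * n)"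
  and F_mat_carrier [simp]: "F_mat n k c \<in> carrier_mat (2 * n) (2 * n)"
  by (simp_all add: E_mat_def F_mat_def)

text \<open>The index \<open>y\<close> may fall outside the range, as happens in the last row or the
  first column; the coefficient \<open>v\<close> is zero there, so the boundary needs no case of its
  own.\<close>

lemma sum_two:
  fixes f g :: "nat \<Rightarrow> 'a::comm_ring_1"
  assumes "x \<in> A" "x \<noteq> y" "finite A" "y \<notin> A \<Longrightarrow> v = 0"
    "\<And>c. g c = (if c = x then 1 else if c = y then v else 0)"
  shows "(\<Sum>c\<in>A. g c * f c) = f x + v * f y"
proof -
  have "(\<Sum>c\<in>A. g c * f c) = (\<Sum>c\<in>A. (if c = x then f x else 0) + (if c = y then v * f y else 0))"
    by (rule sum.cong) (use assms in auto)
  also have "\<dots> = f x + v * f y"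
    using assms(1,3,4) by (auto simp: sum.distrib)
  finally show ?thesis .
qed

lemma root_coeff_outside: "1 \<le> k \<Longrightarrow> k \<le> n \<Longrightarrow> a \<notin> {1..<2 * n} \<Longrightarrow> root_coeff n k c a = 0"
  by (auto simp: root_coeff_def)

text \<open>A row operation. For \<open>a = 2 * n\<close> the term with \<open>Suc a\<close> reads
  outside the matrix, but its coefficient is zero by \<open>root_coeff_outside\<close>; index 0 in
  \<open>ent_mult_E\<close> is harmless for the same reason.\<close>

lemma ent_E_mult:
  assumes M: "M \<in> carrier_mat (2 * n) (2 * n)" and ab: "a \<in> {1..2 * n}" "b \<in> {1..2 * n}"
    and k: "1 \<le> k" "k \<le> n"
  shows "ent (E_mat n k c * M) a b = ent M a b + root_coeff n k c a * ent M (Suc a) b"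
proof -
  have "ent (E_mat n k c * M) a b = (\<Sum>d=1..2 * n.
      (if d = a then 1 else if d = Suc a then root_coeff n k c a else 0) * ent M d b)"
    unfolding ent_mult[OF E_mat_carrier M ab] by (rule sum.cong) (use ab in \<open>auto simp: E_mat_def\<close>)
  also have "\<dots> = ent M a b + root_coeff n k c a * ent M (Suc a) b"
    by (rule sum_two) (use ab in \<open>auto intro: root_coeff_outside[OF k]\<close>)
  finally show ?thesis .
qed

lemma ent_mult_E:
  assumes M: "M \<in> carrier_mat (2 * n) (2 * n)" and ab: "a \<in> {1..2 * n}" "b \<in> {1..2 * n}"
    and k: "1 \<le> k" "k \<le> n"
  shows "ent (M * E_mat n k c) a b = ent M a b + root_coeff n k c (b - 1) * ent M a (b - 1)"
proof -
  have "ent (M * E_mat n k c) a b = (\<Sum>d=1..2 * n.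
      (if d = b then 1 else if d = b - 1 then root_coeff n k c (b - 1) else 0) * ent M a d)"
    unfolding ent_mult[OF M E_mat_carrier ab] by (rule sum.cong) (use ab in \<open>auto simp: E_mat_def\<close>)
  also have "\<dots> = ent M a b + root_coeff n k c (b - 1) * ent M a (b - 1)"
    by (rule sum_two) (use ab in \<open>auto intro: root_coeff_outside[OF k]\<close>)
  finally show ?thesis .
qed

lemma ent_F_mult:
  assumes M: "M \<in> carrier_mat (2 * n) (2 * n)" and ab: "a \<in> {1..2 * n}" "b \<in> {1..2 * n}"
    and k: "1 \<le> k" "k \<le> n"
  shows "ent (F_mat n k c * M) a b = ent M a b + root_coeff n k c (a - 1) * ent M (a - 1) b"
proof -
  have "ent (F_mat n k c * M) a b = (\<Sum>d=1..2 * n.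
      (if d = a then 1 else if d = a - 1 then root_coeff n k c (a - 1) else 0) * ent M d b)"
    unfolding ent_mult[OF F_mat_carrier M ab] by (rule sum.cong) (use ab in \<open>auto simp: F_mat_def\<close>)
  also have "\<dots> = ent M a b + root_coeff n k c (a - 1) * ent M (a - 1) b"
    by (rule sum_two) (use ab in \<open>auto intro: root_coeff_outside[OF k]\<close>)
  finally show ?thesis .
qed

lemma ent_mult_F:
  assumes M: "M \<in> carrier_mat (2 * n) (2 * n)" and ab: "a \<in> {1..2 * n}" "b \<in> {1..2 * n}"
    and k: "1 \<le> k" "k \<le> n"
  shows "ent (M * F_mat n k c) a b = ent M a b + root_coeff n k c b * ent M a (Suc b)"
proof -
  have "ent (M * F_mat n k c) a b = (\<Sum>d=1..2 * n.
      (if d = b then 1 else if d = Suc b then root_coeff n k c b else 0) * ent M a d)"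
    unfolding ent_mult[OF M F_mat_carrier ab] by (rule sum.cong) (use ab in \<open>auto simp: F_mat_def\<close>)
  also have "\<dots> = ent M a b + root_coeff n k c b * ent M a (Suc b)"
    by (rule sum_two) (use ab in \<open>auto intro: root_coeff_outside[OF k]\<close>)
  finally show ?thesis .
qed

section \<open>Exponentials of the generators\<close>

lemma nil_exp_square_zero:
  fixes A :: "'a::field mat"
  assumes A: "A \<in> carrier_mat N N" and sq: "A * A = 0\<^sub>m N N" and N: "N \<ge> 2"
  shows "nil_exp A = 1\<^sub>m N + A"
proof -
  have p: "A ^\<^sub>m k = 0\<^sub>m N N" if "k \<ge> 2" for k
    using that
  proof (induction k rule: dec_induct)
    case base
    then show ?case using A sq by (simp add: numeral_2_eq_2)
  next
    case (step m)
    then show ?case using A by simp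
  qed
  show ?thesis
  proof (rule eq_matI)
    fix i j assume ij: "i < dim_row (1\<^sub>m N + A)" "j < dim_col (1\<^sub>m N + A)"
    then have ij': "i < N" "j < N" using A by auto
    have "(\<Sum>k<N. (A ^\<^sub>m k) $$ (i, j) / of_nat (fact k))
        = (\<Sum>k\<in>{0, 1}. (A ^\<^sub>m k) $$ (i, j) / of_nat (fact k))"
    proof (rule sum.mono_neutral_right)
      show "\<forall>k\<in>{..<N} - {0, 1}. (A ^\<^sub>m k) $$ (i, j) / of_nat (fact k) = 0"
      proof
        fix k assume "k \<in> {..<N} - {0, 1}"
        then have "k \<ge> 2" by auto
        then show "(A ^\<^sub>m k) $$ (i, j) / of_nat (fact k) = 0"
          using p ij' by simp
      qed
    qed (use N in auto)
    then show "nil_exp A $$ (i, j) = (1\<^sub>m N + A) $$ (i, j)"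
      using A ij' by (simp add: nil_exp_def)
  qed (use A in \<open>auto simp: nil_exp_def\<close>)
qed

text \<open>\<open>S\<close> contains the columns that occur and avoids the rows that occur, so no
  intermediate index can join two nonzero entries.\<close>

lemma square_zeroI:
  fixes M :: "'a::field mat"
  assumes "\<And>a b. a \<in> {1..2 * n} \<Longrightarrow> b \<in> {1..2 * n} \<Longrightarrow> b \<notin> S \<Longrightarrow> h a b = 0"
    and "\<And>a b. a \<in> {1..2 * n} \<Longrightarrow> b \<in> {1..2 * n} \<Longrightarrow> a \<in> S \<Longrightarrow> h a b = 0"
    and "M = mat_of n h"
  shows "M * M = 0\<^sub>m (2 * n) (2 * n)"
proof (rule mat_eqI_ent)
  fix a b assume ab: "a \<in> {1..2 * n}" "b \<in> {1..2 * n}"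
  have "ent (M * M) a b = (\<Sum>c=1..2 * n. h a c * h c b)"
    unfolding assms(3) using ab by (subst ent_mult) auto
  also have "\<dots> = 0"
  proof (rule sum.neutral, rule ballI)
    fix c assume "c \<in> {1..2 * n}"
    then show "h a c * h c b = 0"
      using assms(1)[of a c] assms(2)[of c b] ab by (cases "c \<in> S") auto
  qed
  finally show "ent (M * M) a b = ent (0\<^sub>m (2 * n) (2 * n)) a b"
    using ab by (auto simp: ent_def)
qed (auto simp: assms(3) intro!: mult_sq_carrier)

lemma nil_exp_e_gen:
  assumes k: "1 \<le> k" "k \<le> n"
  shows "nil_exp (c \<cdot>\<^sub>m e_gen n k) = E_mat n k (c::'a::field)"
proof -
  let ?h = "\<lambda>a b. if b = Suc a then root_coeff n k c a else 0"
  \<comment> \<open>If \<open>Suc k\<close> were \<open>2 * n - k\<close>, the column of one entry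
    of \<open>e_k\<close> would be the row of the other and the square would not vanish.\<close>
  have parity: "2 * n \<noteq> Suc (2 * k)" by presburger
  have ne: "Suc k \<noteq> 2 * n - k" "2 * n - k \<noteq> Suc k" "Suc (2 * n - k) \<noteq> k" "k \<noteq> Suc (2 * n - k)"
    using k parity by auto
  have eq: "c \<cdot>\<^sub>m e_gen n k = mat_of n ?h"
    by (rule eq_matI) (use k in \<open>auto simp: e_gen_def mat_unit_def mat_of_def root_coeff_def\<close>)
  have "nil_exp (c \<cdot>\<^sub>m e_gen n k) = 1\<^sub>m (2 * n) + mat_of n ?h"
    unfolding eq
    by (rule nil_exp_square_zero, simp, rule square_zeroI[where S = "{Suc k, Suc (2 * n - k)}"])
       (use k ne in \<open>auto simp: root_coeff_def split: if_splits\<close>)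
  also have "\<dots> = E_mat n k c"
    by (rule eq_matI) (auto simp: E_mat_def mat_of_def)
  finally show ?thesis .
qed

lemma nil_exp_f_gen:
  assumes k: "1 \<le> k" "k \<le> n"
  shows "nil_exp (- f_gen n k) = F_mat n k (- 1::'a::field)"
proof -
  let ?h = "\<lambda>a b. if a = Suc b then root_coeff n k (- 1::'a) b else 0"
  have parity: "2 * n \<noteq> Suc (2 * k)" by presburger
  have ne: "Suc k \<noteq> 2 * n - k" "2 * n - k \<noteq> Suc k" "Suc (2 * n - k) \<noteq> k" "k \<noteq> Suc (2 * n - k)"
    using k parity by auto
  have eq: "- f_gen n k = mat_of n ?h"
    by (rule eq_matI) (use k in \<open>auto simp: f_gen_def mat_unit_def mat_of_def root_coeff_def\<close>)
  have "nil_exp (- f_gen n k :: 'a mat) = 1\<^sub>m (2 * n) + mat_of n ?h"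
    unfolding eq
    by (rule nil_exp_square_zero, simp, rule square_zeroI[where S = "{k, 2 * n - k}"])
       (use k ne in \<open>auto simp: root_coeff_def split: if_splits\<close>)
  also have "\<dots> = F_mat n k (- 1)"
    by (rule eq_matI) (auto simp: F_mat_def mat_of_def)
  finally show ?thesis .
qed

lemma nil_exp_e_gen_one:
  assumes k: "1 \<le> k" "k \<le> n"
  shows "nil_exp (e_gen n k) = E_mat n k (1::'a::field)"
proof -
  have "(1::'a) \<cdot>\<^sub>m e_gen n k = e_gen n k"
    by (rule eq_matI) (auto simp: e_gen_def)
  then show ?thesis using nil_exp_e_gen[OF k, of "1::'a"] by simp
qed

section \<open>Lifts of the simple reflections\<close>

definition sgn_pos :: "nat \<Rightarrow> nat \<Rightarrow> nat \<Rightarrow> 'a::field" where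
  "sgn_pos n k a = root_coeff n k 1 a"

lemma root_coeff_conv: "root_coeff n k c a = c * sgn_pos n k a"
  by (simp add: root_coeff_def sgn_pos_def)

text \<open>The pairs \<open>{k, k + 1}\<close> and \<open>{2 * n - k, 2 * n - k + 1}\<close> are
  disjoint or equal, so two consecutive rows never both carry a coefficient.\<close>

lemma sgn_pos_neighbours:
  assumes "1 \<le> k" "k \<le> n" "sgn_pos n k a \<noteq> (0::'a::field)"
  shows "sgn_pos n k (Suc a) = (0::'a)" "sgn_pos n k (a - 1) = (0::'a)"
    "sgn_pos n k a * sgn_pos n k a = (1::'a)" "1 \<le> a" "Suc a \<le> 2 * n"
proof -
  have parity: "2 * n \<noteq> Suc (2 * k)" by presburger
  have a: "a = k \<or> a = 2 * n - k" "a \<le> n \<longrightarrow> a = k"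
    using assms by (auto simp: sgn_pos_def root_coeff_def split: if_splits)
  then have "Suc a \<noteq> k" "Suc a \<noteq> 2 * n - k" "a - 1 \<noteq> k" "a - 1 \<noteq> 2 * n - k"
    using assms(1,2) parity by auto
  then show "sgn_pos n k (Suc a) = (0::'a)" "sgn_pos n k (a - 1) = (0::'a)"
    by (simp_all add: sgn_pos_def root_coeff_def)
  show "sgn_pos n k a * sgn_pos n k a = (1::'a)"
    using a(1) by (auto simp: sgn_pos_def root_coeff_def)
  show "1 \<le> a" "Suc a \<le> 2 * n" using a(1) assms(1,2) by auto
qed

text \<open>On each moved pair of coordinates this is the matrix with rows \<open>(0, g)\<close> and
  \<open>(- g, 0)\<close>, where \<open>g\<close> is 1 or -1. It squares to -1 on such a pair, which
  is the source of the signs in \<open>w0_mat\<close>.\<close>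

definition S_mat :: "nat \<Rightarrow> nat \<Rightarrow> 'a::field mat" where
  "S_mat n k = E_mat n k 1 * F_mat n k (- 1) * E_mat n k 1"

lemma S_mat_carrier [simp]: "S_mat n k \<in> carrier_mat (2 * n) (2 * n)"
  unfolding S_mat_def by (intro mult_sq_carrier) auto

text \<open>The two rows of the product of \<open>(1, g; 0, 1)\<close>,
  \<open>(1, 0; - g, 1)\<close> and \<open>(1, g; 0, 1)\<close>, which is the action of
  \<open>S_mat\<close> on a moved pair.\<close>

lemma involution_cancel:
  fixes g x y :: "'a::comm_ring_1"
  assumes "g * g = 1"
  shows "x + g * y + g * (y - g * (x + g * y)) = g * y" "x - g * (y + g * x) = - (g * y)"
proof -
  have "g * (y - g * (x + g * y)) = g * y - (g * g) * x - (g * g) * (g * y)"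
    and "g * (y + g * x) = g * y + (g * g) * x"
    by (simp_all add: algebra_simps)
  then show "x + g * y + g * (y - g * (x + g * y)) = g * y" "x - g * (y + g * x) = - (g * y)"
    using assms by simp_all
qed

lemma ent_S_mult:
  assumes M: "(M::'a::field mat) \<in> carrier_mat (2 * n) (2 * n)" and ab: "a \<in> {1..2 * n}" "b \<in> {1..2 * n}"
    and k: "1 \<le> k" "k \<le> n"
  shows "ent (S_mat n k * M) a b =
    (if sgn_pos n k a \<noteq> (0::'a) then sgn_pos n k a * ent M (Suc a) b
     else if sgn_pos n k (a - 1) \<noteq> (0::'a) then - (sgn_pos n k (a - 1) * ent M (a - 1) b)
     else ent M a b)" (is "_ = ?r")
proof -
  define X where "X = E_mat n k 1 * M"
  define Y where "Y = F_mat n k (- 1) * X"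
  have X: "X \<in> carrier_mat (2 * n) (2 * n)" and Y: "Y \<in> carrier_mat (2 * n) (2 * n)"
    using M by (auto simp: X_def Y_def intro!: mult_sq_carrier)
  let ?g = "sgn_pos n k :: nat \<Rightarrow> 'a"
  have eX: "ent X a b = ent M a b + ?g a * ent M (Suc a) b" if "a \<in> {1..2 * n}" for a
    using ent_E_mult[OF M that ab(2) k, of 1] by (simp add: X_def root_coeff_conv)
  have eY: "ent Y a b = ent X a b - ?g (a - 1) * ent X (a - 1) b" if "a \<in> {1..2 * n}" for a
    using ent_F_mult[OF X that ab(2) k, of "- 1"] by (simp add: Y_def root_coeff_conv)
  have "S_mat n k * M = E_mat n k 1 * Y"
    unfolding S_mat_def X_def Y_def using M by (simp add: mult_sq_assoc[where N = "2 * n"])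
  then have eZ: "ent (S_mat n k * M) a b = ent Y a b + ?g a * ent Y (Suc a) b"
    using ent_E_mult[OF Y ab k, of 1] by (simp add: root_coeff_conv)
  note nb = sgn_pos_neighbours[OF k, where 'a = 'a]
  show ?thesis
  proof (cases "?g a = 0")
    case False
    then have "Suc a \<in> {1..2 * n}" using nb(5)[of a] by auto
    moreover have g: "?g (Suc a) = 0" "?g (a - 1) = 0" "?g a * ?g a = 1"
      using False nb(1-3) by blast+
    ultimately have "ent (S_mat n k * M) a b = ent M a b + ?g a * ent M (Suc a) b + ?g a * (ent M (Suc a) b - ?g a * (ent M a b + ?g a * ent M (Suc a) b))"
      using ab by (simp add: eZ eY eX)
    also have "\<dots> = ?g a * ent M (Suc a) b"
      by (rule involution_cancel[OF g(3)])
    finally show ?thesis using False by simp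
  next
    case g0: True
    show ?thesis
    proof (cases "?g (a - 1) = 0")
      case True
      then show ?thesis using g0 ab by (simp add: eZ eY eX)
    next
      case False
      then have "a - 1 \<in> {1..2 * n}" "Suc (a - 1) = a" using nb(4,5)[of "a - 1"] by auto
      moreover have g: "?g (a - 1 - 1) = 0" "?g (a - 1) * ?g (a - 1) = 1"
        using False nb(2,3) by blast+
      ultimately have "ent (S_mat n k * M) a b = ent M a b - ?g (a - 1) * (ent M (a - 1) b + ?g (a - 1) * ent M a b)"
        using g0 ab by (simp add: eZ eY eX)
      also have "\<dots> = - (?g (a - 1) * ent M (a - 1) b)"
        by (rule involution_cancel[OF g(2)])
      finally show ?thesis using False g0 by simp
    qed
  qed
qed

lemma ent_mult_S:
  assumes M: "(M::'a::field mat) \<in> carrier_mat (2 * n) (2 * n)" and ab: "a \<in> {1..2 * n}" "b \<in> {1..2 * n}"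
    and k: "1 \<le> k" "k \<le> n"
  shows "ent (M * S_mat n k) a b =
    (if sgn_pos n k b \<noteq> (0::'a) then - (sgn_pos n k b * ent M a (Suc b))
     else if sgn_pos n k (b - 1) \<noteq> (0::'a) then sgn_pos n k (b - 1) * ent M a (b - 1)
     else ent M a b)"
proof -
  define X where "X = M * E_mat n k 1"
  define Y where "Y = X * F_mat n k (- 1)"
  have X: "X \<in> carrier_mat (2 * n) (2 * n)" and Y: "Y \<in> carrier_mat (2 * n) (2 * n)"
    using M by (auto simp: X_def Y_def intro!: mult_sq_carrier)
  let ?g = "sgn_pos n k :: nat \<Rightarrow> 'a"
  have eX: "ent X a b = ent M a b + ?g (b - 1) * ent M a (b - 1)" if "b \<in> {1..2 * n}" for b
    using ent_mult_E[OF M ab(1) that k, of 1] by (simp add: X_def root_coeff_conv)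
  have eY: "ent Y a b = ent X a b - ?g b * ent X a (Suc b)" if "b \<in> {1..2 * n}" for b
    using ent_mult_F[OF X ab(1) that k, of "- 1"] by (simp add: Y_def root_coeff_conv)
  have "M * S_mat n k = Y * E_mat n k 1"
    unfolding S_mat_def X_def Y_def using M by (simp add: mult_sq_assoc[where N = "2 * n"])
  then have eZ: "ent (M * S_mat n k) a b = ent Y a b + ?g (b - 1) * ent Y a (b - 1)"
    using ent_mult_E[OF Y ab k, of 1] by (simp add: root_coeff_conv)
  note nb = sgn_pos_neighbours[OF k, where 'a = 'a]
  show ?thesis
  proof (cases "?g b = 0")
    case False
    then have "Suc b \<in> {1..2 * n}" using nb(5)[of b] by auto
    moreover have g: "?g (Suc b) = 0" "?g (b - 1) = 0" "?g b * ?g b = 1"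
      using False nb(1-3) by blast+
    ultimately have "ent (M * S_mat n k) a b = ent M a b - ?g b * (ent M a (Suc b) + ?g b * ent M a b)"
      using ab by (simp add: eZ eY eX)
    also have "\<dots> = - (?g b * ent M a (Suc b))"
      by (rule involution_cancel[OF g(3)])
    finally show ?thesis using False by simp
  next
    case g0: True
    show ?thesis
    proof (cases "?g (b - 1) = 0")
      case True
      then show ?thesis using g0 ab by (simp add: eZ eY eX)
    next
      case False
      then have "b - 1 \<in> {1..2 * n}" "Suc (b - 1) = b" using nb(4,5)[of "b - 1"] by auto
      moreover have g: "?g (b - 1 - 1) = 0" "?g (b - 1) * ?g (b - 1) = 1"
        using False nb(2,3) by blast+
      ultimately have "ent (M * S_mat n k) a b = ent M a b + ?g (b - 1) * ent M a (b - 1) + ?g (b - 1) * (ent M a (b - 1) - ?g (b - 1) * (ent M a b + ?g (b - 1) * ent M a (b - 1)))"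
        using g0 ab by (simp add: eZ eY eX)
      also have "\<dots> = ?g (b - 1) * ent M a (b - 1)"
        by (rule involution_cancel[OF g(2)])
      finally show ?thesis using False g0 by simp
    qed
  qed
qed

section \<open>Entries of the product over one row\<close>

text \<open>The product over one row, built outwards from its middle factor. A layer puts the same
  generator on both sides, with parameters indexed by one more than the generator. Keeping
  \<open>G\<close> arbitrary gives one recursion for the \<open>e\<close>-factors, the
  \<open>f\<close>-factors, the reflections and the inverses.\<close>

primrec hook :: "(nat \<Rightarrow> 'b \<Rightarrow> 'a::field mat) \<Rightarrow> nat \<Rightarrow> (nat \<Rightarrow> 'b) \<Rightarrow> (nat \<Rightarrow> 'b) \<Rightarrow> 'b \<Rightarrow> nat \<Rightarrow> 'a mat"
  where
    "hook G n q p d 0 = G n d"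
  | "hook G n q p d (Suc j) =
       G (n - Suc j) (q (n - j)) * hook G n q p d j * G (n - Suc j) (p (n - j))"

lemma hook_carrier [simp]:
  assumes "\<And>k c. G k c \<in> carrier_mat (2 * n) (2 * n)"
  shows "hook G n q p d j \<in> carrier_mat (2 * n) (2 * n)"
  by (induction j) (auto simp: assms intro!: mult_sq_carrier)

text \<open>The number of layers does not occur: enlarging the hook leaves the inner block unchanged
  and only adds a border. The cases depend on the position of \<open>a\<close> and \<open>b\<close>
  relative to the middle \<open>n\<close>; columns beyond it bring factors \<open>- p\<close>, from
  the negative entries of the generators.\<close>

definition hook_entry ::
  "nat \<Rightarrow> (nat \<Rightarrow> 'a) \<Rightarrow> (nat \<Rightarrow> 'a) \<Rightarrow> 'a \<Rightarrow> nat \<Rightarrow> nat \<Rightarrow> 'a::field" where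
  "hook_entry n q p d a b =
    (if a = b then 1 else if b < a then 0
     else if b \<le> n then (q b + p b) * prod q {a<..<b}
     else if a \<le> n then d * prod q {a<..n} * (\<Prod>k\<in>{hat n b<..n}. - p k)
     else - (p (hat n a) + q (hat n a)) * (\<Prod>k\<in>{hat n b<..<hat n a}. - p k))"

lemma prod_open_left:
  "Suc k < b \<Longrightarrow> prod f {k<..<b} = f (Suc k) * prod f {Suc k<..<b}"
  "Suc k \<le> b \<Longrightarrow> prod f {k<..b} = f (Suc k) * prod f {Suc k<..b}"
  for f :: "nat \<Rightarrow> 'a::comm_monoid_mult"
proof -
  assume "Suc k < b"
  then have "{k<..<b} = insert (Suc k) {Suc k<..<b}" by auto
  then show "prod f {k<..<b} = f (Suc k) * prod f {Suc k<..<b}" by simp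
next
  assume "Suc k \<le> b"
  then have "{k<..b} = insert (Suc k) {Suc k<..b}" by auto
  then show "prod f {k<..b} = f (Suc k) * prod f {Suc k<..b}" by simp
qed

lemma pred_cases:
  fixes b k l :: nat
  assumes "b \<in> {1..m}"
  obtains "b = Suc k" | "b = Suc l" | "b - 1 \<noteq> k" "b - 1 \<noteq> l"
  using assms by (cases b) auto

text \<open>A new generator adds multiples of rows \<open>k + 1\<close> and
  \<open>2 * n - k + 1\<close> to the rows before them, and of columns \<open>k\<close> and
  \<open>2 * n - k\<close> to the columns after them; all else is inherited. With \<open>H\<close>
  an abstract function this is a case analysis free of matrices.\<close>

lemma hook_entry_step:
  fixes H :: "nat \<Rightarrow> nat \<Rightarrow> 'a::field"
  assumes k: "1 \<le> k" "k < n" and ab: "a \<in> {1..2 * n}" "b \<in> {1..2 * n}"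
    and H: "\<And>a b. a \<in> {1..2 * n} \<Longrightarrow> b \<in> {1..2 * n} \<Longrightarrow>
      H a b = (if a \<in> {Suc k..2 * n - k} \<and> b \<in> {Suc k..2 * n - k}
        then hook_entry n q p d a b else if a = b then 1 else 0)"
  shows "H a b + root_coeff n k (p (Suc k)) (b - 1) * H a (b - 1)
      + root_coeff n k (q (Suc k)) a * (H (Suc a) b + root_coeff n k (p (Suc k)) (b - 1) * H (Suc a) (b - 1)) =
    (if a \<in> {k..Suc (2 * n - k)} \<and> b \<in> {k..Suc (2 * n - k)} then hook_entry n q p d a b
     else if a = b then 1 else 0)"
proof -
  have em: "{k<..<Suc k} = {}" by auto
  consider "a = k" | "a = 2 * n - k" | "a \<noteq> k" "a \<noteq> 2 * n - k" by blast
  then show ?thesis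
  proof cases
    case a: 1
    consider "b = Suc k" | "b = Suc (2 * n - k)" | "b - 1 \<noteq> k" "b - 1 \<noteq> 2 * n - k" by (rule pred_cases[OF ab(2)])
    then show ?thesis
    proof cases
      case 1
      then show ?thesis using a k ab
        by (simp add: H) (auto simp: root_coeff_def hook_entry_def hat_def em)
    next
      case 2
      then show ?thesis using a k ab
        by (simp add: H) (auto simp: root_coeff_def hook_entry_def hat_def prod_open_left em)
    next
      case 3
      then show ?thesis using a k ab
        by (simp add: H root_coeff_def) (auto simp: hook_entry_def hat_def prod_open_left em)
    qed
  next
    case a: 2
    consider "b = Suc k" | "b = Suc (2 * n - k)" | "b - 1 \<noteq> k" "b - 1 \<noteq> 2 * n - k" by (rule pred_cases[OF ab(2)])
    then show ?thesis
    proof cases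
      case 1
      then show ?thesis using a k ab
        by (simp add: H) (auto simp: root_coeff_def hook_entry_def hat_def em)
    next
      case 2
      then show ?thesis using a k ab
        by (simp add: H) (auto simp: root_coeff_def hook_entry_def hat_def prod_open_left em)
    next
      case 3
      then show ?thesis using a k ab
        by (simp add: H root_coeff_def) (auto simp: hook_entry_def hat_def prod_open_left em)
    qed
  next
    case a: 3
    consider "b = Suc k" | "b = Suc (2 * n - k)" | "b - 1 \<noteq> k" "b - 1 \<noteq> 2 * n - k" by (rule pred_cases[OF ab(2)])
    then show ?thesis
    proof cases
      case 1
      have "a = b \<or> b < a" if "a \<in> {k..Suc (2 * n - k)}" "b \<in> {k..Suc (2 * n - k)}"
        "\<not> (a \<in> {Suc k..2 * n - k} \<and> b \<in> {Suc k..2 * n - k})"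
        using that a 1 by auto
      moreover have "root_coeff n k (q (Suc k)) a = 0" "H a (b - 1) = 0"
        using a k ab 1 by (simp_all add: root_coeff_def H)
      ultimately show ?thesis using k ab
        by (simp add: H) (auto simp: hook_entry_def)
    next
      case 2
      then show ?thesis using a k ab
        by (simp add: H) (auto simp: root_coeff_def hook_entry_def hat_def prod_open_left em)
    next
      case 3
      have "a = b \<or> b < a" if "a \<in> {k..Suc (2 * n - k)}" "b \<in> {k..Suc (2 * n - k)}"
        "\<not> (a \<in> {Suc k..2 * n - k} \<and> b \<in> {Suc k..2 * n - k})"
        using that a 3 by auto
      moreover have "root_coeff n k (p (Suc k)) (b - 1) = 0" "root_coeff n k (q (Suc k)) a = 0"
        using a 3 by (simp_all add: root_coeff_def)
      ultimately show ?thesis using k ab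
        by (simp add: H) (auto simp: hook_entry_def)
    qed
  qed
qed

lemma ent_hook_E:
  assumes "j < n" "a \<in> {1..2 * n}" "b \<in> {1..2 * n}"
  shows "ent (hook (E_mat n) n q p d j) a b =
    (if a \<in> {n - j..n + 1 + j} \<and> b \<in> {n - j..n + 1 + j} then hook_entry n q p d a b
     else if a = b then 1 else 0)"
  using assms
proof (induction j arbitrary: a b)
  case 0
  then show ?case
    by (simp add: E_mat_def) (auto simp: root_coeff_def hook_entry_def hat_def)
next
  case (Suc j)
  define k where "k = n - Suc j"
  have k: "1 \<le> k" "k \<le> n" "k < n" "n - j = Suc k" "n + 1 + j = 2 * n - k"
      "n - Suc j = k" "n + 1 + Suc j = Suc (2 * n - k)"
    using Suc.prems by (auto simp: k_def)
  let ?H = "hook (E_mat n) n q p d j"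
  have H: "?H \<in> carrier_mat (2 * n) (2 * n)" by simp
  have IH: "ent ?H a b = (if a \<in> {Suc k..2 * n - k} \<and> b \<in> {Suc k..2 * n - k}
      then hook_entry n q p d a b else if a = b then 1 else 0)"
    if "a \<in> {1..2 * n}" "b \<in> {1..2 * n}" for a b
    using Suc.IH[OF _ that] Suc.prems(1) unfolding k by simp
  have HE: "?H * E_mat n k (p (Suc k)) \<in> carrier_mat (2 * n) (2 * n)"
    by (rule mult_sq_carrier[OF H]) simp
  have e1: "ent (?H * E_mat n k (p (Suc k))) a b =
      ent ?H a b + root_coeff n k (p (Suc k)) (b - 1) * ent ?H a (b - 1)"
    if "a \<in> {1..2 * n}" "b \<in> {1..2 * n}" for a b
    using ent_mult_E[OF H that k(1,2)] .
  have "hook (E_mat n) n q p d (Suc j) = E_mat n k (q (Suc k)) * (?H * E_mat n k (p (Suc k)))"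
    unfolding hook.simps k(4,6) by (rule mult_sq_assoc[where N = "2 * n"]) simp_all
  then have "ent (hook (E_mat n) n q p d (Suc j)) a b = ent (?H * E_mat n k (p (Suc k))) a b
      + root_coeff n k (q (Suc k)) a * ent (?H * E_mat n k (p (Suc k))) (Suc a) b"
    using ent_E_mult[OF HE Suc.prems(2,3) k(1,2)] by simp
  also have "root_coeff n k (q (Suc k)) a * ent (?H * E_mat n k (p (Suc k))) (Suc a) b =
      root_coeff n k (q (Suc k)) a * (ent ?H (Suc a) b + root_coeff n k (p (Suc k)) (b - 1) * ent ?H (Suc a) (b - 1))"
    using e1[of "Suc a" b] root_coeff_outside[OF k(1,2), of a] Suc.prems(2,3) by (cases "a < 2 * n") auto
  finally show ?case
    unfolding k e1[OF Suc.prems(2,3)]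
    using hook_entry_step[OF k(1,3) Suc.prems(2,3), where H = "ent ?H" and p = p and q = q and d = d, OF IH]
    by simp
qed

lemma ent_transpose:
  assumes "A \<in> carrier_mat (2 * n) (2 * n)" "a \<in> {1..2 * n}" "b \<in> {1..2 * n}"
  shows "ent (transpose_mat A) a b = ent A b a"
  using assms by (auto simp: ent_def)

lemma transpose_F_mat: "transpose_mat (F_mat n k c) = E_mat n k c"
  by (rule eq_matI) (auto simp: F_mat_def E_mat_def mat_of_def)

text \<open>Transposition reverses the product. The generators of a hook form a palindrome, so the
  only effect on the parameters is that the left and the right list are exchanged.\<close>

lemma transpose_hook_F:
  "transpose_mat (hook (F_mat n) n q p d j) = hook (E_mat n) n p q d j"
proof (induction j)
  case (Suc j)
  have "transpose_mat (A * B * C) = transpose_mat C * transpose_mat B * transpose_mat A"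
    if "A \<in> carrier_mat (2 * n) (2 * n)" "B \<in> carrier_mat (2 * n) (2 * n)"
      "C \<in> carrier_mat (2 * n) (2 * n)" for A B C :: "'a mat"
  proof -
    have "A * B \<in> carrier_mat (2 * n) (2 * n)"
      and T: "transpose_mat A \<in> carrier_mat (2 * n) (2 * n)"
        "transpose_mat B \<in> carrier_mat (2 * n) (2 * n)"
        "transpose_mat C \<in> carrier_mat (2 * n) (2 * n)"
      using that by (auto intro!: mult_sq_carrier)
    then show ?thesis
      using that mult_sq_assoc[OF T(3,2,1)] by (simp add: transpose_mult[where nr = "2 * n" and n = "2 * n" and nc = "2 * n"])
  qed
  note tr = this
  show ?case
    unfolding hook.simps by (subst tr) (simp_all only: Suc transpose_F_mat F_mat_carrier hook_carrier)
qed (simp add: transpose_F_mat)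

lemma ent_hook_F:
  assumes "j < n" "a \<in> {1..2 * n}" "b \<in> {1..2 * n}"
  shows "ent (hook (F_mat n) n q p d j) a b =
    (if a \<in> {n - j..n + 1 + j} \<and> b \<in> {n - j..n + 1 + j} then hook_entry n p q d b a
     else if a = b then 1 else 0)"
proof -
  have "ent (hook (F_mat n) n q p d j) a b = ent (hook (E_mat n) n p q d j) b a"
    unfolding transpose_hook_F[symmetric] using assms by (subst ent_transpose[where n = n]) simp_all
  then show ?thesis using assms by (auto simp: ent_hook_E)
qed

lemma five_cases:
  fixes a k l :: nat
  obtains "a = k" | "a = Suc k" | "a = l" | "a = Suc l"
    | "a \<noteq> k" "a \<noteq> Suc k" "a \<noteq> l" "a \<noteq> Suc l"
  by blast

lemma ent_S_mult_less:
  assumes M: "(M::'a::field mat) \<in> carrier_mat (2 * n) (2 * n)"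
    and ab: "a \<in> {1..2 * n}" "b \<in> {1..2 * n}" and k: "1 \<le> k" "k < n"
  shows "ent (S_mat n k * M) a b =
    (if a = k then ent M (Suc k) b else if a = Suc k then - ent M k b
     else if a = 2 * n - k then - ent M (Suc (2 * n - k)) b
     else if a = Suc (2 * n - k) then ent M (2 * n - k) b else ent M a b)"
    and "ent (M * S_mat n k) a b =
    (if b = k then - ent M a (Suc k) else if b = Suc k then ent M a k
     else if b = 2 * n - k then ent M a (Suc (2 * n - k))
     else if b = Suc (2 * n - k) then - ent M a (2 * n - k) else ent M a b)"
proof -
  have g: "sgn_pos n k x = (if x = k then 1 else if x = 2 * n - k then - 1 else 0 :: 'a)" for x
    by (simp add: sgn_pos_def root_coeff_def)
  have p: "x - 1 = k \<longleftrightarrow> x = Suc k" "x - 1 = 2 * n - k \<longleftrightarrow> x = Suc (2 * n - k)"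
    if "x \<in> {1..2 * n}" for x
    using that k by auto
  have ne: "Suc k \<noteq> 2 * n - k" "k \<noteq> 2 * n - k" "k \<noteq> Suc (2 * n - k)"
    using k by auto
  have kn: "k \<le> n" using k by simp
  show "ent (S_mat n k * M) a b =
    (if a = k then ent M (Suc k) b else if a = Suc k then - ent M k b
     else if a = 2 * n - k then - ent M (Suc (2 * n - k)) b
     else if a = Suc (2 * n - k) then ent M (2 * n - k) b else ent M a b)"
    unfolding ent_S_mult[OF M ab k(1) kn] g p[OF ab(1)]
    by (rule five_cases[where a = a and k = k and l = "2 * n - k"]) (use ne in simp_all)
  show "ent (M * S_mat n k) a b =
    (if b = k then - ent M a (Suc k) else if b = Suc k then ent M a k
     else if b = 2 * n - k then ent M a (Suc (2 * n - k))
     else if b = Suc (2 * n - k) then - ent M a (2 * n - k) else ent M a b)"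
    unfolding ent_mult_S[OF M ab k(1) kn] g p[OF ab(2)]
    by (rule five_cases[where a = b and k = k and l = "2 * n - k"]) (use ne in simp_all)
qed

text \<open>The factor of \<open>w\<^sub>0\<close> from a single row is a lift of the reflection in the long root of row \<open>m\<close>;
  it exchanges the coordinates \<open>m\<close> and \<open>h\<close> and acts by \<open>- 1\<close> on those between them.\<close>

definition refl_entry :: "'a \<Rightarrow> nat \<Rightarrow> nat \<Rightarrow> nat \<Rightarrow> nat \<Rightarrow> 'a::field" where
  "refl_entry \<sigma> m h a b =
    (if a = m then (if b = h then \<sigma> else 0)
     else if a = h then (if b = m then - \<sigma> else 0)
     else if a \<noteq> b then 0 else if m < a \<and> a < h then - 1 else 1)"

text \<open>Here \<open>R a\<close> is the entry \<open>(a, b)\<close> after right multiplication by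
  \<open>S_k\<close>. As \<open>S_k\<close> stands on both sides, without an inverse, and squares to
  -1 on moved pairs, each layer negates the corner sign and leaves -1 on the two coordinates that
  become enclosed.\<close>

lemma refl_entry_step:
  fixes \<sigma> :: "'a::field"
  assumes "Suc k < l"
    and R: "\<And>a. R a = (if b = k then - refl_entry \<sigma> (Suc k) l a (Suc k)
       else if b = Suc k then refl_entry \<sigma> (Suc k) l a k
       else if b = l then refl_entry \<sigma> (Suc k) l a (Suc l)
       else if b = Suc l then - refl_entry \<sigma> (Suc k) l a l
       else refl_entry \<sigma> (Suc k) l a b)"
  shows "(if a = k then R (Suc k) else if a = Suc k then - R k
       else if a = l then - R (Suc l) else if a = Suc l then R l else R a) =
    refl_entry (- \<sigma>) k (Suc l) a b"
proof -
  have row: "refl_entry \<sigma> m h m b = (if b = h then \<sigma> else 0)"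
    "m < h \<Longrightarrow> refl_entry \<sigma> m h h b = (if b = m then - \<sigma> else 0)"
    "a \<noteq> m \<Longrightarrow> a \<noteq> h \<Longrightarrow> refl_entry \<sigma> m h a b =
      (if a \<noteq> b then 0 else if m < a \<and> a < h then - 1 else 1)" for \<sigma> :: 'a and m h a b
    by (simp_all add: refl_entry_def)
  have ne: "k \<noteq> l" "l \<noteq> k" "Suc k \<noteq> l" "l \<noteq> Suc k" "k \<noteq> Suc l" "Suc l \<noteq> k" "k < Suc l"
    "\<not> l < k" "\<not> Suc l < k" "\<not> Suc l < l" "Suc k < Suc l"
    using assms(1) by auto
  show ?thesis
  proof (rule five_cases[where a = a and k = k and l = l])
    assume "a = k"
    then show ?thesis unfolding R using assms(1) by (auto simp: row ne)
  next
    assume "a = Suc k"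
    then show ?thesis unfolding R using assms(1) by (auto simp: row ne)
  next
    assume "a = l"
    then show ?thesis unfolding R using assms(1) by (auto simp: row ne)
  next
    assume "a = Suc l"
    then show ?thesis unfolding R using assms(1) by (auto simp: row ne)
  next
    assume a: "a \<noteq> k" "a \<noteq> Suc k" "a \<noteq> l" "a \<noteq> Suc l"
    then have "(k < a \<and> a < Suc l) = (Suc k < a \<and> a < l)" by auto
    then show ?thesis unfolding R using a by (auto simp: row(3) ne)
  qed
qed

lemma ent_hook_S:
  assumes "j < n" "a \<in> {1..2 * n}" "b \<in> {1..2 * n}"
  shows "ent (hook (\<lambda>k _. S_mat n k) n q p d j) a b =
    refl_entry ((- 1 :: 'a::field) ^ j) (n - j) (n + 1 + j) a b"
  using assms
proof (induction j arbitrary: a b)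
  case 0
  have g: "sgn_pos n n x = (if x = n then 1 else 0 :: 'a)" for x
    by (simp add: sgn_pos_def root_coeff_def)
  have p: "a - 1 = n \<longleftrightarrow> a = Suc n" using 0(2) by auto
  have n: "1 \<le> n" "Suc n \<in> {1..2 * n}" "n \<in> {1..2 * n}" using 0(1) by auto
  have "ent (S_mat n n * 1\<^sub>m (2 * n)) a b =
      (if a = n then ent (1\<^sub>m (2 * n)) (Suc n) b else if a = Suc n then - ent (1\<^sub>m (2 * n)) n b
       else ent (1\<^sub>m (2 * n)) a b :: 'a)"
    unfolding ent_S_mult[OF one_carrier_mat 0(2,3) n(1) order_refl] g p by simp
  also have "\<dots> = refl_entry (1 :: 'a) n (Suc n) a b"
    unfolding ent_one[OF n(2) 0(3)] ent_one[OF n(3) 0(3)] ent_one[OF 0(2,3)]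
    by (auto simp: refl_entry_def)
  finally have "ent (S_mat n n * 1\<^sub>m (2 * n)) a b = refl_entry (1 :: 'a) n (Suc n) a b" .
  then show ?case by (simp add: right_mult_one_mat[OF S_mat_carrier])
next
  case (Suc j)
  define k where "k = n - Suc j"
  define l where "l = 2 * n - k"
  have k: "1 \<le> k" "k < n" "n - j = Suc k" "n + 1 + j = l" "n - Suc j = k" "n + 1 + Suc j = Suc l"
    using Suc.prems by (auto simp: k_def l_def)
  have l: "Suc k < l" "l < 2 * n" using k(1,2) by (auto simp: l_def)
  let ?H = "hook (\<lambda>k _. S_mat n k) n q p d j :: 'a mat"
  have H: "?H \<in> carrier_mat (2 * n) (2 * n)" by simp
  have IH: "ent ?H a b = refl_entry ((- 1) ^ j) (Suc k) l a b"
    if "a \<in> {1..2 * n}" "b \<in> {1..2 * n}" for a b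
    using Suc.IH[OF _ that] Suc.prems(1) unfolding k by simp
  have HS: "?H * S_mat n k \<in> carrier_mat (2 * n) (2 * n)"
    by (rule mult_sq_carrier[OF H]) simp
  have in_range: "k \<in> {1..2 * n}" "Suc k \<in> {1..2 * n}" "l \<in> {1..2 * n}" "Suc l \<in> {1..2 * n}"
    using k(1) l by auto
  have e1: "ent (?H * S_mat n k) a b =
      (if b = k then - refl_entry ((- 1) ^ j) (Suc k) l a (Suc k)
       else if b = Suc k then refl_entry ((- 1) ^ j) (Suc k) l a k
       else if b = l then refl_entry ((- 1) ^ j) (Suc k) l a (Suc l)
       else if b = Suc l then - refl_entry ((- 1) ^ j) (Suc k) l a l
       else refl_entry ((- 1) ^ j) (Suc k) l a b)"
    if "a \<in> {1..2 * n}" "b \<in> {1..2 * n}" for a b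
    unfolding ent_S_mult_less(2)[OF H that k(1,2)] l_def[symmetric]
    by (simp only: IH[OF that(1)] in_range that)
  have "hook (\<lambda>k _. S_mat n k) n q p d (Suc j) = S_mat n k * (?H * S_mat n k)"
    unfolding hook.simps k(3,5) by (rule mult_sq_assoc[where N = "2 * n"]) simp_all
  then have e2: "ent (hook (\<lambda>k _. S_mat n k) n q p d (Suc j)) a b =
      (if a = k then ent (?H * S_mat n k) (Suc k) b else if a = Suc k then - ent (?H * S_mat n k) k b
       else if a = l then - ent (?H * S_mat n k) (Suc l) b
       else if a = Suc l then ent (?H * S_mat n k) l b
       else ent (?H * S_mat n k) a b)"
    using ent_S_mult_less(1)[OF HS Suc.prems(2,3) k(1,2)] unfolding l_def by (simp only:)
  show ?case
    unfolding e2 k(5,6) e1[OF Suc.prems(2,3)] e1[OF in_range(1) Suc.prems(3)]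
      e1[OF in_range(2) Suc.prems(3)] e1[OF in_range(3) Suc.prems(3)] e1[OF in_range(4) Suc.prems(3)]
    by (subst refl_entry_step[OF l(1) refl]) simp
qed

section \<open>Words in the generators\<close>

definition word_mat :: "nat \<Rightarrow> (nat \<Rightarrow> 'b \<Rightarrow> 'a::field mat) \<Rightarrow> ('b \<times> nat) list \<Rightarrow> 'a mat" where
  "word_mat n G w = mat_prod n (map (\<lambda>(v, k). G k v) w)"

lemma word_mat_Nil [simp]: "word_mat n G [] = 1\<^sub>m (2 * n)"
  and word_mat_Cons [simp]: "word_mat n G ((v, k) # w) = G k v * word_mat n G w"
  by (simp_all add: word_mat_def mat_prod_def)

lemma word_mat_carrier [simp]:
  assumes "\<And>k v. G k v \<in> carrier_mat (2 * n) (2 * n)"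
  shows "word_mat n G w \<in> carrier_mat (2 * n) (2 * n)"
  by (induction w) (auto simp: assms intro!: mult_sq_carrier)

lemma word_mat_append:
  assumes "\<And>k v. G k v \<in> carrier_mat (2 * n) (2 * n)"
  shows "word_mat n G (w @ w') = word_mat n G w * word_mat n G w'"
proof (induction w)
  case Nil
  have "word_mat n G w' \<in> carrier_mat (2 * n) (2 * n)" using assms by simp
  then show ?case by simp
next
  case (Cons x w)
  show ?case
    using Cons by (cases x) (simp add: mult_sq_assoc[where N = "2 * n"] assms)
qed

lemma word_mat_cong:
  assumes "\<And>v k. (v, k) \<in> set w \<Longrightarrow> G k v = G' k v"
  shows "word_mat n G w = word_mat n G' w"
  using assms by (induction w) auto

lemma hook_word:
  assumes G: "\<And>k v. G k v \<in> carrier_mat (2 * n) (2 * n)" and j: "j \<le> n"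
  shows "word_mat n G (map (\<lambda>l. (A l, l - 1)) [n - j + 1..<n + 1] @ [(d, n)] @
      map (\<lambda>l. (B l, l - 1)) (rev [n - j + 1..<n + 1])) = hook G n A B d j"
  using j
proof (induction j)
  case 0
  then show ?case using G by (simp add: right_mult_one_mat[OF G])
next
  case (Suc j)
  have "n - Suc j + 1 = n - j" "n - j - 1 = n - Suc j" "[n - j..<n + 1] = (n - j) # [n - j + 1..<n + 1]"
    using Suc.prems by (auto simp: upt_conv_Cons)
  then have "map (\<lambda>l. (A l, l - 1)) [n - Suc j + 1..<n + 1] @ [(d, n)] @
      map (\<lambda>l. (B l, l - 1)) (rev [n - Suc j + 1..<n + 1]) =
    [(A (n - j), n - Suc j)] @ (map (\<lambda>l. (A l, l - 1)) [n - j + 1..<n + 1] @ [(d, n)] @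
      map (\<lambda>l. (B l, l - 1)) (rev [n - j + 1..<n + 1])) @ [(B (n - j), n - Suc j)]"
    by simp
  then have "word_mat n G (map (\<lambda>l. (A l, l - 1)) [n - Suc j + 1..<n + 1] @ [(d, n)] @
      map (\<lambda>l. (B l, l - 1)) (rev [n - Suc j + 1..<n + 1])) =
    G (n - Suc j) (A (n - j)) * (hook G n A B d j * G (n - Suc j) (B (n - j)))"
    using Suc.IH Suc.prems
    by (simp only: word_mat_append[OF G] Suc_leD word_mat_Cons word_mat_Nil right_mult_one_mat[OF G])
  then show ?case
    by (simp add: mult_sq_assoc[where N = "2 * n"] G)
qed

text \<open>The hook is taken with the names of the parameters as arguments;
  \<open>hook_param\<close> substitutes values. The reversed word is again a hook, with the two
  lists exchanged, and serves for inverses.\<close>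

lemma R_word_hook:
  assumes G: "\<And>k v. G k v \<in> carrier_mat (2 * n) (2 * n)" and i: "i \<le> n"
  shows "word_mat n G (R_word n i) = hook G n (ParS i) (ParT i) (ParD i) (n - i)"
    and "word_mat n G (rev (R_word n i)) = hook G n (ParT i) (ParS i) (ParD i) (n - i)"
proof -
  have e: "n - (n - i) = i" using i by simp
  show "word_mat n G (R_word n i) = hook G n (ParS i) (ParT i) (ParD i) (n - i)"
    unfolding R_word_def
    by (rule hook_word[OF G diff_le_self[of n i], where A = "ParS i" and B = "ParT i" and d = "ParD i", unfolded e])
  have "rev (R_word n i) = map (\<lambda>l. (ParT i l, l - 1)) [i + 1..<n + 1] @ [(ParD i, n)] @
      map (\<lambda>l. (ParS i l, l - 1)) (rev [i + 1..<n + 1])"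
    by (simp add: R_word_def rev_map del: upt_Suc)
  then show "word_mat n G (rev (R_word n i)) = hook G n (ParT i) (ParS i) (ParD i) (n - i)"
    using hook_word[OF G diff_le_self[of n i], where A = "ParT i" and B = "ParS i" and d = "ParD i", unfolded e]
    by (simp only:)
qed

lemma hook_param:
  "hook (\<lambda>k v. G k (x v)) n q p d j = hook G n (\<lambda>i. x (q i)) (\<lambda>i. x (p i)) (x d) j"
  by (induction j) simp_all

text \<open>The rows \<open>n, ..., i\<close> in the order of the product. The empty tail at
  \<open>Suc n\<close> starts the descending induction, and each further row is appended on the
  right.\<close>

definition X_tail :: "nat \<Rightarrow> nat \<Rightarrow> (param \<times> nat) list" where
  "X_tail n i = concat (map (R_word n) (rev [i..<n + 1]))"

lemma X_word_tail: "X_word n = X_tail n 1"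
  by (simp add: X_word_def X_tail_def)

lemma X_tail_empty [simp]: "X_tail n (Suc n) = []"
  by (simp add: X_tail_def)

lemma X_tail_rec: "i \<le> n \<Longrightarrow> X_tail n i = X_tail n (Suc i) @ R_word n i"
  unfolding X_tail_def by (subst upt_conv_Cons) (simp_all del: upt_Suc)

lemma R_word_bounds:
  assumes "(v, k) \<in> set (R_word n i)" "i \<le> n"
  shows "i \<le> k \<and> k \<le> n \<and>
    ((\<exists>j. i < j \<and> j \<le> n \<and> k = j - 1 \<and> (v = ParT i j \<or> v = ParS i j)) \<or> v = ParD i \<and> k = n)"
  using assms by (auto simp: R_word_def)

text \<open>What matters later is \<open>i \<le> k\<close>: a tail starting at row \<open>i\<close>
  leaves alone all coordinates outside the range from \<open>i\<close> to
  \<open>hat n i\<close>.\<close>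

lemma X_tail_bounds:
  assumes "(v, k) \<in> set (X_tail n i)"
  obtains i' where "i \<le> i'" "i' \<le> n" "i' \<le> k" "k \<le> n"
    "(\<exists>j. i' < j \<and> j \<le> n \<and> k = j - 1 \<and> (v = ParT i' j \<or> v = ParS i' j)) \<or> v = ParD i' \<and> k = n"
proof -
  have "\<exists>i'\<in>set [i..<n + 1]. (v, k) \<in> set (R_word n i')"
    using assms by (simp add: X_tail_def del: upt_Suc)
  then obtain i' where "i \<le> i'" "i' \<le> n" "(v, k) \<in> set (R_word n i')"
    by (auto simp del: upt_Suc)
  then show ?thesis using R_word_bounds[of v k n i'] that[of i'] by blast
qed

lemma X_word_bounds:
  assumes "(v, k) \<in> set (X_word n)"
  shows "1 \<le> k" "k \<le> n" "v \<in> params n"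
  using assms unfolding X_word_tail
  by (auto elim!: X_tail_bounds simp: params_def)

lemma X_mat_word: "X_mat n x = word_mat n (\<lambda>k v. E_mat n k (x v)) (X_word n)"
proof -
  have "X_mat n x = word_mat n (\<lambda>k v. nil_exp (x v \<cdot>\<^sub>m e_gen n k)) (X_word n)"
    by (simp add: X_mat_def word_mat_def)
  also have "\<dots> = word_mat n (\<lambda>k v. E_mat n k (x v)) (X_word n)"
    by (rule word_mat_cong) (use X_word_bounds nil_exp_e_gen in blast)
  finally show ?thesis .
qed

lemma w0_mat_word: "w0_mat n = word_mat n (\<lambda>k _. S_mat n k) (X_word n)"
proof -
  have "w0_mat n = word_mat n
      (\<lambda>k v. nil_exp (e_gen n k) * nil_exp (- f_gen n k) * nil_exp (e_gen n k)) (X_word n)"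
    by (simp add: w0_mat_def word_mat_def)
  also have "\<dots> = word_mat n (\<lambda>k _. S_mat n k) (X_word n)"
    by (rule word_mat_cong)
       (use X_word_bounds in \<open>metis S_mat_def nil_exp_e_gen_one nil_exp_f_gen\<close>)
  finally show ?thesis .
qed

section \<open>The longest Weyl group element\<close>

lemma ent_mult_single:
  fixes A B :: "'a::field mat"
  assumes "A \<in> carrier_mat (2 * n) (2 * n)" "B \<in> carrier_mat (2 * n) (2 * n)"
    and "a \<in> {1..2 * n}" "b \<in> {1..2 * n}" "c \<in> {1..2 * n}"
    and "\<And>d. d \<in> {1..2 * n} \<Longrightarrow> d \<noteq> c \<Longrightarrow> ent A a d = 0"
  shows "ent (A * B) a b = ent A a c * ent B c b"
proof -
  have "ent (A * B) a b = (\<Sum>d\<in>{c}. ent A a d * ent B d b)"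
    unfolding ent_mult[OF assms(1-4)]
    by (rule sum.mono_neutral_right) (use assms(5,6) in auto)
  then show ?thesis by simp
qed

text \<open>The shape of the product over rows \<open>i, ..., n\<close>: the longest element for the
  coordinates from \<open>i\<close> to \<open>hat n i\<close>, padded by the identity.\<close>

definition antidiag_entry :: "'a \<Rightarrow> nat \<Rightarrow> nat \<Rightarrow> nat \<Rightarrow> nat \<Rightarrow> 'a::field" where
  "antidiag_entry \<sigma> n i a b =
    (if i \<le> a \<and> a \<le> hat n i then (if b = hat n a then (if a \<le> n then \<sigma> else - \<sigma>) else 0)
     else if a = b then 1 else 0)"

abbreviation S_word :: "nat \<Rightarrow> (param \<times> nat) list \<Rightarrow> 'a::field mat" where
  "S_word n \<equiv> word_mat n (\<lambda>k _. S_mat n k)"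

abbreviation E_word :: "nat \<Rightarrow> (param \<Rightarrow> 'a) \<Rightarrow> (param \<times> nat) list \<Rightarrow> 'a::field mat" where
  "E_word n x \<equiv> word_mat n (\<lambda>k v. E_mat n k (x v))"

abbreviation F_word :: "nat \<Rightarrow> (param \<Rightarrow> 'a) \<Rightarrow> (param \<times> nat) list \<Rightarrow> 'a::field mat" where
  "F_word n x \<equiv> word_mat n (\<lambda>k v. F_mat n k (x v))"

lemma ent_S_word_R:
  assumes "1 \<le> i" "i \<le> n" "a \<in> {1..2 * n}" "b \<in> {1..2 * n}"
  shows "ent (S_word n (R_word n i)) a b = refl_entry ((- 1 :: 'a::field) ^ (n - i)) i (hat n i) a b"
proof -
  have "n - (n - i) = i" "n + 1 + (n - i) = hat n i"
    using assms(1,2) by (auto simp: hat_def)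
  then show ?thesis
    using assms by (simp only: R_word_hook(1)[OF S_mat_carrier]) (subst ent_hook_S, auto)
qed

text \<open>Row \<open>i\<close> exchanges the outer coordinates \<open>i\<close> and
  \<open>hat n i\<close> and acts by -1 between them, which negates the antidiagonal already built;
  hence the sign \<open>\<sigma>\<close> alternates with \<open>i\<close>.\<close>

lemma ent_S_word_tail:
  assumes "1 \<le> i" "i \<le> n" "a \<in> {1..2 * n}" "b \<in> {1..2 * n}"
  shows "ent (S_word n (X_tail n i)) a b = antidiag_entry ((- 1 :: 'a::field) ^ (n - i)) n i a b"
  using assms(2,1,3,4)
proof (induction i arbitrary: a b rule: inc_induct)
  case base
  have W: "S_word n (R_word n n) \<in> carrier_mat (2 * n) (2 * n)" by simp
  have "S_word n (X_tail n n) = (S_word n (R_word n n) :: 'a mat)"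
    by (simp add: X_tail_rec left_mult_one_mat[OF W])
  then have "ent (S_word n (X_tail n n)) a b = refl_entry ((- 1 :: 'a::field) ^ (n - n)) n (hat n n) a b"
    using ent_S_word_R[OF base(1) order_refl base(2,3), where 'a = 'a] by simp
  moreover have "hat n n = Suc n" "hat n (Suc n) = n" by (auto simp: hat_def)
  ultimately show ?case
    by (auto simp: refl_entry_def antidiag_entry_def)
next
  case (step i)
  define h where "h = hat n i"
  have h: "hat n (Suc i) = h - 1" "i < h - 1" "Suc i \<le> h - 1" "h \<le> 2 * n" "n < h"
    "hat n i = h" "hat n h = i" "i \<le> n" "1 \<le> i"
    using step.hyps step.prems by (auto simp: hat_def h_def)
  define \<sigma> where "\<sigma> = (- 1 :: 'a) ^ (n - Suc i)"
  have \<sigma>: "(- 1 :: 'a) ^ (n - i) = - \<sigma>"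
    using step.hyps by (simp add: \<sigma>_def flip: Suc_diff_Suc)
  let ?W = "S_word n (R_word n i) :: 'a mat"
  have W: "ent ?W a b = refl_entry (- \<sigma>) i h a b" if "a \<in> {1..2 * n}" "b \<in> {1..2 * n}" for a b
    using ent_S_word_R[OF h(9,8) that, where 'a = 'a] unfolding \<sigma> h_def .
  have IH: "ent (S_word n (X_tail n (Suc i))) a b = antidiag_entry \<sigma> n (Suc i) a b"
    if "a \<in> {1..2 * n}" "b \<in> {1..2 * n}" for a b
    using step.IH[of a b] that by (simp add: \<sigma>_def)
  have eq: "S_word n (X_tail n i) = S_word n (X_tail n (Suc i)) * ?W"
    using h(8) by (simp add: X_tail_rec word_mat_append)
  define a' where "a' = hat n a"
  have a': "a' \<in> {1..2 * n}" "a' = hat n a" using step.prems(2) by (auto simp: a'_def hat_def)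
  have flip: "Suc i \<le> a' \<and> a' \<le> h - 1 \<longleftrightarrow> Suc i \<le> a \<and> a \<le> h - 1"
    "a \<noteq> i \<Longrightarrow> a' \<noteq> h" "a \<noteq> h \<Longrightarrow> a' \<noteq> i"
    using step.prems(2) h(8,9) by (auto simp: a'_def hat_def h_def)
  show ?case
  proof (cases "Suc i \<le> a \<and> a \<le> h - 1")
    case True
    then have "ent (S_word n (X_tail n i)) a b = (if a \<le> n then \<sigma> else - \<sigma>) * refl_entry (- \<sigma>) i h a' b"
      unfolding eq using step.prems a'(1)
      by (subst ent_mult_single[where c = a' and n = n]) (simp_all add: IH W antidiag_entry_def h a'(2)[symmetric])
    also have "refl_entry (- \<sigma>) i h a' b = (if a' = b then - 1 else 0)"
      using True flip h(2) by (auto simp: refl_entry_def)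
    also have "(if a \<le> n then \<sigma> else - \<sigma>) * (if a' = b then - 1 else 0) = antidiag_entry (- \<sigma>) n i a b"
      using True h(2) by (auto simp: antidiag_entry_def h a'(2))
    finally show ?thesis by (simp add: \<sigma>)
  next
    case False
    have "ent (S_word n (X_tail n (Suc i))) a d = (if a = d then 1 else 0 :: 'a)" if "d \<in> {1..2 * n}" for d
      unfolding IH[OF step.prems(2) that] antidiag_entry_def h(1) if_not_P[OF False] ..
    then have "ent (S_word n (X_tail n i)) a b = refl_entry (- \<sigma>) i h a b"
      unfolding eq using step.prems
      by (subst ent_mult_single[where c = a and n = n]) (simp_all add: W)
    also have "\<dots> = antidiag_entry (- \<sigma>) n i a b"
    proof -
      consider "a = i" | "a = h" | "a < i \<or> h < a" using False by linarith
      then show ?thesis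
      proof cases
        case 1
        have "i \<le> h" using h(2) by simp
        then show ?thesis using h(6,8) by (simp add: 1 refl_entry_def antidiag_entry_def)
      next
        case 2
        have "i \<le> h" "i \<noteq> h" "\<not> h \<le> n" using h(2,5) by auto
        then show ?thesis using h(6,7) by (simp add: 2 refl_entry_def antidiag_entry_def)
      next
        case 3
        then have "\<not> (i \<le> a \<and> a \<le> h)" "a \<noteq> i" "a \<noteq> h" "\<not> (i < a \<and> a < h)"
          using h(2) by auto
        then show ?thesis unfolding refl_entry_def antidiag_entry_def h(6) by (cases "a = b") (simp_all only: if_False if_True simp_thms)
      qed
    qed
    finally show ?thesis by (simp add: \<sigma>)
  qed
qed

section \<open>The matrix of the symplectic form\<close>

lemma root_coeff_scale: "root_coeff n k c a = c * root_coeff n k 1 a"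
  by (simp add: root_coeff_def)

text \<open>For \<open>\<sigma> = 1\<close> this is the Gram matrix of \<open>symp_form\<close>, and
  for \<open>\<sigma> = (- 1) ^ (n - 1)\<close> it is \<open>w0_mat\<close> when
  \<open>n \<ge> 1\<close>. With the scalar kept free, \<open>E_form\<close> serves both
  purposes.\<close>

definition form_mat :: "nat \<Rightarrow> 'a::field \<Rightarrow> 'a mat" where
  "form_mat n \<sigma> = mat_of n (\<lambda>a b. if b = hat n a then (if a \<le> n then \<sigma> else - \<sigma>) else 0)"

lemma form_mat_carrier [simp]: "form_mat n \<sigma> \<in> carrier_mat (2 * n) (2 * n)"
  by (simp add: form_mat_def)

lemma ent_form_mat:
  assumes "a \<in> {1..2 * n}" "b \<in> {1..2 * n}"
  shows "ent (form_mat n \<sigma>) a b = (if a + b = 2 * n + 1 then (if a \<le> n then \<sigma> else - \<sigma>) else 0)"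
  using assms by (auto simp: form_mat_def hat_def)

lemma S_word_tail_one:
  assumes "1 \<le> n"
  shows "S_word n (X_tail n 1) = form_mat n ((- 1 :: 'a::field) ^ (n - 1))"
proof (rule mat_eqI_ent[of _ n])
  fix a b assume ab: "a \<in> {1..2 * n}" "b \<in> {1..2 * n}"
  show "ent (S_word n (X_tail n 1)) a b = ent (form_mat n ((- 1 :: 'a) ^ (n - 1))) a b"
    unfolding ent_S_word_tail[OF order_refl assms ab] using ab
    by (auto simp: antidiag_entry_def form_mat_def hat_def)
qed simp_all

text \<open>Since \<open>e_k\<close> is the transpose of \<open>f_k\<close>, membership of
  \<open>f_k\<close> in the symplectic Lie algebra reads \<open>e_k J = - J f_k\<close> for the
  matrix \<open>J\<close> of the form, and both exponentials are affine in \<open>c\<close>.\<close>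

lemma E_form:
  assumes k: "1 \<le> k" "k \<le> n"
  shows "E_mat n k (- c) * form_mat n \<sigma> = form_mat n \<sigma> * F_mat n k (c :: 'a::field)"
proof (rule mat_eqI_ent[of _ n])
  fix a b assume ab: "a \<in> {1..2 * n}" "b \<in> {1..2 * n}"
  have 1: "root_coeff n k (- c) a * ent (form_mat n \<sigma>) (Suc a) b =
      (if a + b = 2 * n then - c * root_coeff n k 1 a * (if a < n then \<sigma> else - \<sigma>) else 0)"
  proof (cases "a < 2 * n")
    case True
    then show ?thesis using ent_form_mat[of "Suc a" n b \<sigma>] ab by (subst root_coeff_scale) auto
  next
    case False
    then show ?thesis using root_coeff_outside[OF k, of a] ab by auto
  qed
  have 2: "root_coeff n k c b * ent (form_mat n \<sigma>) a (Suc b) =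
      (if a + b = 2 * n then c * root_coeff n k 1 b * (if a \<le> n then \<sigma> else - \<sigma>) else 0)"
  proof (cases "b < 2 * n")
    case True
    then show ?thesis using ent_form_mat[of a n "Suc b" \<sigma>] ab by (subst root_coeff_scale) auto
  next
    case False
    then show ?thesis using root_coeff_outside[OF k, of b] ab by auto
  qed
  \<comment> \<open>Where \<open>a + b = 2 * n\<close>, the two coefficients are opposite unless
    \<open>a = n\<close>; in that case the two entries of the form have opposite signs
    instead.\<close>
  have 3: "- c * root_coeff n k 1 a * (if a < n then \<sigma> else - \<sigma>) = c * root_coeff n k 1 b * (if a \<le> n then \<sigma> else - \<sigma>)"
    if s: "a + b = 2 * n"
  proof (cases "a = n")
    case True
    then have "b = n" using s by simp
    then show ?thesis using True by simp
  next
    case False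
    have b: "b = 2 * n - a" using s by simp
    have "root_coeff n k (1 :: 'a) b = - root_coeff n k 1 a"
      using False k ab unfolding root_coeff_def b by auto
    then show ?thesis using False by auto
  qed
  show "ent (E_mat n k (- c) * form_mat n \<sigma>) a b = ent (form_mat n \<sigma> * F_mat n k c) a b"
    unfolding ent_E_mult[OF form_mat_carrier ab k] ent_mult_F[OF form_mat_carrier ab k] 1 2 using 3 by simp
qed (auto intro!: mult_sq_carrier)

text \<open>Serves three times: for conjugation by \<open>w0_mat\<close>, for moving a torus factor,
  and for moving a reflection past later rows.\<close>

lemma word_intertwine:
  assumes A: "\<And>k v. A k v \<in> carrier_mat (2 * n) (2 * n)" and B: "\<And>k v. B k v \<in> carrier_mat (2 * n) (2 * n)"
    and M: "(M :: 'a::field mat) \<in> carrier_mat (2 * n) (2 * n)"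
    and c: "\<And>v k. (v, k) \<in> set w \<Longrightarrow> A k v * M = M * B k v"
  shows "word_mat n A w * M = M * word_mat n B w"
  using c
proof (induction w)
  case Nil
  then show ?case using M by simp
next
  case (Cons x w)
  obtain v k where x: "x = (v, k)" by force
  have "A k v * word_mat n A w * M = A k v * (word_mat n A w * M)"
    using A M by (intro mult_sq_assoc[where N = "2 * n"]) simp_all
  also have "\<dots> = A k v * (M * word_mat n B w)"
    using Cons by simp
  also have "\<dots> = A k v * M * word_mat n B w"
    using A B M by (intro mult_sq_assoc[where N = "2 * n", symmetric]) simp_all
  also have "\<dots> = M * B k v * word_mat n B w"
    using Cons.prems x by simp
  also have "\<dots> = M * (B k v * word_mat n B w)"
    using A B M by (intro mult_sq_assoc[where N = "2 * n"]) simp_all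
  finally show ?case by (simp add: x)
qed

lemma X_neg_mult_w0:
  "X_mat n (\<lambda>v. - x v) * w0_mat n = S_word n (X_tail n 1) * F_word n x (X_tail n 1 :: _ list)"
  for x :: "param \<Rightarrow> 'a::field"
  unfolding X_mat_word w0_mat_word X_word_tail
proof (rule word_intertwine)
  fix v k assume "(v, k) \<in> set (X_tail n 1)"
  then have "1 \<le> k" "k \<le> n" using X_word_bounds[of v k n] by (simp_all only: X_word_tail)
  then show "E_mat n k (- x v) * S_word n (X_tail n 1) = S_word n (X_tail n 1) * F_mat n k (x v)"
    using S_word_tail_one[of n, where 'a = 'a] by (simp add: E_form)
qed simp_all

text \<open>The reflection of row \<open>i\<close> is the scalar -1 on the coordinates strictly
  between \<open>i\<close> and \<open>hat n i\<close>, and a factor with \<open>k > i\<close>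
  differs from the identity only there.\<close>

lemma refl_commute_F:
  assumes "1 \<le> i" "i < k" "k \<le> n"
  shows "F_mat n k c * S_word n (R_word n i) = S_word n (R_word n i) * F_mat n k (c :: 'a::field)"
proof (rule mat_eqI_ent[of _ n])
  let ?W = "S_word n (R_word n i) :: 'a mat"
  have k: "1 \<le> k" "k \<le> n" and i: "i \<le> n" using assms by auto
  define h where "h = hat n i"
  have W: "ent ?W a b = refl_entry ((- 1) ^ (n - i)) i h a b" if "a \<in> {1..2 * n}" "b \<in> {1..2 * n}" for a b
    using ent_S_word_R[OF assms(1) i that, where 'a = 'a] by (simp add: h_def)
  have g: "i < x \<and> Suc x < h" if "root_coeff n k c x \<noteq> 0" for x
    using that assms by (auto simp: root_coeff_def h_def hat_def split: if_splits)
  fix a b assume ab: "a \<in> {1..2 * n}" "b \<in> {1..2 * n}"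
  have Wc: "?W \<in> carrier_mat (2 * n) (2 * n)" by simp
  have h: "h \<le> 2 * n" using assms by (auto simp: h_def hat_def)
  have 1: "root_coeff n k c (a - 1) * ent ?W (a - 1) b = (if a = Suc b then - root_coeff n k c b else 0)"
  proof (cases "root_coeff n k c (a - 1) = 0")
    case True
    then show ?thesis by auto
  next
    case False
    then have r: "i < a - 1" "a - 1 < h" "a - 1 \<in> {1..2 * n}" using g[of "a - 1"] h by auto
    then show ?thesis unfolding W[OF r(3) ab(2)] using r by (auto simp: refl_entry_def)
  qed
  have 2: "root_coeff n k c b * ent ?W a (Suc b) = (if a = Suc b then - root_coeff n k c b else 0)"
  proof (cases "root_coeff n k c b = 0")
    case True
    then show ?thesis by auto
  next
    case False
    then have r: "i < Suc b" "Suc b < h" "Suc b \<in> {1..2 * n}" using g[of b] h by auto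
    then show ?thesis unfolding W[OF ab(1) r(3)] using r by (auto simp: refl_entry_def)
  qed
  show "ent (F_mat n k c * ?W) a b = ent (?W * F_mat n k c) a b"
    unfolding ent_F_mult[OF Wc ab k] ent_mult_F[OF Wc ab k] 1 2 ..
qed (auto intro!: mult_sq_carrier)

section \<open>The factorization of one row\<close>

text \<open>One row in isolation, with value 1 at equal indices. As \<open>u i\<close> is 1 and not
  2, the equation \<open>u j = t j + s j\<close> is asked for \<open>j > i\<close> only.\<close>

locale hook_params =
  fixes n i :: nat and s t u :: "nat \<Rightarrow> 'a::field" and d :: 'a
  assumes i: "1 \<le> i" "i \<le> n"
    and base: "s i = 1" "t i = 1" "u i = 1"
    and u_eq: "\<And>j. i < j \<Longrightarrow> j \<le> n \<Longrightarrow> u j = t j + s j"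
    and nz: "\<And>j. i \<le> j \<Longrightarrow> j \<le> n \<Longrightarrow> s j \<noteq> 0" "\<And>j. i \<le> j \<Longrightarrow> j \<le> n \<Longrightarrow> t j \<noteq> 0"
      "\<And>j. i \<le> j \<Longrightarrow> j \<le> n \<Longrightarrow> u j \<noteq> 0" "d \<noteq> 0"
begin

text \<open>The solution for a row standing alone, that is, the general formulas with the products
  over \<open>k < i\<close> removed.\<close>

definition p' :: "nat \<Rightarrow> 'a" where "p' j = u (j - 1) / (u j * s (j - 1))"
definition q' :: "nat \<Rightarrow> 'a" where "q' j = p' j * (s j / t j)"
definition d' :: 'a where "d' = (u n)\<^sup>2 / (d * (s n)\<^sup>2)"
definition S :: "nat \<Rightarrow> 'a" where "S a = prod s {i<..a}"
definition T :: "nat \<Rightarrow> 'a" where "T a = prod t {i<..a}"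
definition sg :: "nat \<Rightarrow> 'a" where "sg a = (- 1) ^ a"

lemma sg_sq: "sg a * sg a = 1"
  by (simp add: sg_def flip: power_mult_distrib)

lemma sg_diff: "b \<le> a \<Longrightarrow> (- 1) ^ (a - b) = sg a * sg b"
proof -
  assume "b \<le> a"
  then have "sg a = (- 1) ^ (a - b) * sg b"
    by (simp add: sg_def flip: power_add)
  then show ?thesis by (simp add: mult.assoc sg_sq)
qed

lemma S_nz: "a \<le> n \<Longrightarrow> S a \<noteq> 0" and T_nz: "a \<le> n \<Longrightarrow> T a \<noteq> 0"
  using nz(1,2) by (auto simp: S_def T_def)

lemma S_base: "S i = 1" and T_base: "T i = 1"
  by (simp_all add: S_def T_def)

lemma prod_greaterThanAtMost_Suc: "a \<le> m \<Longrightarrow> prod f {a<..Suc m} = prod f {a<..m} * f (Suc m)"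
  for f :: "nat \<Rightarrow> 'a"
proof -
  assume "a \<le> m"
  then have "{a<..Suc m} = insert (Suc m) {a<..m}" by auto
  then show ?thesis by (simp add: mult.commute)
qed

lemma S_Suc: "i \<le> a \<Longrightarrow> S (Suc a) = S a * s (Suc a)" and T_Suc: "i \<le> a \<Longrightarrow> T (Suc a) = T a * t (Suc a)"
  by (simp_all add: S_def T_def prod_greaterThanAtMost_Suc)

lemma prod_s: "i \<le> a \<Longrightarrow> a \<le> m \<Longrightarrow> m \<le> n \<Longrightarrow> prod s {a<..m} = S m / S a"
  and prod_t: "i \<le> a \<Longrightarrow> a \<le> m \<Longrightarrow> m \<le> n \<Longrightarrow> prod t {a<..m} = T m / T a"
proof (induction m rule: nat_induct)
  case (Suc m)
  {
    case 1
    show ?case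
    proof (cases "a = Suc m")
      case True
      then show ?thesis using 1 S_nz by simp
    next
      case False
      then show ?thesis using 1 Suc(1) by (simp add: prod_greaterThanAtMost_Suc S_Suc)
    qed
  next
    case 2
    show ?case
    proof (cases "a = Suc m")
      case True
      then show ?thesis using 2 T_nz by simp
    next
      case False
      then show ?thesis using 2 Suc(2) by (simp add: prod_greaterThanAtMost_Suc T_Suc)
    qed
  }
qed (use i(1) in simp_all)

text \<open>Written as \<open>(u (j - 1) / s (j - 1)) * (s j / u j) / t j\<close>, the factors
  \<open>q' j\<close> telescope and leave a quotient of values of \<open>T\<close>; for
  \<open>p' j\<close> the last divisor is \<open>s j\<close>, which leaves \<open>S\<close>.\<close>

lemma prod_q: "i \<le> a \<Longrightarrow> a \<le> m \<Longrightarrow> m \<le> n \<Longrightarrow> prod q' {a<..m} = (u a * s m * T a) / (u m * s a * T m)"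
  and prod_p: "i \<le> a \<Longrightarrow> a \<le> m \<Longrightarrow> m \<le> n \<Longrightarrow> prod p' {a<..m} = (u a * s m * S a) / (u m * s a * S m)"
proof (induction m rule: nat_induct)
  case (Suc m)
  {
    case 1
    show ?case
    proof (cases "a = Suc m")
      case True
      then show ?thesis using 1 T_nz nz by simp
    next
      case False
      then have "u m \<noteq> 0" "s m \<noteq> 0" using 1 nz by auto
      then show ?thesis using False 1 Suc(1)
        by (simp add: prod_greaterThanAtMost_Suc T_Suc q'_def p'_def ac_simps)
    qed
  next
    case 2
    show ?case
    proof (cases "a = Suc m")
      case True
      then show ?thesis using 2 S_nz nz by simp
    next
      case False
      then have "u m \<noteq> 0" "s m \<noteq> 0" "s (Suc m) \<noteq> 0" using 2 nz by auto
      then show ?thesis using False 2 Suc(2)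
        by (simp add: prod_greaterThanAtMost_Suc S_Suc p'_def ac_simps)
    qed
  }
qed (use i(1) in simp_all)

lemma prod_uminus_sg:
  "a \<le> m \<Longrightarrow> (\<Prod>k\<in>{a<..m}. - f k) = sg m * sg a * prod f {a<..m}"
  for f :: "nat \<Rightarrow> 'a"
  by (simp add: prod_uminus sg_diff)

lemma open_closed: "{a<..<b} = {a<..b - 1}" if "0 < b" for a b :: nat
  using that by auto

text \<open>Factoring out \<open>p' b\<close> leaves \<open>(s b + t b) / t b = u b / t b\<close>,
  and \<open>u b\<close> cancels against the denominator of \<open>p' b\<close>.\<close>

lemma pq_sum: "i < b \<Longrightarrow> b \<le> n \<Longrightarrow> q' b + p' b = u (b - 1) / (s (b - 1) * t b)"
proof -
  assume b: "i < b" "b \<le> n"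
  then have "i \<le> b" by simp
  then have "u b \<noteq> 0" "t b \<noteq> 0" using nz b by blast+
  moreover have "s (b - 1) \<noteq> 0" using nz(1)[of "b - 1"] b by simp
  moreover have "u b = t b + s b" using u_eq b by blast
  ultimately show ?thesis
    by (simp add: q'_def p'_def divide_simps) (simp add: algebra_simps)
qed

definition h :: nat where "h = hat n i"

lemma hat_bounds: "n < b \<Longrightarrow> b \<le> h \<Longrightarrow> i \<le> hat n b \<and> hat n b \<le> n"
  using i by (auto simp: h_def hat_def)

text \<open>In this and the next two lemmas the entry is a factor for \<open>a\<close> times a
  factor for \<open>b\<close>, with the same factors across the regimes: strictly above the diagonal
  the matrix agrees with one of rank one. The three lemmas on the \<open>f\<close>-factors show the
  same below the diagonal.\<close>

lemma E_entry_upper: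
  assumes "i \<le> a" "a < b" "b \<le> n"
  shows "hook_entry n q' p' d' a b = (u a / s a) * T a / T b"
proof -
  have nzs: "s (b - 1) \<noteq> 0" "u (b - 1) \<noteq> 0" "t b \<noteq> 0" "T (b - 1) \<noteq> 0"
    using assms nz T_nz by auto
  have "T b = T (b - 1) * t b"
    using T_Suc[of "b - 1"] assms by simp
  then show ?thesis
    using assms nzs by (simp add: hook_entry_def open_closed prod_q pq_sum)
qed

lemma E_entry_mixed:
  assumes "i \<le> a" "a \<le> n" "n < b" "b \<le> h"
  shows "hook_entry n q' p' d' a b =
    sg n * sg (hat n b) * (u a * u (hat n b) * T a * S (hat n b)) / (d * s a * s (hat n b) * T n * S n)"
proof -
  have b: "i \<le> hat n b" "hat n b \<le> n" using hat_bounds assms by auto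
  have "u n \<noteq> 0" "s n \<noteq> 0" using nz i by auto
  then show ?thesis
    using assms b by (simp add: hook_entry_def prod_uminus_sg prod_q prod_p d'_def power2_eq_square ac_simps)
qed

lemma E_entry_lower:
  assumes "n < a" "a < b" "b \<le> h"
  shows "hook_entry n q' p' d' a b =
    sg (hat n a) * sg (hat n b) * ((u (hat n b) / s (hat n b)) * (s (hat n a) / t (hat n a)) * S (hat n b) / S (hat n a))"
proof -
  define a' b' where "a' = hat n a" and "b' = hat n b"
  have b: "i \<le> b'" "b' < a'" "a' \<le> n"
    using hat_bounds[of b] hat_bounds[of a] assms by (auto simp: a'_def b'_def hat_def h_def)
  have nzs: "s (a' - 1) \<noteq> 0" "u (a' - 1) \<noteq> 0" "t a' \<noteq> 0" "s a' \<noteq> 0" "S (a' - 1) \<noteq> 0"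
    using b nz S_nz by auto
  have S: "S a' = S (a' - 1) * s a'"
    using S_Suc[of "a' - 1"] b by simp
  have sg: "sg (a' - Suc 0) = - sg a'"
    using b by (cases a') (simp_all add: sg_def)
  have pq: "p' a' + q' a' = u (a' - 1) / (s (a' - 1) * t a')" using pq_sum[of a'] b by (simp add: add.commute)
  have "hook_entry n q' p' d' a b = - (p' a' + q' a') * (\<Prod>k\<in>{b'<..a' - 1}. - p' k)"
    using assms b by (simp add: hook_entry_def open_closed a'_def b'_def)
  also have "\<dots> = sg a' * sg b' * ((u b' / s b') * (s a' / t a') * S b' / S a')"
    unfolding pq using b nzs by (simp add: prod_uminus_sg sg prod_p S ac_simps)
  finally show ?thesis by (simp add: a'_def b'_def)
qed

lemma F_entry_upper:
  assumes "i \<le> b" "b < a" "a \<le> n"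
  shows "hook_entry n t s d b a = (u a / t a) * T a / T b"
proof -
  have nzs: "t a \<noteq> 0" "T (a - 1) \<noteq> 0" using assms nz T_nz by auto
  have "T a = T (a - 1) * t a"
    using T_Suc[of "a - 1"] assms by simp
  then show ?thesis
    using assms nzs u_eq[of a] by (simp add: hook_entry_def open_closed prod_t add.commute)
qed

lemma F_entry_mixed:
  assumes "i \<le> b" "b \<le> n" "n < a" "a \<le> h"
  shows "hook_entry n t s d b a = sg n * sg (hat n a) * (d * T n * S n / (T b * S (hat n a)))"
proof -
  have a: "i \<le> hat n a" "hat n a \<le> n" using hat_bounds assms by auto
  then show ?thesis
    using assms by (simp add: hook_entry_def prod_uminus_sg prod_t prod_s ac_simps)
qed

lemma F_entry_lower:
  assumes "n < b" "b < a" "a \<le> h"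
  shows "hook_entry n t s d b a =
    sg (hat n a) * sg (hat n b) * ((u (hat n b) / s (hat n b)) * S (hat n b) / S (hat n a))"
proof -
  define a' b' where "a' = hat n a" and "b' = hat n b"
  have b: "i \<le> a'" "a' < b'" "b' \<le> n"
    using hat_bounds[of b] hat_bounds[of a] assms by (auto simp: a'_def b'_def hat_def h_def)
  have nzs: "s b' \<noteq> 0" "S (b' - 1) \<noteq> 0"
    using b nz S_nz by auto
  have S: "S b' = S (b' - 1) * s b'"
    using S_Suc[of "b' - 1"] b by simp
  have sg: "sg (b' - Suc 0) = - sg b'"
    using b by (cases b') (simp_all add: sg_def)
  have st: "s b' + t b' = u b'" using u_eq[of b'] b by (simp add: add.commute)
  have "hook_entry n t s d b a = - (s b' + t b') * (\<Prod>k\<in>{a'<..b' - 1}. - s k)"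
    using assms b by (simp add: hook_entry_def open_closed a'_def b'_def)
  also have "\<dots> = sg a' * sg b' * ((u b' / s b') * S b' / S a')"
    unfolding st using b nzs by (simp add: prod_uminus_sg sg prod_s S ac_simps)
  finally show ?thesis by (simp add: a'_def b'_def)
qed

text \<open>The torus factor of a single row: the pivot at place \<open>i\<close> and the ratios
  \<open>s k / t k\<close> after it. \<open>dd\<close> extends it to all \<open>2 * n\<close> places
  by inverses.\<close>

definition \<delta> :: "nat \<Rightarrow> 'a" where
  "\<delta> k = (if k = i then d * (S n * T n) else if i < k then s k / t k else 1)"

definition dd :: "nat \<Rightarrow> 'a" where
  "dd a = (if a \<le> n then \<delta> a else inverse (\<delta> (hat n a)))"

abbreviation "R \<equiv> hook_entry n q' p' d'"
abbreviation "H a b \<equiv> hook_entry n t s d b a"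

lemma R_first:
  assumes "i \<le> b" "b \<le> h"
  shows "R i b = (if b \<le> n then 1 / T b
    else sg n * sg (hat n b) * (u (hat n b) * S (hat n b)) / (d * s (hat n b) * T n * S n))"
  using assms i E_entry_upper[of i b] E_entry_mixed[of i b]
  by (cases "b = i") (auto simp: base T_base hook_entry_def)

text \<open>The two matrices share their column factor, and row \<open>h\<close> of \<open>H\<close>
  and row \<open>i\<close> of \<open>R\<close> are full multiples of it, diagonal entries included.
  The sign on the left is that of the reflection which brings row \<open>h\<close> to place
  \<open>i\<close>.\<close>

lemma first_row:
  assumes "i \<le> b" "b \<le> h"
  shows "sg n * sg i * H h b = d * (S n * T n) * R i b"
proof (cases "b \<le> n")
  case True
  have "n < h" "hat n h = i" using i by (auto simp: h_def hat_def)
  then have "H h b = sg n * sg i * (d * T n * S n / T b)"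
    using F_entry_mixed[of b h] True assms by (simp add: S_base)
  then have "sg n * sg i * H h b = (sg n * sg n) * (sg i * sg i) * (d * T n * S n / T b)"
    by (simp only: ac_simps)
  then show ?thesis using True assms by (simp add: sg_sq R_first ac_simps)
next
  case False
  have nzs: "d \<noteq> 0" "S n \<noteq> 0" "T n \<noteq> 0" using nz S_nz T_nz by auto
  have hi: "hat n h = i" using i by (auto simp: h_def hat_def)
  have "H h b = sg i * sg (hat n b) * ((u (hat n b) / s (hat n b)) * S (hat n b))"
  proof (cases "b = h")
    case True
    then show ?thesis using hi by (simp add: hook_entry_def base S_base sg_sq)
  next
    case neq: False
    then show ?thesis using F_entry_lower[of b h] hi False assms by (simp add: S_base)
  qed
  then have "sg n * sg i * H h b = (sg i * sg i) * (sg n * sg (hat n b) * ((u (hat n b) / s (hat n b)) * S (hat n b)))"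
    by (simp only: ac_simps)
  then show ?thesis using False assms nzs by (simp add: sg_sq R_first)
qed

text \<open>The Schur complement of the entry \<open>(2n + 1 - i, i)\<close> of the matrix \<open>H\<close>, whose last row is given
  by \<open>first_row\<close>.\<close>

lemma middle_rows:
  assumes a: "i < a" "a < h" and b: "i \<le> b" "b \<le> h"
  shows "H a b = H a i * R i b - dd a * R a b"
proof (cases "a \<le> n")
  case True
  have nza: "s a \<noteq> 0" "t a \<noteq> 0" "u a \<noteq> 0" "T a \<noteq> 0"
    using nz T_nz a True by auto
  have ue: "u a = t a + s a" using u_eq a True by simp
  have Hi: "H a i = (u a / t a) * T a"
    using F_entry_upper[of i a] a True by (simp add: T_base)
  have da: "dd a = s a / t a" using True a by (simp add: dd_def \<delta>_def)
  \<comment> \<open>Left of the diagonal \<open>R a b\<close> vanishes and \<open>H\<close> has rank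
    one; right of it \<open>H a b\<close> vanishes and \<open>R\<close> has rank one; the diagonal
    is \<open>u a / t a - s a / t a = 1\<close>. For \<open>a > n\<close> the argument is the same
    with \<open>s\<close> and \<open>t\<close> exchanged on the diagonal.\<close>
  consider "b < a" | "b = a" | "a < b" "b \<le> n" | "n < b" by linarith
  then show ?thesis
  proof cases
    case 1
    then have "R a b = 0" by (simp add: hook_entry_def)
    then show ?thesis
      using 1 F_entry_upper[of b a] True a b by (simp add: Hi R_first)
  next
    case 2
    have "H a a = 1" "R a a = 1" by (simp_all add: hook_entry_def)
    then show ?thesis
      using nza(1,2,4) True a b unfolding 2 Hi da by (simp add: R_first ue field_simps)
  next
    case 3
    then have "H a b = 0" by (simp add: hook_entry_def)
    then show ?thesis using 3 nza(1-4) E_entry_upper[of a b] a b by (simp add: Hi da R_first)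
  next
    case 4
    then have "H a b = 0" using True by (simp add: hook_entry_def)
    then show ?thesis using 4 nza(1-4) True E_entry_mixed[of a b] a b by (simp add: Hi da R_first ac_simps)
  qed
next
  case False
  define a' where "a' = hat n a"
  have a': "i < a'" "a' \<le> n" using False a by (auto simp: a'_def hat_def h_def)
  have nza: "s a' \<noteq> 0" "t a' \<noteq> 0" "u a' \<noteq> 0" "S a' \<noteq> 0" "d \<noteq> 0" "S n \<noteq> 0" "T n \<noteq> 0"
    using nz S_nz T_nz a' by auto
  have ue: "u a' = t a' + s a'" using u_eq a' by simp
  have Hi: "H a i = sg n * sg a' * (d * T n * S n / S a')"
    using F_entry_mixed[of i a] False a i by (simp add: T_base a'_def)
  have da: "dd a = t a' / s a'" using False a' by (simp add: dd_def \<delta>_def a'_def[symmetric])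
  show ?thesis
  proof (cases "b \<le> n")
    case True
    then have "R a b = 0" using False by (simp add: hook_entry_def)
    then show ?thesis
      using F_entry_mixed[of b a] True False a b by (simp add: Hi R_first a'_def)
  next
    case bn: False
    define b' where "b' = hat n b"
    have b': "s b' \<noteq> 0" using nz hat_bounds[of b] bn b by (auto simp: b'_def)
    have "H a i * R i b = (sg n * sg n) * (sg a' * sg b' * ((u b' / s b') * S b' / S a'))"
      using bn b nza b' by (simp add: Hi R_first b'_def[symmetric] ac_simps)
    then have HR: "H a i * R i b = sg a' * sg b' * ((u b' / s b') * S b' / S a')"
      by (simp add: sg_sq)
    consider "b < a" | "b = a" | "a < b" by linarith
    then show ?thesis
    proof cases
      case 1
      then have "R a b = 0" by (simp add: hook_entry_def)
      then show ?thesis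
        using F_entry_lower[of b a] \<open>b < a\<close> bn a unfolding HR
        by (simp add: a'_def b'_def)
    next
      case 2
      have "H a b = 1" "R a b = 1" "b' = a'" using 2 by (simp_all add: hook_entry_def a'_def b'_def)
      then show ?thesis
        using nza(1,2,4) unfolding HR da by (simp add: sg_sq ue field_simps)
    next
      case 3
      then have "H a b = 0" by (simp add: hook_entry_def)
      moreover have "R a b = sg a' * sg b' * ((u b' / s b') * (s a' / t a') * S b' / S a')"
        using E_entry_lower[of a b] 3 False b by (simp add: a'_def b'_def)
      ultimately show ?thesis
        using nza(1,2,4) unfolding HR da by simp
    qed
  qed
qed

end

section \<open>Inverses, and conjugation by later rows\<close>

lemma E_mat_inverse:
  assumes k: "1 \<le> k" "k \<le> n"
  shows "E_mat n k c * E_mat n k (- c) = 1\<^sub>m (2 * n)"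
proof (rule mat_eqI_ent[of _ n])
  fix a b assume ab: "a \<in> {1..2 * n}" "b \<in> {1..2 * n}"
  have e: "ent (E_mat n k (- c)) x b = (if x = b then 1 else if b = Suc x then - root_coeff n k c x else 0)"
    if "x \<in> {1..2 * n}" for x
    using that ab by (simp add: E_mat_def root_coeff_def)
  have sq: "root_coeff n k c a * root_coeff n k c (Suc a) = 0"
    using sgn_pos_neighbours(1)[OF k, of a, where 'a = 'a] by (cases "sgn_pos n k a = (0 :: 'a)") (simp_all add: root_coeff_conv)
  have "root_coeff n k c a * ent (E_mat n k (- c)) (Suc a) b = (if b = Suc a then root_coeff n k c a else 0)"
  proof (cases "a < 2 * n")
    case True
    then show ?thesis using ab sq by (simp add: e)
  next
    case False
    then show ?thesis using root_coeff_outside[OF k, of a] by auto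
  qed
  then show "ent (E_mat n k c * E_mat n k (- c)) a b = ent (1\<^sub>m (2 * n)) a b"
    unfolding ent_E_mult[OF E_mat_carrier ab k] e[OF ab(1)] ent_one[OF ab] by simp
qed (auto intro!: mult_sq_carrier)

lemma E_mat_inverse':
  assumes k: "1 \<le> k" "k \<le> n"
  shows "E_mat n k (- c) * E_mat n k c = 1\<^sub>m (2 * n)"
  using E_mat_inverse[OF k, of "- c"] by simp

text \<open>The inverse is kept as a word, so that for a single row it is again a hook with explicit
  entries (\<open>ent_E_word_R\<close>).\<close>

definition inv_word :: "nat \<Rightarrow> (param \<Rightarrow> 'a) \<Rightarrow> (param \<times> nat) list \<Rightarrow> 'a::field mat" where
  "inv_word n x w = E_word n (\<lambda>v. - x v) (rev w)"

lemma inv_word_carrier [simp]: "inv_word n x w \<in> carrier_mat (2 * n) (2 * n)"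
  by (simp add: inv_word_def)

lemma E_word_inverse:
  assumes "\<And>v k. (v, k) \<in> set w \<Longrightarrow> 1 \<le> k \<and> k \<le> n"
  shows "E_word n x w * inv_word n x w = 1\<^sub>m (2 * n) \<and> inv_word n x w * E_word n x w = 1\<^sub>m (2 * n)"
  using assms
proof (induction w)
  case (Cons y w)
  obtain v k where y: "y = (v, k)" by force
  let ?E = "E_mat n k (x v)" and ?E' = "E_mat n k (- x v)" and ?W = "E_word n x w" and ?V = "inv_word n x w"
  have C: "?E \<in> carrier_mat (2 * n) (2 * n)" "?E' \<in> carrier_mat (2 * n) (2 * n)"
    "?W \<in> carrier_mat (2 * n) (2 * n)" "?V \<in> carrier_mat (2 * n) (2 * n)" by simp_all
  have k: "1 \<le> k" "k \<le> n" using Cons.prems y by auto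
  have IH: "?W * ?V = 1\<^sub>m (2 * n)" "?V * ?W = 1\<^sub>m (2 * n)" using Cons by auto
  have V: "inv_word n x (y # w) = ?V * ?E'"
    by (simp add: y inv_word_def word_mat_append right_mult_one_mat[OF E_mat_carrier])
  have W: "E_word n x (y # w) = ?E * ?W" by (simp add: y)
  have CW: "?V * ?E' \<in> carrier_mat (2 * n) (2 * n)" "?E * ?W \<in> carrier_mat (2 * n) (2 * n)"
    by (intro mult_sq_carrier C)+
  have "(?E * ?W) * (?V * ?E') = ?E * (?W * (?V * ?E'))"
    by (rule mult_sq_assoc[OF C(1,3) CW(1)])
  also have "?W * (?V * ?E') = ?W * ?V * ?E'" by (rule mult_sq_assoc[OF C(3,4,2), symmetric])
  also have "?E * (?W * ?V * ?E') = 1\<^sub>m (2 * n)"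
    unfolding IH using E_mat_inverse[OF k, of "x v"] left_mult_one_mat[OF C(2)] by simp
  finally have 1: "(?E * ?W) * (?V * ?E') = 1\<^sub>m (2 * n)" .
  have "(?V * ?E') * (?E * ?W) = ?V * (?E' * (?E * ?W))"
    by (rule mult_sq_assoc[OF C(4,2) CW(2)])
  also have "?E' * (?E * ?W) = ?E' * ?E * ?W" by (rule mult_sq_assoc[OF C(2,1,3), symmetric])
  also have "?V * (?E' * ?E * ?W) = 1\<^sub>m (2 * n)"
    using IH(2) E_mat_inverse'[OF k, of "x v"] left_mult_one_mat[OF C(3)] by simp
  finally have 2: "(?V * ?E') * (?E * ?W) = 1\<^sub>m (2 * n)" .
  show ?case unfolding V W using 1 2 by blast
qed (simp add: inv_word_def)

text \<open>Membership in the radical is what survives conjugation by the rows after \<open>i\<close>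
  (lemma \<open>unip_radical_conj_E\<close>): only column \<open>i\<close> and row \<open>2n + 1 - i\<close> may be nontrivial.\<close>

definition unip_radical :: "nat \<Rightarrow> nat \<Rightarrow> 'a::field mat \<Rightarrow> bool" where
  "unip_radical n i Y \<longleftrightarrow> Y \<in> carrier_mat (2 * n) (2 * n) \<and>
    (\<forall>a\<in>{1..2 * n}. \<forall>b\<in>{1..2 * n}. \<not> (b = i \<and> i < a) \<and> \<not> (a = hat n i \<and> b < hat n i) \<longrightarrow>
      ent Y a b = (if a = b then 1 else 0))"

text \<open>For \<open>k > i\<close> the operations involve only indices strictly between
  \<open>i\<close> and \<open>hat n i\<close>. So column \<open>i\<close> sees only row operations
  and row \<open>hat n i\<close> only column operations, while on the block between them, where
  \<open>Y\<close> is the identity, the conjugation cancels.\<close>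

lemma unip_radical_conj_E:
  assumes Y: "unip_radical n i Y" and i: "1 \<le> i" "i < k" "k \<le> n"
  shows "unip_radical n i (E_mat n k c * Y * E_mat n k (- c))"
  unfolding unip_radical_def
proof (intro conjI ballI impI)
  have Yc: "Y \<in> carrier_mat (2 * n) (2 * n)" using Y by (simp add: unip_radical_def)
  have Zc: "E_mat n k c * Y \<in> carrier_mat (2 * n) (2 * n)" by (intro mult_sq_carrier Yc E_mat_carrier)
  show "E_mat n k c * Y * E_mat n k (- c) \<in> carrier_mat (2 * n) (2 * n)"
    by (intro mult_sq_carrier Zc E_mat_carrier)
  fix a b assume ab: "a \<in> {1..2 * n}" "b \<in> {1..2 * n}"
    and out: "\<not> (b = i \<and> i < a) \<and> \<not> (a = hat n i \<and> b < hat n i)"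
  have k: "1 \<le> k" "k \<le> n" using i by auto
  define h where "h = hat n i"
  have h: "h \<le> 2 * n" "i < h" using i by (auto simp: h_def hat_def)
  have g: "i < x \<and> Suc x < h" if "root_coeff n k c x \<noteq> 0" for x
    using that i by (auto simp: root_coeff_def h_def hat_def split: if_splits)
  have Ye: "ent Y a b = (if a = b then 1 else 0)"
    if "a \<in> {1..2 * n}" "b \<in> {1..2 * n}" "b \<noteq> i \<or> a \<le> i" "a \<noteq> h \<or> h \<le> b" for a b
    using Y that unfolding unip_radical_def h_def by force
  have neg: "root_coeff n k (- c) x = - root_coeff n k c x" for x by (simp add: root_coeff_def)
  have e: "ent (E_mat n k c * Y * E_mat n k (- c)) a b =
      ent Y a b + root_coeff n k c a * ent Y (Suc a) b
      - root_coeff n k c (b - 1) * (ent Y a (b - 1) + root_coeff n k c a * ent Y (Suc a) (b - 1))"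
  proof (cases "root_coeff n k c (b - 1) = 0")
    case True
    then show ?thesis
      unfolding ent_mult_E[OF Zc ab k] ent_E_mult[OF Yc ab k] neg by simp
  next
    case False
    then have "b - 1 \<in> {1..2 * n}" using g[of "b - 1"] h by auto
    then show ?thesis
      unfolding ent_mult_E[OF Zc ab k] ent_E_mult[OF Yc ab k] neg
      using ent_E_mult[OF Yc ab(1) _ k] by simp
  qed
  have sq: "root_coeff n k c a * root_coeff n k c (Suc a) = 0"
    using sgn_pos_neighbours(1)[OF k, of a, where 'a = 'a] by (cases "sgn_pos n k a = (0 :: 'a)") (simp_all add: root_coeff_conv)
  show "ent (E_mat n k c * Y * E_mat n k (- c)) a b = (if a = b then 1 else 0)"
  proof (cases "b = i \<or> a = h")
    case True
    have z1: "root_coeff n k c a = 0"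
    proof (rule ccontr)
      assume "root_coeff n k c a \<noteq> 0"
      then show False using g[of a] True out by auto
    qed
    have z2: "root_coeff n k c (b - 1) = 0"
    proof (rule ccontr)
      assume "root_coeff n k c (b - 1) \<noteq> 0"
      then have "i < b - 1" "Suc (b - 1) < h" using g[of "b - 1"] by auto
      then show False using True out by (auto simp: h_def[symmetric])
    qed
    note z = z1 z2
    have "ent Y a b = (if a = b then 1 else 0)"
      by (rule Ye[OF ab]) (use out True h in \<open>auto simp: h_def[symmetric]\<close>)
    then show ?thesis unfolding e z by simp
  next
    case False
    have 1: "ent Y a b = (if a = b then 1 else 0)"
      by (rule Ye[OF ab]) (use False in auto)
    have 2: "root_coeff n k c a * ent Y (Suc a) b = (if b = Suc a then root_coeff n k c a else 0)"
    proof (cases "root_coeff n k c a = 0")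
      case True
      then show ?thesis by simp
    next
      case nz: False
      have "ent Y (Suc a) b = (if Suc a = b then 1 else 0)"
        by (rule Ye) (use ab h g[OF nz] False in auto)
      then show ?thesis by auto
    qed
    have 3: "root_coeff n k c (b - 1) * (ent Y a (b - 1) + root_coeff n k c a * ent Y (Suc a) (b - 1)) =
      (if b = Suc a then root_coeff n k c a else 0)"
    proof (cases "root_coeff n k c (b - 1) = 0")
      case True
      then show ?thesis by auto
    next
      case nz: False
      then have b: "b - 1 \<in> {1..2 * n}" "b - 1 \<noteq> i" using g[of "b - 1"] h by auto
      have "ent Y a (b - 1) = (if a = b - 1 then 1 else 0)"
        by (rule Ye) (use ab b False in auto)
      moreover have "root_coeff n k c (b - 1) * (root_coeff n k c a * ent Y (Suc a) (b - 1)) = 0"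
      proof (cases "root_coeff n k c a = 0")
        case True
        then show ?thesis by simp
      next
        case nza: False
        have "ent Y (Suc a) (b - 1) = (if Suc a = b - 1 then 1 else 0)"
          by (rule Ye) (use ab b g[OF nza] False h in auto)
        then show ?thesis using sq by auto
      qed
      ultimately show ?thesis using b by (auto simp: distrib_left)
    qed
    show ?thesis unfolding e 1 2 3 by simp
  qed
qed

lemma unip_radical_push_word:
  assumes "unip_radical n i Y" "1 \<le> i" and w: "\<And>v k. (v, k) \<in> set w \<Longrightarrow> i < k \<and> k \<le> n"
  shows "\<exists>Y'. unip_radical n i Y' \<and> E_word n x w * Y = Y' * E_word n x w"
  using w
proof (induction w)
  case Nil
  have "Y \<in> carrier_mat (2 * n) (2 * n)" using assms(1) by (simp add: unip_radical_def)
  then show ?case using assms(1) by auto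
next
  case (Cons y w)
  obtain v k where y: "y = (v, k)" by force
  have k: "i < k" "k \<le> n" "1 \<le> k" using Cons.prems y assms(2) by fastforce+
  obtain Y' where Y': "unip_radical n i Y'" "E_word n x w * Y = Y' * E_word n x w"
    using Cons by auto
  let ?E = "E_mat n k (x v)" and ?E' = "E_mat n k (- x v)" and ?W = "E_word n x w"
  have C: "?E \<in> carrier_mat (2 * n) (2 * n)" "?E' \<in> carrier_mat (2 * n) (2 * n)"
    "?W \<in> carrier_mat (2 * n) (2 * n)" "Y \<in> carrier_mat (2 * n) (2 * n)" "Y' \<in> carrier_mat (2 * n) (2 * n)"
    using assms(1) Y' by (simp_all add: unip_radical_def)
  have EY: "?E * Y' \<in> carrier_mat (2 * n) (2 * n)" by (intro mult_sq_carrier C)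
  have "?E * ?W * Y = ?E * (?W * Y)" by (rule mult_sq_assoc[OF C(1,3,4)])
  also have "\<dots> = ?E * (Y' * ?W)" by (simp only: Y'(2))
  also have "\<dots> = ?E * Y' * ?W" by (rule mult_sq_assoc[OF C(1,5,3), symmetric])
  also have "?E * Y' = ?E * Y' * (?E' * ?E)"
    using E_mat_inverse'[OF k(3,2), of "x v"] right_mult_one_mat[OF EY] by simp
  also have "\<dots> = ?E * Y' * ?E' * ?E" by (rule mult_sq_assoc[OF EY C(2,1), symmetric])
  also have "\<dots> * ?W = ?E * Y' * ?E' * (?E * ?W)"
    by (rule mult_sq_assoc[OF mult_sq_carrier[OF EY C(2)] C(1,3)])
  finally show ?case
    using unip_radical_conj_E[OF Y'(1) assms(2) k(1,2), of "x v"] by (auto simp: y)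
qed

section \<open>Torus and unipotent matrices\<close>

definition torus_entry :: "nat \<Rightarrow> (nat \<Rightarrow> 'a) \<Rightarrow> nat \<Rightarrow> 'a::field" where
  "torus_entry n c a = (if a \<le> n then c a else inverse (c (hat n a)))"

lemma torus_mat_carrier [simp]: "torus_mat n c \<in> carrier_mat (2 * n) (2 * n)"
  by (simp add: torus_mat_def)

lemma ent_torus:
  assumes ab: "a \<in> {1..2 * n}" "b \<in> {1..2 * n}"
  shows "ent (torus_mat n c) a b = (if a = b then torus_entry n c a else 0)"
proof -
  have "ent (torus_mat n c) a b = (\<Sum>k=1..n. (if k = a \<and> a = b then c k else 0)
      + (if hat n k = a \<and> a = b then inverse (c k) else 0))"
    using ab by (auto simp: torus_mat_def ent_def mat_unit_def hat_def intro!: sum.cong)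
  also have "\<dots> = (if a = b then torus_entry n c a else 0)"
  proof (cases "a = b")
    case True
    have "(\<Sum>k=1..n. (if k = a then c k else 0)) = (if a \<le> n then c a else 0)"
      using ab by (simp add: sum.delta)
    moreover have "(\<Sum>k=1..n. (if hat n k = a then inverse (c k) else 0))
        = (\<Sum>k=1..n. (if k = hat n a then inverse (c k) else 0))"
      by (rule sum.cong) (use ab in \<open>auto simp: hat_def\<close>)
    moreover have "\<dots> = (if a \<le> n then 0 else inverse (c (hat n a)))"
      using ab by (auto simp: hat_def)
    ultimately show ?thesis using True by (simp add: sum.distrib torus_entry_def)
  qed simp
  finally show ?thesis .
qed

lemma ent_torus_mult:
  assumes "M \<in> carrier_mat (2 * n) (2 * n)" "a \<in> {1..2 * n}" "b \<in> {1..2 * n}"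
  shows "ent (torus_mat n c * M) a b = torus_entry n c a * ent M a b"
  using assms by (subst ent_mult_single[where c = a and n = n]) (simp_all add: ent_torus)

lemma ent_mult_torus:
  assumes M: "M \<in> carrier_mat (2 * n) (2 * n)" and ab: "a \<in> {1..2 * n}" "b \<in> {1..2 * n}"
  shows "ent (M * torus_mat n c) a b = ent M a b * torus_entry n c b"
proof -
  have "ent (M * torus_mat n c) a b = (\<Sum>d=1..2 * n. if d = b then ent M a b * torus_entry n c b else 0)"
    unfolding ent_mult[OF M torus_mat_carrier ab]
    by (rule sum.cong) (use ab in \<open>auto simp: ent_torus\<close>)
  then show ?thesis using ab by (simp add: sum.delta)
qed

lemma torus_mult: "torus_mat n c * torus_mat n c' = torus_mat n (\<lambda>k. c k * c' k)"
  by (rule mat_eqI_ent[of _ n])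
     (auto simp: ent_torus_mult ent_torus torus_entry_def intro!: mult_sq_carrier)

lemma torus_cong: "(\<And>k. 1 \<le> k \<Longrightarrow> k \<le> n \<Longrightarrow> c k = c' k) \<Longrightarrow> torus_mat n c = torus_mat n c'"
  by (rule mat_eqI_ent[of _ n]) (auto simp: ent_torus torus_entry_def hat_def)

lemma torus_one: "torus_mat n (\<lambda>_. 1) = 1\<^sub>m (2 * n)"
  by (rule mat_eqI_ent[of _ n]) (auto simp: ent_torus torus_entry_def)

lemma torus_inverse:
  assumes "\<And>k. 1 \<le> k \<Longrightarrow> k \<le> n \<Longrightarrow> c k \<noteq> 0"
  shows "torus_mat n c * torus_mat n (\<lambda>k. inverse (c k)) = 1\<^sub>m (2 * n)"
    and "torus_mat n (\<lambda>k. inverse (c k)) * torus_mat n c = 1\<^sub>m (2 * n)"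
  unfolding torus_mult torus_one[symmetric] using assms by (auto intro!: torus_cong)

lemma torus_entry_inverse: "torus_entry n (\<lambda>k. inverse (c k)) a = inverse (torus_entry n c a)"
  by (simp add: torus_entry_def)

lemma torus_entry_nonzero:
  assumes "\<And>k. 1 \<le> k \<Longrightarrow> k \<le> n \<Longrightarrow> c k \<noteq> 0" "a \<in> {1..2 * n}"
  shows "torus_entry n c a \<noteq> 0"
proof (cases "a \<le> n")
  case False
  then have "1 \<le> hat n a" "hat n a \<le> n" using assms(2) by (auto simp: hat_def)
  then show ?thesis using assms(1) False by (simp add: torus_entry_def)
qed (use assms in \<open>auto simp: torus_entry_def\<close>)

text \<open>The inverse of the \<open>k\<close>-th simple root at the torus element: the root is
  \<open>c k / c (k + 1)\<close> for \<open>k < n\<close> and the square of \<open>c n\<close> for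
  \<open>k = n\<close>.\<close>

definition root_ratio :: "nat \<Rightarrow> (nat \<Rightarrow> 'a) \<Rightarrow> nat \<Rightarrow> 'a::field" where
  "root_ratio n c k = (if k < n then c (Suc k) / c k else inverse ((c n)\<^sup>2))"

lemma E_mult_torus:
  assumes k: "1 \<le> k" "k \<le> n" and c: "\<And>k. 1 \<le> k \<Longrightarrow> k \<le> n \<Longrightarrow> c k \<noteq> 0"
  shows "E_mat n k x * torus_mat n c = torus_mat n c * E_mat n k (x * root_ratio n c k)"
proof (rule mat_eqI_ent[of _ n])
  fix a b assume ab: "a \<in> {1..2 * n}" "b \<in> {1..2 * n}"
  have g: "root_coeff n k x a * torus_entry n c (Suc a) = root_coeff n k (x * root_ratio n c k) a * torus_entry n c a"
  proof -
    consider "a = k" "k < n" | "a = k" "k = n" | "a = 2 * n - k" "k < n" | "root_coeff n k x a = 0" "root_coeff n k (x * root_ratio n c k) a = 0"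
      using k by (fastforce simp: root_coeff_def)
    then show ?thesis
    proof cases
      case 1
      then show ?thesis using c[of k] k by (simp add: root_coeff_def torus_entry_def root_ratio_def)
    next
      case 2
      then show ?thesis using c[of n] k by (simp add: root_coeff_def torus_entry_def root_ratio_def hat_def power2_eq_square)
    next
      case 3
      then have "\<not> a \<le> n" "a \<noteq> k" "hat n a = Suc k" "hat n (Suc a) = k"
        using k by (auto simp: hat_def)
      then show ?thesis using 3 c[of k] c[of "Suc k"] k by (simp add: root_coeff_def torus_entry_def root_ratio_def field_simps)
    qed simp
  qed
  have 1: "root_coeff n k x a * ent (torus_mat n c) (Suc a) b = (if b = Suc a then root_coeff n k x a * torus_entry n c (Suc a) else 0)"
  proof (cases "a < 2 * n")
    case True
    then show ?thesis using ab by (auto simp: ent_torus)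
  next
    case False
    then show ?thesis using root_coeff_outside[OF k, of a x] by simp
  qed
  have 2: "root_coeff n k y (b - 1) * ent (torus_mat n c) a (b - 1) = (if b = Suc a then root_coeff n k y a * torus_entry n c a else 0)" for y
  proof (cases "b = 1")
    case True
    then show ?thesis using root_coeff_outside[OF k, of 0 y] root_coeff_outside[OF k, of 0 x] ab by simp
  next
    case False
    then have "b - 1 \<in> {1..2 * n}" "a = b - 1 \<longleftrightarrow> b = Suc a" using ab by auto
    then show ?thesis using ab by (auto simp: ent_torus)
  qed
  show "ent (E_mat n k x * torus_mat n c) a b = ent (torus_mat n c * E_mat n k (x * root_ratio n c k)) a b"
    unfolding ent_E_mult[OF torus_mat_carrier ab k] ent_mult_E[OF torus_mat_carrier ab k] 1 2 g ..
qed (auto intro!: mult_sq_carrier)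

section \<open>Lower unitriangular matrices\<close>

definition unilower :: "nat \<Rightarrow> 'a::field mat \<Rightarrow> bool" where
  "unilower n Y \<longleftrightarrow> Y \<in> carrier_mat (2 * n) (2 * n) \<and>
    (\<forall>a\<in>{1..2 * n}. \<forall>b\<in>{1..2 * n}. a \<le> b \<longrightarrow> ent Y a b = (if a = b then 1 else 0))"

lemma unilower_carrier: "unilower n Y \<Longrightarrow> Y \<in> carrier_mat (2 * n) (2 * n)"
  by (simp add: unilower_def)

lemma unilower_lower_unitriangular:
  assumes "Y \<in> carrier_mat (2 * n) (2 * n)"
  shows "lower_unitriangular Y \<longleftrightarrow> unilower n Y"
proof
  assume *: "unilower n Y"
  show "lower_unitriangular Y"
      unfolding lower_unitriangular_def
  proof -
    have L: "Y $$ (i, j) = (if i = j then 1 else 0)" if "i < 2 * n" "j < 2 * n" "i \<le> j" for i j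
    proof -
      have "ent Y (Suc i) (Suc j) = (if Suc i = Suc j then 1 else 0)"
        using * that unfolding unilower_def by (simp del: diff_Suc_1)
      then show ?thesis by (simp add: ent_def)
    qed
    then show "\<forall>i<dim_row Y. Y $$ (i, i) = 1 \<and> (\<forall>j<dim_col Y. i < j \<longrightarrow> Y $$ (i, j) = 0)"
      using assms by auto
  qed
next
  assume *: "lower_unitriangular Y"
  then show "unilower n Y"
    using assms unfolding lower_unitriangular_def unilower_def ent_def by auto
qed

lemma unilower_mult:
  assumes A: "unilower n A" and B: "unilower n B"
  shows "unilower n (A * B)"
  unfolding unilower_def
proof (intro conjI ballI impI)
  note C = unilower_carrier[OF A] unilower_carrier[OF B]
  show "A * B \<in> carrier_mat (2 * n) (2 * n)" by (intro mult_sq_carrier C)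
  fix a b assume ab: "a \<in> {1..2 * n}" "b \<in> {1..2 * n}" "a \<le> b"
  have "(\<Sum>c=1..2 * n. ent A a c * ent B c b) = (\<Sum>c=1..2 * n. if c = a then (if a = b then 1 else 0) else 0)"
  proof (rule sum.cong[OF refl])
    fix c assume c: "c \<in> {1..2 * n}"
    consider "a < c" | "c = a" | "c < a" by linarith
    then show "ent A a c * ent B c b = (if c = a then (if a = b then 1 else 0) else 0)"
      using A B ab c by cases (simp_all add: unilower_def)
  qed
  then show "ent (A * B) a b = (if a = b then 1 else 0)"
    unfolding ent_mult[OF C ab(1,2)] using ab by (simp add: sum.delta)
qed

lemma unip_radical_unilower: "unip_radical n i Y \<Longrightarrow> unilower n Y"
  unfolding unip_radical_def unilower_def by auto

lemma torus_push_unilower: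
  assumes Y: "unilower n Y" and c: "\<And>k. 1 \<le> k \<Longrightarrow> k \<le> n \<Longrightarrow> c k \<noteq> 0"
  shows "\<exists>Y'. unilower n Y' \<and> torus_mat n c * Y = Y' * torus_mat n c"
proof (intro exI conjI)
  let ?T = "torus_mat n c" and ?T' = "torus_mat n (\<lambda>k. inverse (c k))"
  note Yc = unilower_carrier[OF Y]
  have TY: "?T * Y \<in> carrier_mat (2 * n) (2 * n)" by (intro mult_sq_carrier Yc) simp
  have torus_entry: "torus_entry n c a \<noteq> 0" if "a \<in> {1..2 * n}" for a
    using torus_entry_nonzero[OF c that] .
  show "unilower n (?T * Y * ?T')"
    unfolding unilower_def
    using Y TY torus_entry by (auto simp: ent_mult_torus[OF TY] ent_torus_mult[OF Yc] torus_entry_inverse unilower_def intro!: mult_sq_carrier)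
  have "?T * Y * ?T' * ?T = ?T * Y * (?T' * ?T)" by (rule mult_sq_assoc[OF TY]) simp_all
  also have "\<dots> = ?T * Y" using torus_inverse(2)[of n c, OF c] right_mult_one_mat[OF TY] by simp
  finally show "?T * Y = ?T * Y * ?T' * ?T" ..
qed

lemma hook_cong:
  assumes "\<And>l. n - j < l \<Longrightarrow> l \<le> n \<Longrightarrow> q l = q' l" "\<And>l. n - j < l \<Longrightarrow> l \<le> n \<Longrightarrow> p l = p' l" "j < n"
  shows "hook G n q p d j = hook G n q' p' d j"
  using assms
proof (induction j)
  case (Suc j)
  have "q (n - j) = q' (n - j)" "p (n - j) = p' (n - j)"
    using Suc.prems by auto
  moreover have "hook G n q p d j = hook G n q' p' d j"
    using Suc by auto
  ultimately show ?case by simp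
qed simp

section \<open>Entries of the words of one row, and elimination\<close>

lemma ent_E_word_R:
  fixes x :: "param \<Rightarrow> 'a::field"
  assumes i: "1 \<le> i" "i \<le> n" and ab: "a \<in> {1..2 * n}" "b \<in> {1..2 * n}"
    and q: "\<And>l. i < l \<Longrightarrow> l \<le> n \<Longrightarrow> x (ParS i l) = q l" and p: "\<And>l. i < l \<Longrightarrow> l \<le> n \<Longrightarrow> x (ParT i l) = p l"
    and d: "x (ParD i) = d"
  shows "ent (E_word n x (R_word n i)) a b =
      (if a \<in> {i..hat n i} \<and> b \<in> {i..hat n i} then hook_entry n q p d a b else if a = b then 1 else 0)"
    and "ent (F_word n x (R_word n i)) a b =
      (if a \<in> {i..hat n i} \<and> b \<in> {i..hat n i} then hook_entry n p q d b a else if a = b then 1 else 0)"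
    and "ent (inv_word n x (R_word n i)) a b =
      (if a \<in> {i..hat n i} \<and> b \<in> {i..hat n i}
       then hook_entry n (\<lambda>l. - p l) (\<lambda>l. - q l) (- d) a b else if a = b then 1 else 0)"
proof -
  have r: "n - (n - i) = i" "n + 1 + (n - i) = hat n i" "n - i < n"
    using i by (auto simp: hat_def)
  have 1: "E_word n x (R_word n i) = hook (E_mat n) n q p d (n - i)"
    unfolding R_word_hook(1)[OF E_mat_carrier i(2)] hook_param d
    by (rule hook_cong) (use q p r in auto)
  have 2: "F_word n x (R_word n i) = hook (F_mat n) n q p d (n - i)"
    unfolding R_word_hook(1)[OF F_mat_carrier i(2)] hook_param d
    by (rule hook_cong) (use q p r in auto)
  have 3: "inv_word n x (R_word n i) = hook (E_mat n) n (\<lambda>l. - p l) (\<lambda>l. - q l) (- d) (n - i)"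
    unfolding inv_word_def R_word_hook(2)[OF E_mat_carrier i(2)] d[symmetric]
      hook_param[of "E_mat n" "\<lambda>v. - x v"]
    by (rule hook_cong) (use q p r in auto)
  show "ent (E_word n x (R_word n i)) a b =
      (if a \<in> {i..hat n i} \<and> b \<in> {i..hat n i} then hook_entry n q p d a b else if a = b then 1 else 0)"
    unfolding 1 ent_hook_E[OF r(3) ab] r ..
  show "ent (F_word n x (R_word n i)) a b =
      (if a \<in> {i..hat n i} \<and> b \<in> {i..hat n i} then hook_entry n p q d b a else if a = b then 1 else 0)"
    unfolding 2 ent_hook_F[OF r(3) ab] r ..
  show "ent (inv_word n x (R_word n i)) a b =
      (if a \<in> {i..hat n i} \<and> b \<in> {i..hat n i}
       then hook_entry n (\<lambda>l. - p l) (\<lambda>l. - q l) (- d) a b else if a = b then 1 else 0)"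
    unfolding 3 ent_hook_E[OF r(3) ab] r ..
qed

lemma ent_refl_mult:
  fixes M :: "'a::field mat"
  assumes i: "1 \<le> i" "i \<le> n" and M: "M \<in> carrier_mat (2 * n) (2 * n)"
    and ab: "a \<in> {1..2 * n}" "b \<in> {1..2 * n}"
  shows "ent (S_word n (R_word n i) * M) a b =
    (if a = i then (- 1) ^ (n - i) * ent M (hat n i) b
     else if a = hat n i then - ((- 1) ^ (n - i) * ent M i b)
     else if i < a \<and> a < hat n i then - ent M a b else ent M a b)"
proof -
  define h where "h = hat n i"
  have h: "h \<in> {1..2 * n}" "i \<in> {1..2 * n}" "i \<noteq> h" using i by (auto simp: h_def hat_def)
  define c where "c = (if a = i then h else if a = h then i else a)"
  have c: "c \<in> {1..2 * n}" using h ab by (simp add: c_def)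
  have W: "ent (S_word n (R_word n i)) a d = refl_entry ((- 1 :: 'a) ^ (n - i)) i h a d"
    if "d \<in> {1..2 * n}" for d
    unfolding h_def by (rule ent_S_word_R[OF i ab(1) that])
  have "ent (S_word n (R_word n i) * M) a b = refl_entry ((- 1) ^ (n - i)) i h a c * ent M c b"
    unfolding W[OF c, symmetric]
    by (rule ent_mult_single[OF _ M ab c]) (auto simp: W refl_entry_def c_def split: if_splits)
  then show ?thesis
    using h(3) by (simp add: h_def[symmetric] c_def refl_entry_def)
qed

context hook_params
begin

lemma \<delta>_nz: "1 \<le> k \<Longrightarrow> k \<le> n \<Longrightarrow> \<delta> k \<noteq> 0"
  using nz S_nz T_nz i by (auto simp: \<delta>_def)

text \<open>\<open>Y\<close> is defined as what remains after dividing by the upper factor and the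
  torus; the work is to see that it lies in the radical. Each row of \<open>A\<close> except row
  \<open>h\<close> combines row \<open>i\<close> and the row of the same index of the upper factor,
  so multiplication by the inverse leaves, besides the diagonal, at most an entry in column
  \<open>i\<close>.\<close>

lemma hook_factor:
  fixes x p :: "param \<Rightarrow> 'a"
  assumes x: "\<And>l. i < l \<Longrightarrow> l \<le> n \<Longrightarrow> x (ParS i l) = s l" "\<And>l. i < l \<Longrightarrow> l \<le> n \<Longrightarrow> x (ParT i l) = t l"
      "x (ParD i) = d"
    and p: "\<And>l. i < l \<Longrightarrow> l \<le> n \<Longrightarrow> p (ParS i l) = q' l" "\<And>l. i < l \<Longrightarrow> l \<le> n \<Longrightarrow> p (ParT i l) = p' l"
      "p (ParD i) = d'"
  shows "\<exists>Y. unip_radical n i Y \<and> S_word n (R_word n i) * F_word n x (R_word n i) =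
    Y * (torus_mat n \<delta> * E_word n p (R_word n i))"
proof -
  let ?F = "F_word n x (R_word n i)" and ?R = "E_word n p (R_word n i)" and ?V = "inv_word n p (R_word n i)"
  let ?T = "torus_mat n \<delta>" and ?T' = "torus_mat n (\<lambda>k. inverse (\<delta> k))"
  define A where "A = S_word n (R_word n i) * ?F"
  define Y where "Y = A * ?V * ?T'"
  have C: "?F \<in> carrier_mat (2 * n) (2 * n)" "?R \<in> carrier_mat (2 * n) (2 * n)"
    "?V \<in> carrier_mat (2 * n) (2 * n)" "A \<in> carrier_mat (2 * n) (2 * n)"
    by (auto simp: A_def intro!: mult_sq_carrier)
  have AV: "A * ?V \<in> carrier_mat (2 * n) (2 * n)" by (intro mult_sq_carrier C)
  have Yc: "Y \<in> carrier_mat (2 * n) (2 * n)" unfolding Y_def by (intro mult_sq_carrier AV) simp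
  have inv: "?R * ?V = 1\<^sub>m (2 * n)" "?V * ?R = 1\<^sub>m (2 * n)"
    using E_word_inverse[of "R_word n i" n p] R_word_bounds[of _ _ n i] i by fastforce+
  have hh: "h \<in> {1..2 * n}" "i \<in> {1..2 * n}" "i < h" "n < h" "hat n h = i" "i < n \<or> i = n"
    using i by (auto simp: h_def hat_def)
  have Fe: "ent ?F a b = (if a \<in> {i..h} \<and> b \<in> {i..h} then H a b else if a = b then 1 else 0)"
    if "a \<in> {1..2 * n}" "b \<in> {1..2 * n}" for a b
    unfolding h_def by (rule ent_E_word_R(2)[OF i that x])
  have Re: "ent ?R a b = (if a \<in> {i..h} \<and> b \<in> {i..h} then R a b else if a = b then 1 else 0)"
    if "a \<in> {1..2 * n}" "b \<in> {1..2 * n}" for a b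
    unfolding h_def by (rule ent_E_word_R(1)[OF i that p])
  have Ve: "ent ?V a b = (if a \<in> {i..h} \<and> b \<in> {i..h}
      then hook_entry n (\<lambda>l. - p' l) (\<lambda>l. - q' l) (- d') a b else if a = b then 1 else 0)"
    if "a \<in> {1..2 * n}" "b \<in> {1..2 * n}" for a b
    unfolding h_def by (rule ent_E_word_R(3)[OF i that p])
  have sgi: "(- 1) ^ (n - i) = sg n * sg i" by (rule sg_diff[OF i(2)])
  have Ae: "ent A a b = (if a = i then sg n * sg i * ent ?F h b
     else if a = h then - (sg n * sg i * ent ?F i b)
     else if i < a \<and> a < h then - ent ?F a b else ent ?F a b)"
    if "a \<in> {1..2 * n}" "b \<in> {1..2 * n}" for a b
    unfolding A_def ent_refl_mult[OF i C(1) that] sgi h_def ..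
  \<comment> \<open>The multiplier of row \<open>i\<close> in the elimination; after division by the
    torus it becomes column \<open>i\<close> of \<open>Y\<close> below the diagonal, outside row
    \<open>h\<close>.\<close>
  define \<alpha> where "\<alpha> a = (if i < a \<and> a < h then - H a i else 0)" for a
  have dd: "dd a = torus_entry n \<delta> a" for a by (simp add: dd_def torus_entry_def)
  have row: "ent A a c = \<alpha> a * ent ?R i c + dd a * ent ?R a c"
    if a: "a \<in> {1..2 * n}" "a \<noteq> h" and c: "c \<in> {1..2 * n}" for a c
  proof -
    have in_block: "ent ?F x c = H x c" "ent ?R x c = R x c" if "c \<in> {i..h}" "x \<in> {i..h}" for x
      using that Fe[of x c] Re[of x c] c hh by auto
    have off_block: "ent ?F x c = (if x = c then 1 else 0)" "ent ?R x c = (if x = c then 1 else 0)"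
      if "c \<notin> {i..h} \<or> x \<notin> {i..h}" "x \<in> {1..2 * n}" for x
      unfolding Fe[OF that(2) c] Re[OF that(2) c] using that(1) by auto
    consider "a = i" | "i < a" "a < h" | "a < i \<or> h < a" using a by linarith
    then show ?thesis
    proof cases
      case 1
      have "dd i = d * (S n * T n)" using i by (simp add: dd_def \<delta>_def)
      moreover have "\<alpha> i = 0" by (simp add: \<alpha>_def)
      moreover have "sg n * sg i * ent ?F h c = d * (S n * T n) * ent ?R i c"
      proof (cases "c \<in> {i..h}")
        case True
        then show ?thesis using first_row[of c] hh(3) in_block[OF True] by simp
      next
        case False
        then have "c \<noteq> i" "c \<noteq> h" using hh(3) by auto
        then show ?thesis using off_block[OF disjI1[OF False]] hh(1,2) by simp
      qed
      ultimately show ?thesis unfolding 1 Ae[OF hh(2) c] by simp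
    next
      case 2
      have "\<alpha> a = - H a i" using 2 by (simp add: \<alpha>_def)
      moreover have "- ent ?F a c = - H a i * ent ?R i c + dd a * ent ?R a c"
      proof (cases "c \<in> {i..h}")
        case True
        then show ?thesis using middle_rows[OF 2, of c] hh(3) 2 in_block[OF True] by simp
      next
        case False
        then have "c \<noteq> i" "a \<noteq> c" using 2 hh(3) by auto
        then show ?thesis using off_block[OF disjI1[OF False]] hh(1,2) a by simp
      qed
      moreover have "a \<noteq> i" using 2 by simp
      ultimately show ?thesis unfolding Ae[OF a(1) c] using a(2) 2 by simp
    next
      case 3
      have "dd a = 1" "\<alpha> a = 0"
        using 3 hh(3) a i by (auto simp: dd_def \<delta>_def h_def hat_def \<alpha>_def)
      have nb: "a \<notin> {i..h}" "a \<noteq> i" "\<not> (i < a \<and> a < h)" using 3 hh(3) by auto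
      have "ent A a c = ent ?F a c"
        unfolding Ae[OF a(1) c] using a(2) nb by (simp only: if_False)
      also have "\<dots> = \<alpha> a * ent ?R i c + dd a * ent ?R a c"
        unfolding off_block[OF disjI2[OF nb(1)] a(1)] \<open>dd a = 1\<close> \<open>\<alpha> a = 0\<close> by simp
      finally show ?thesis .
    qed
  qed
  have AVe: "ent (A * ?V) a b = \<alpha> a * (if i = b then 1 else 0) + dd a * (if a = b then 1 else 0)"
    if a: "a \<in> {1..2 * n}" "a \<noteq> h" and b: "b \<in> {1..2 * n}" for a b
  proof -
    have "ent (A * ?V) a b = (\<Sum>c=1..2 * n. \<alpha> a * (ent ?R i c * ent ?V c b) + dd a * (ent ?R a c * ent ?V c b))"
      unfolding ent_mult[OF C(4,3) a(1) b]
      by (rule sum.cong) (use row[OF a] in \<open>auto simp: algebra_simps\<close>)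
    also have "\<dots> = \<alpha> a * ent (?R * ?V) i b + dd a * ent (?R * ?V) a b"
      unfolding ent_mult[OF C(2,3) a(1) b] ent_mult[OF C(2,3) hh(2) b]
      by (simp add: sum.distrib sum_distrib_left)
    finally show ?thesis unfolding inv using a b hh by simp
  qed
  have ddnz: "dd a \<noteq> 0" if "a \<in> {1..2 * n}" for a
    unfolding dd by (rule torus_entry_nonzero[OF \<delta>_nz that])
  have Ye: "ent Y a b = ent (A * ?V) a b * inverse (dd b)" if "a \<in> {1..2 * n}" "b \<in> {1..2 * n}" for a b
    unfolding Y_def ent_mult_torus[OF AV that] torus_entry_inverse dd ..
  have "unip_radical n i Y"
    unfolding unip_radical_def h_def[symmetric]
  proof (intro conjI ballI impI)
    fix a b assume ab: "a \<in> {1..2 * n}" "b \<in> {1..2 * n}"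
      and out: "\<not> (b = i \<and> i < a) \<and> \<not> (a = h \<and> b < h)"
    show "ent Y a b = (if a = b then 1 else 0)"
    proof (cases "a = h")
      case False
      have "\<alpha> a * (if i = b then 1 else 0) = 0" using out by (auto simp: \<alpha>_def)
      then show ?thesis
        using ddnz[OF ab(1)] unfolding Ye[OF ab] AVe[OF ab(1) False ab(2)] by auto
    next
      \<comment> \<open>In row \<open>h\<close> the radical constrains only the entries with
        \<open>h \<le> b\<close>. Row \<open>h\<close> of \<open>A\<close> is, up to sign, row
        \<open>i\<close> of the lower factor, whose single entry is in column \<open>i\<close>; so
        only row \<open>i\<close> of the inverse matters.\<close>
      case True
      have "ent A h c = (if c = i then - (sg n * sg i) else 0)" if "c \<in> {1..2 * n}" for c
        using that hh by (auto simp: Ae Fe hook_entry_def)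
      then have "ent (A * ?V) h b = - (sg n * sg i) * ent ?V i b"
        using hh ab by (subst ent_mult_single[OF C(4,3) hh(1) ab(2) hh(2)]) auto
      moreover have "h \<le> b" using out True by auto
      moreover have "ent ?V i b = 0" if "h < b"
        using that hh ab by (simp add: Ve)
      \<comment> \<open>The corner of the inverse hook is the reciprocal of the pivot up to sign;
        this makes the diagonal entry of \<open>Y\<close> equal to 1.\<close>
      moreover have "ent ?V i h = - (sg n * sg i / (d * (S n * T n)))"
      proof -
        have "u n \<noteq> 0" "s n \<noteq> 0" "S n \<noteq> 0" "T n \<noteq> 0" "d \<noteq> 0" using nz S_nz T_nz i by auto
        then show ?thesis
          using hh i by (simp add: Ve hook_entry_def prod_uminus_sg prod_q prod_p d'_def base S_base T_base
              power2_eq_square ac_simps)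
      qed
      moreover have "dd h = inverse (d * (S n * T n))"
        using hh by (simp add: dd_def \<delta>_def)
      moreover have "(sg n * sg i) * (sg n * sg i) = 1"
        using sg_sq[of n] sg_sq[of i] by (simp add: mult.left_commute mult.assoc)
      moreover have "d * (S n * T n) \<noteq> 0" using nz S_nz T_nz by auto
      ultimately show ?thesis
        using True unfolding Ye[OF ab] by (cases "h = b") auto
    qed
  qed (rule Yc)
  moreover have "A = Y * (?T * ?R)"
  proof -
    have T'T: "?T' * ?T = 1\<^sub>m (2 * n)" by (rule torus_inverse(2)) (rule \<delta>_nz)
    have "Y * (?T * ?R) = A * ?V * (?T' * (?T * ?R))"
      unfolding Y_def by (rule mult_sq_assoc[OF AV]) (simp_all add: C)
    also have "?T' * (?T * ?R) = ?T' * ?T * ?R"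
      by (rule mult_sq_assoc[symmetric, where N = "2 * n"]) (simp_all add: C)
    also have "\<dots> = ?R"
      unfolding T'T by (rule left_mult_one_mat[OF C(2)])
    also have "A * ?V * ?R = A * (?V * ?R)" by (rule mult_sq_assoc[OF C(4,3,2)])
    also have "\<dots> = A" unfolding inv using C(4) by simp
    finally show ?thesis ..
  qed
  ultimately show ?thesis unfolding A_def by blast
qed

end

section \<open>The factorization of all rows\<close>

text \<open>Counterparts of \<open>s_var\<close>, \<open>t_var\<close> and \<open>u_fun\<close> over
  an arbitrary field, so that one set of formulas serves for the variables and for real
  values.\<close>

definition row_s :: "(param \<Rightarrow> 'a) \<Rightarrow> nat \<Rightarrow> nat \<Rightarrow> 'a::field" where
  "row_s x i j = (if i = j then 1 else x (ParS i j))"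

definition row_t :: "(param \<Rightarrow> 'a) \<Rightarrow> nat \<Rightarrow> nat \<Rightarrow> 'a::field" where
  "row_t x i j = (if i = j then 1 else x (ParT i j))"

definition row_u :: "(param \<Rightarrow> 'a) \<Rightarrow> nat \<Rightarrow> nat \<Rightarrow> 'a::field" where
  "row_u x i j = (if i = j then 1 else row_t x i j + row_s x i j)"

text \<open>The parameters \<open>p\<close>, \<open>q\<close> and the torus element of the factorization of the
  product over the rows \<open>m, \<dots>, n\<close> only.\<close>

fun param_formula :: "nat \<Rightarrow> (param \<Rightarrow> 'a) \<Rightarrow> nat \<Rightarrow> param \<Rightarrow> 'a::field" where
  "param_formula n x m (ParT i j) = row_u x i (j - 1) / (row_u x i j * row_s x i (j - 1))
     * (\<Prod>k=m..<i. row_t x k (j - 1) / row_s x k (j - 1)) * (\<Prod>k=m..<i. row_s x k j / row_t x k j)"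
| "param_formula n x m (ParS i j) = row_u x i (j - 1) / (row_u x i j * row_s x i (j - 1))
     * (\<Prod>k=m..<i. row_t x k (j - 1) / row_s x k (j - 1)) * (\<Prod>k=m..i. row_s x k j / row_t x k j)"
| "param_formula n x m (ParD i) = (row_u x i n)\<^sup>2 / (x (ParD i) * (row_s x i n)\<^sup>2)
     * (\<Prod>k=m..<i. (row_t x k n)\<^sup>2 / (row_s x k n)\<^sup>2)"

definition torus_formula :: "nat \<Rightarrow> (param \<Rightarrow> 'a) \<Rightarrow> nat \<Rightarrow> nat \<Rightarrow> 'a::field" where
  "torus_formula n x m k = (if k < m then 1 else
     x (ParD k) * (\<Prod>j=m..<k. row_s x j k / row_t x j k) * (\<Prod>j=k+1..n. row_s x k j * row_t x k j))"

text \<open>Collects what the formulas divide by, the sums \<open>t + s\<close> included. It is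
  instantiated at the variables and at positive real points.\<close>

locale parameters =
  fixes n :: nat and x :: "param \<Rightarrow> 'a::field"
  assumes x_nz: "\<And>v. v \<in> params n \<Longrightarrow> x v \<noteq> 0"
    and sum_nz: "\<And>i j. 1 \<le> i \<Longrightarrow> i < j \<Longrightarrow> j \<le> n \<Longrightarrow> x (ParT i j) + x (ParS i j) \<noteq> 0"
begin

abbreviation "sv \<equiv> row_s x"
abbreviation "tv \<equiv> row_t x"
abbreviation "uv \<equiv> row_u x"
abbreviation "new_param \<equiv> param_formula n x"
abbreviation "torus_coeff \<equiv> torus_formula n x"

lemma sv_nz: "1 \<le> i \<Longrightarrow> i \<le> j \<Longrightarrow> j \<le> n \<Longrightarrow> sv i j \<noteq> 0"
  and tv_nz: "1 \<le> i \<Longrightarrow> i \<le> j \<Longrightarrow> j \<le> n \<Longrightarrow> tv i j \<noteq> 0"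
  and uv_nz: "1 \<le> i \<Longrightarrow> i \<le> j \<Longrightarrow> j \<le> n \<Longrightarrow> uv i j \<noteq> 0"
  and xD_nz: "1 \<le> i \<Longrightarrow> i \<le> n \<Longrightarrow> x (ParD i) \<noteq> 0"
  using x_nz sum_nz by (auto simp: row_s_def row_t_def row_u_def params_def)

lemma hook_params_row: "1 \<le> i \<Longrightarrow> i \<le> n \<Longrightarrow> hook_params n i (sv i) (tv i) (uv i) (x (ParD i))"
  by unfold_locales (auto simp: sv_nz tv_nz uv_nz xD_nz, simp_all add: row_s_def row_t_def row_u_def)

lemma torus_coeff_nz: "1 \<le> m \<Longrightarrow> 1 \<le> k \<Longrightarrow> k \<le> n \<Longrightarrow> torus_coeff m k \<noteq> 0"
  by (auto simp: torus_formula_def sv_nz tv_nz xD_nz)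

lemma new_param_nz:
  assumes "v \<in> params n" shows "new_param 1 v \<noteq> 0"
  using assms by (cases v) (auto simp: params_def sv_nz tv_nz uv_nz xD_nz)

text \<open>A letter with second index \<open>j\<close> belongs to generator \<open>j - 1\<close>,
  so the torus of row \<open>i\<close> rescales it by the quotient of its values at \<open>j\<close>
  and \<open>j - 1\<close>; this is the factor with index \<open>i\<close> in the products. For
  \<open>ParD\<close> it is the inverse square of the value at \<open>n\<close>.\<close>

lemma new_param_step:
  assumes i: "1 \<le> i" "i \<le> n" and v: "(v, k) \<in> set (X_tail n (Suc i))"
  shows "new_param i v = new_param (Suc i) v *
    root_ratio n (hook_params.\<delta> n i (sv i) (tv i) (x (ParD i))) k"
proof -
  interpret hook_params n i "sv i" "tv i" "uv i" "x (ParD i)" by (rule hook_params_row[OF i])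
  obtain i' where i': "Suc i \<le> i'" "i' \<le> n" "i' \<le> k" "k \<le> n"
    and c: "(\<exists>j. i' < j \<and> j \<le> n \<and> k = j - 1 \<and> (v = ParT i' j \<or> v = ParS i' j)) \<or> v = ParD i' \<and> k = n"
    using v by (rule X_tail_bounds)
  have pr: "prod f {i..<i'} = f i * prod f {Suc i..<i'}" "prod f {i..i'} = f i * prod f {Suc i..i'}"
    for f :: "nat \<Rightarrow> 'a"
    using i' by (simp_all add: prod.atLeast_Suc_lessThan prod.atLeast_Suc_atMost)
  from c show ?thesis
  proof (elim disjE exE conjE)
    fix j assume j: "i' < j" "j \<le> n" "k = j - 1" "v = ParT i' j"
    \<comment> \<open>The letter comes from a row after \<open>i\<close>, so even
      \<open>j - 1\<close> exceeds \<open>i\<close>: the pivot \<open>\<delta> i\<close> does not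
      enter and both places carry ratios \<open>s / t\<close>.\<close>
    have "k < n" "Suc k = j" "i < k" "i < j" using j(1-3) i' by auto
    then have "root_ratio n \<delta> k = (sv i j / tv i j) / (sv i (j - 1) / tv i (j - 1))"
      by (auto simp: root_ratio_def \<delta>_def)
    then show ?thesis by (simp add: j(4) pr ac_simps)
  next
    fix j assume j: "i' < j" "j \<le> n" "k = j - 1" "v = ParS i' j"
    have "k < n" "Suc k = j" "i < k" "i < j" using j(1-3) i' by auto
    then have "root_ratio n \<delta> k = (sv i j / tv i j) / (sv i (j - 1) / tv i (j - 1))"
      by (auto simp: root_ratio_def \<delta>_def)
    then show ?thesis by (simp add: j(4) pr ac_simps)
  next
    assume j: "v = ParD i'" "k = n"
    then have "root_ratio n \<delta> k = (tv i n)\<^sup>2 / (sv i n)\<^sup>2"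
      using i' by (simp add: root_ratio_def \<delta>_def power_divide)
    then show ?thesis by (simp add: j(1) pr ac_simps)
  qed
qed

text \<open>Row \<open>i\<close> contributes its pivot at place \<open>i\<close> and a factor
  \<open>s / t\<close> at each later place; this is the origin of the two products in
  \<open>T_k\<close>.\<close>

lemma torus_coeff_step:
  assumes i: "1 \<le> i" "i \<le> n"
  shows "torus_mat n (torus_coeff (Suc i)) * torus_mat n (hook_params.\<delta> n i (sv i) (tv i) (x (ParD i)))
    = torus_mat n (torus_coeff i)"
proof -
  interpret hook_params n i "sv i" "tv i" "uv i" "x (ParD i)" by (rule hook_params_row[OF i])
  show ?thesis
    unfolding torus_mult
  proof (rule torus_cong)
    fix k assume k: "1 \<le> k" "k \<le> n"
    consider "k < i" | "k = i" | "i < k" by linarith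
    then show "torus_coeff (Suc i) k * \<delta> k = torus_coeff i k"
    proof cases
      case 2
      have "{i<..n} = {i+1..n}" by auto
      then show ?thesis using 2 by (simp add: torus_formula_def \<delta>_def S_def T_def prod.distrib)
    next
      case 3
      then have "{i..<k} = insert i {Suc i..<k}" by auto
      then show ?thesis using 3 by (simp add: torus_formula_def \<delta>_def)
    qed (simp add: torus_formula_def \<delta>_def)
  qed
qed

text \<open>The lower factors of the later rows stand between the reflection and the lower factor of
  row \<open>i\<close>. \<open>refl_commute_F\<close> moves them past the reflection, after which
  the induction hypothesis and \<open>hook_factor\<close> apply to separate blocks.\<close>

lemma tail_factor:
  assumes "1 \<le> i" "i \<le> Suc n"
  shows "\<exists>Y. unilower n Y \<and> S_word n (X_tail n i) * F_word n x (X_tail n i) =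
    Y * (torus_mat n (torus_coeff i) * E_word n (new_param i) (X_tail n i))"
  using assms(2,1)
proof (induction i rule: inc_induct)
  case base
  have "torus_mat n (torus_coeff (Suc n)) = 1\<^sub>m (2 * n)"
    unfolding torus_one[symmetric] by (rule torus_cong) (simp add: torus_formula_def)
  moreover have "unilower n (1\<^sub>m (2 * n) :: 'a mat)" by (simp add: unilower_def)
  ultimately show ?case by (intro exI[of _ "1\<^sub>m (2 * n)"]) simp
next
  case (step i)
  have i: "1 \<le> i" "i \<le> n" using step by auto
  interpret hook_params n i "sv i" "tv i" "uv i" "x (ParD i)" by (rule hook_params_row[OF i])
  let ?w = "X_tail n (Suc i)" and ?r = "R_word n i"
  let ?Ws = "S_word n ?w :: 'a mat" and ?Wr = "S_word n ?r :: 'a mat"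
  let ?Fs = "F_word n x ?w" and ?Fr = "F_word n x ?r"
  let ?E = "E_word n (new_param (Suc i)) ?w" and ?E' = "E_word n (new_param i) ?w" and ?R = "E_word n (new_param i) ?r"
  let ?T = "torus_mat n (torus_coeff (Suc i))" and ?D = "torus_mat n \<delta>"
  obtain Y where Y: "unilower n Y" "?Ws * ?Fs = Y * (?T * ?E)"
    using step.IH i by auto
  have "\<exists>Y. unip_radical n i Y \<and> ?Wr * ?Fr = Y * (?D * ?R)"
  proof (rule hook_factor)
    show "new_param i (ParS i l) = q' l" for l
      by (simp add: q'_def p'_def)
    show "new_param i (ParT i l) = p' l" for l
      by (simp add: p'_def)
    show "new_param i (ParD i) = d'"
      by (simp add: d'_def)
  qed (simp_all add: row_s_def row_t_def)
  then obtain Y1 where Y1: "unip_radical n i Y1" "?Wr * ?Fr = Y1 * (?D * ?R)" by blast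
  have bound: "i < k \<and> k \<le> n" if "(v, k) \<in> set ?w" for v k
    using that by (rule X_tail_bounds) auto
  have "\<exists>Y2. unip_radical n i Y2 \<and> ?E * Y1 = Y2 * ?E"
    by (rule unip_radical_push_word[OF Y1(1) i(1)]) (rule bound)
  then obtain Y2 where Y2: "unip_radical n i Y2" "?E * Y1 = Y2 * ?E" by blast
  obtain Y3 where Y3: "unilower n Y3" "?T * Y2 = Y3 * ?T"
    using torus_push_unilower[OF unip_radical_unilower[OF Y2(1)], of "torus_coeff (Suc i)"] torus_coeff_nz by auto
  have ED: "?E * ?D = ?D * ?E'"
  proof (rule word_intertwine)
    fix v k assume v: "(v, k) \<in> set ?w"
    then show "E_mat n k (new_param (Suc i) v) * ?D = ?D * E_mat n k (new_param i v)"
      unfolding new_param_step[OF i v] using bound[OF v] by (intro E_mult_torus \<delta>_nz) auto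
  qed simp_all
  have FW: "?Fs * ?Wr = ?Wr * ?Fs"
  proof (rule word_intertwine)
    fix v k assume "(v, k) \<in> set ?w"
    then show "F_mat n k (x v) * ?Wr = ?Wr * F_mat n k (x v)"
      using bound i(1) by (intro refl_commute_F) auto
  qed simp_all
  have C: "?Ws \<in> carrier_mat (2 * n) (2 * n)" "?Wr \<in> carrier_mat (2 * n) (2 * n)"
    "?Fs \<in> carrier_mat (2 * n) (2 * n)" "?Fr \<in> carrier_mat (2 * n) (2 * n)"
    "?E \<in> carrier_mat (2 * n) (2 * n)" "?E' \<in> carrier_mat (2 * n) (2 * n)" "?R \<in> carrier_mat (2 * n) (2 * n)"
    "?T \<in> carrier_mat (2 * n) (2 * n)" "?D \<in> carrier_mat (2 * n) (2 * n)"
    "Y \<in> carrier_mat (2 * n) (2 * n)" "Y1 \<in> carrier_mat (2 * n) (2 * n)" "Y2 \<in> carrier_mat (2 * n) (2 * n)"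
    "Y3 \<in> carrier_mat (2 * n) (2 * n)"
    using Y(1) Y1(1) Y2(1) Y3(1) by (simp_all add: unilower_carrier unip_radical_unilower)
  note assoc = mult_sq_assoc[where N = "2 * n"]
  \<comment> \<open>One step of the rearrangement: exchanging the two factors at the head of a
    right-nested product.\<close>
  have swap: "M * (K * L) = K' * (M' * L)" if "M * K = K' * M'" "M \<in> carrier_mat (2 * n) (2 * n)"
    "K \<in> carrier_mat (2 * n) (2 * n)" "L \<in> carrier_mat (2 * n) (2 * n)"
    "K' \<in> carrier_mat (2 * n) (2 * n)" "M' \<in> carrier_mat (2 * n) (2 * n)" for M K L K' M' :: "'a mat"
    using that assoc[of M K L] assoc[of K' M' L] by simp
  note mc = mult_sq_carrier
  have "S_word n (X_tail n i) * F_word n x (X_tail n i) = ?Ws * ?Wr * (?Fs * ?Fr)"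
    using i(2) by (simp add: X_tail_rec word_mat_append)
  also have "\<dots> = ?Ws * (?Wr * (?Fs * ?Fr))" by (intro assoc mc C)
  also have "?Wr * (?Fs * ?Fr) = ?Fs * (?Wr * ?Fr)" by (intro swap[OF FW[symmetric]] C)
  also have "?Ws * (?Fs * (?Wr * ?Fr)) = Y * (?T * ?E * (?Wr * ?Fr))"
    by (intro swap[OF Y(2)] mc C)
  also have "?T * ?E * (?Wr * ?Fr) = ?T * (?E * (?Wr * ?Fr))" by (intro assoc mc C)
  also have "?E * (?Wr * ?Fr) = Y2 * (?E * (?D * ?R))"
    unfolding Y1(2) by (intro swap[OF Y2(2)] mc C)
  also have "?E * (?D * ?R) = ?D * (?E' * ?R)" by (intro swap[OF ED] mc C)
  also have "?T * (Y2 * (?D * (?E' * ?R))) = Y3 * (?T * (?D * (?E' * ?R)))"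
    by (intro swap[OF Y3(2)] mc C)
  also have "?T * (?D * (?E' * ?R)) = ?T * ?D * (?E' * ?R)" by (intro assoc[symmetric] mc C)
  also have "Y * (Y3 * (?T * ?D * (?E' * ?R))) = Y * Y3 * (?T * ?D * (?E' * ?R))"
    by (intro assoc[symmetric] mc C)
  also have "?T * ?D = torus_mat n (torus_coeff i)" by (rule torus_coeff_step[OF i])
  also have "?E' * ?R = E_word n (new_param i) (X_tail n i)"
    using i(2) by (simp add: X_tail_rec word_mat_append)
  finally show ?case using unilower_mult[OF Y(1) Y3(1)] by blast
qed

lemma X_factor:
  "\<exists>Y. unilower n Y \<and> X_mat n (\<lambda>v. - x v) * w0_mat n =
    Y * torus_mat n (torus_coeff 1) * X_mat n (new_param 1)"
proof -
  obtain Y where Y: "unilower n Y" "S_word n (X_tail n 1) * F_word n x (X_tail n 1) =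
    Y * (torus_mat n (torus_coeff 1) * E_word n (new_param 1) (X_tail n 1))"
    using tail_factor[of 1] by auto
  have "Y * (torus_mat n (torus_coeff 1) * X_mat n (new_param 1)) =
      Y * torus_mat n (torus_coeff 1) * X_mat n (new_param 1)"
    by (rule mult_sq_assoc[where N = "2 * n", symmetric])
       (use unilower_carrier[OF Y(1)] in \<open>simp_all add: X_mat_word\<close>)
  moreover have "X_mat n (new_param 1) = E_word n (new_param 1) (X_tail n 1)"
    by (simp only: X_mat_word X_word_tail)
  ultimately show ?thesis
    using Y(1) X_neg_mult_w0[of n x] unfolding Y(2) by (intro exI[of _ Y]) simp
qed

end

section \<open>Symplectic matrices\<close>

lemma symp_form_mat:
  assumes x: "x \<in> carrier_vec (2 * n)" and y: "y \<in> carrier_vec (2 * n)"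
  shows "symp_form n x y = x \<bullet> (form_mat n 1 *\<^sub>v y)"
proof -
  have row: "(form_mat n 1 *\<^sub>v y) $ (a - 1) = (if a \<le> n then y $ (hat n a - 1) else - (y $ (hat n a - 1)))"
    if a: "a \<in> {1..2 * n}" for a
  proof -
    have "(form_mat n 1 *\<^sub>v y) $ (a - 1) = (\<Sum>j<2 * n. form_mat n 1 $$ (a - 1, j) * y $ j)"
      using a y by (auto simp: scalar_prod_def lessThan_atLeast0 form_mat_def mat_of_def)
    also have "\<dots> = (\<Sum>j<2 * n. if j = hat n a - 1 then (if a \<le> n then y $ j else - (y $ j)) else 0)"
      by (rule sum.cong) (use a in \<open>auto simp: form_mat_def mat_of_def hat_def\<close>)
    also have "\<dots> = (if a \<le> n then y $ (hat n a - 1) else - (y $ (hat n a - 1)))"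
      using a by (auto simp: hat_def)
    finally show ?thesis .
  qed
  have "x \<bullet> (form_mat n 1 *\<^sub>v y) = (\<Sum>j<2 * n. x $ j * (form_mat n 1 *\<^sub>v y) $ j)"
    using x y by (auto simp: scalar_prod_def lessThan_atLeast0 form_mat_def mat_of_def)
  also have "\<dots> = (\<Sum>a\<in>{1..2 * n}. x $ (a - 1) * (form_mat n 1 *\<^sub>v y) $ (a - 1))"
    by (rule sum.reindex_bij_witness[of _ "\<lambda>a. a - 1" Suc]) auto
  also have "{1..2 * n} = {1..n} \<union> hat n ` {1..n}"
  proof (intro equalityI subsetI)
    fix a assume "a \<in> {1..2 * n}"
    then have "a \<in> {1..n} \<or> a = hat n (hat n a) \<and> hat n a \<in> {1..n}" by (auto simp: hat_def)
    then show "a \<in> {1..n} \<union> hat n ` {1..n}" by blast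
  qed (auto simp: hat_def)
  also have "(\<Sum>a\<in>{1..n} \<union> hat n ` {1..n}. x $ (a - 1) * (form_mat n 1 *\<^sub>v y) $ (a - 1)) =
      (\<Sum>a=1..n. x $ (a - 1) * y $ (hat n a - 1)) + (\<Sum>a\<in>hat n ` {1..n}. - (x $ (a - 1) * y $ (hat n a - 1)))"
  proof -
    have "(\<Sum>a=1..n. x $ (a - 1) * (form_mat n 1 *\<^sub>v y) $ (a - 1)) = (\<Sum>a=1..n. x $ (a - 1) * y $ (hat n a - 1))"
    proof (rule sum.cong[OF refl])
      fix a assume a: "a \<in> {1..n}"
      then have "a \<in> {1..2 * n}" "a \<le> n" by auto
      then show "x $ (a - 1) * (form_mat n 1 *\<^sub>v y) $ (a - 1) = x $ (a - 1) * y $ (hat n a - 1)"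
        using row[of a] by simp
    qed
    moreover have "(\<Sum>a\<in>hat n ` {1..n}. x $ (a - 1) * (form_mat n 1 *\<^sub>v y) $ (a - 1)) =
        (\<Sum>a\<in>hat n ` {1..n}. - (x $ (a - 1) * y $ (hat n a - 1)))"
    proof (rule sum.cong[OF refl])
      fix a assume "a \<in> hat n ` {1..n}"
      then have "a \<in> {1..2 * n}" "\<not> a \<le> n" by (auto simp: hat_def)
      then show "x $ (a - 1) * (form_mat n 1 *\<^sub>v y) $ (a - 1) = - (x $ (a - 1) * y $ (hat n a - 1))"
        using row[of a] by simp
    qed
    moreover have "{1..n} \<inter> hat n ` {1..n} = {}" by (auto simp: hat_def)
    ultimately show ?thesis by (simp add: sum.union_disjoint)
  qed
  also have "(\<Sum>a\<in>hat n ` {1..n}. - (x $ (a - 1) * y $ (hat n a - 1))) =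
      (\<Sum>a=1..n. - (x $ (hat n a - 1) * y $ (a - 1)))"
    by (subst sum.reindex) (auto simp: hat_def inj_on_def intro!: sum.cong)
  finally show ?thesis
    by (simp add: symp_form_def sum_subtractf sum_negf)
qed

lemma Sp_I:
  assumes A: "A \<in> carrier_mat (2 * n) (2 * n)" and "transpose_mat A * (form_mat n 1 * A) = form_mat n 1"
  shows "A \<in> Sp n"
  unfolding Sp_def
proof (intro CollectI conjI ballI)
  fix x y :: "'a vec" assume x: "x \<in> carrier_vec (2 * n)" and y: "y \<in> carrier_vec (2 * n)"
  have Ax: "A *\<^sub>v x \<in> carrier_vec (2 * n)" and Ay: "A *\<^sub>v y \<in> carrier_vec (2 * n)"
    using A x y by auto
  have At: "transpose_mat A \<in> carrier_mat (2 * n) (2 * n)" using A by simp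
  have fA: "form_mat n 1 * A \<in> carrier_mat (2 * n) (2 * n)" using A by (auto intro!: mult_sq_carrier)
  have "(A *\<^sub>v x) \<bullet> (form_mat n 1 *\<^sub>v (A *\<^sub>v y)) = x \<bullet> (transpose_mat A *\<^sub>v (form_mat n 1 *\<^sub>v (A *\<^sub>v y)))"
    using transpose_vec_mult_scalar[OF At _ x, of "form_mat n 1 *\<^sub>v (A *\<^sub>v y)"] Ay
    by (simp add: mult_mat_vec_carrier[OF form_mat_carrier])
  also have "\<dots> = x \<bullet> (transpose_mat A *\<^sub>v ((form_mat n 1 * A) *\<^sub>v y))"
    using A y by (simp add: assoc_mult_mat_vec[OF form_mat_carrier])
  also have "\<dots> = x \<bullet> ((transpose_mat A * (form_mat n 1 * A)) *\<^sub>v y)"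
    by (simp only: assoc_mult_mat_vec[OF At fA y])
  finally show "symp_form n (A *\<^sub>v x) (A *\<^sub>v y) = symp_form n x y"
    unfolding symp_form_mat[OF Ax Ay] symp_form_mat[OF x y] assms(2) .
qed (rule A)

lemma Sp_carrier: "A \<in> Sp n \<Longrightarrow> A \<in> carrier_mat (2 * n) (2 * n)"
  by (simp add: Sp_def)

lemma Sp_one: "1\<^sub>m (2 * n) \<in> Sp n"
  by (simp add: Sp_def)

lemma Sp_mult: "A \<in> Sp n \<Longrightarrow> B \<in> Sp n \<Longrightarrow> A * B \<in> Sp n"
  by (auto simp: Sp_def assoc_mult_mat_vec[of _ "2 * n" "2 * n" _ "2 * n"] intro!: mult_sq_carrier)

lemma transpose_E_mat: "transpose_mat (E_mat n k c) = F_mat n k c"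
  by (rule eq_matI) (auto simp: F_mat_def E_mat_def mat_of_def)

text \<open>The other half of the Lie algebra condition, \<open>f_k J = - J e_k\<close>. As
  \<open>F_mat\<close> is the transpose of \<open>E_mat\<close>, it makes \<open>E_mat\<close>
  symplectic, while \<open>E_form\<close> does so for \<open>F_mat\<close>.\<close>

lemma F_form:
  assumes k: "1 \<le> k" "k \<le> n"
  shows "F_mat n k (c :: 'a::field) * form_mat n 1 = form_mat n 1 * E_mat n k (- c)"
proof (rule mat_eqI_ent[of _ n])
  fix a b assume ab: "a \<in> {1..2 * n}" "b \<in> {1..2 * n}"
  have w: "ent (form_mat n (1 :: 'a)) a b = (if a + b = 2 * n + 1 then (if a \<le> n then 1 else - 1) else 0)"
    if "a \<in> {1..2 * n}" "b \<in> {1..2 * n}" for a b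
    using ent_form_mat[OF that, of "1 :: 'a"] .
  have 1: "root_coeff n k c (a - 1) * ent (form_mat n 1) (a - 1) b =
      (if a + b = 2 * n + 2 then c * root_coeff n k 1 (a - 1) * (if a \<le> Suc n then 1 else - 1) else 0)"
  proof (cases "a = 1")
    case True
    then show ?thesis using root_coeff_outside[OF k, of 0 c] ab by auto
  next
    case False
    then have a: "a - 1 \<in> {1..2 * n}" using ab by auto
    show ?thesis unfolding w[OF a ab(2)] using False ab by (subst root_coeff_scale) auto
  qed
  have 2: "root_coeff n k (- c) (b - 1) * ent (form_mat n 1) a (b - 1) =
      (if a + b = 2 * n + 2 then - c * root_coeff n k 1 (b - 1) * (if a \<le> n then 1 else - 1) else 0)"
  proof (cases "b = 1")
    case True
    then show ?thesis using root_coeff_outside[OF k, of 0 "- c"] ab by auto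
  next
    case False
    then have b: "b - 1 \<in> {1..2 * n}" using ab by auto
    show ?thesis unfolding w[OF ab(1) b] using False ab by (subst root_coeff_scale) auto
  qed
  have 3: "c * root_coeff n k 1 (a - 1) * (if a \<le> Suc n then 1 else - 1) = - c * root_coeff n k 1 (b - 1) * (if a \<le> n then 1 else - 1)"
    if s: "a + b = 2 * n + 2"
  proof (cases "a = Suc n")
    case True
    then have "b = Suc n" using s by simp
    then show ?thesis using True by simp
  next
    case False
    have b: "b - 1 = 2 * n - (a - 1)" and a: "a - 1 \<noteq> n" "a - 1 \<le> 2 * n" using s False ab by auto
    have "root_coeff n k (1 :: 'a) (b - 1) = - root_coeff n k 1 (a - 1)"
      using a k unfolding root_coeff_def b by auto
    then show ?thesis using False by auto
  qed
  show "ent (F_mat n k c * form_mat n 1) a b = ent (form_mat n 1 * E_mat n k (- c)) a b"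
    unfolding ent_F_mult[OF form_mat_carrier ab k] ent_mult_E[OF form_mat_carrier ab k] 1 2 using 3 by simp
qed (auto intro!: mult_sq_carrier)

lemma E_mat_Sp:
  assumes k: "1 \<le> k" "k \<le> n"
  shows "E_mat n k c \<in> Sp n"
proof (rule Sp_I)
  have "transpose_mat (E_mat n k c) * (form_mat n 1 * E_mat n k c) = F_mat n k c * form_mat n 1 * E_mat n k c"
    unfolding transpose_E_mat by (rule mult_sq_assoc[where N = "2 * n", symmetric]) simp_all
  also have "\<dots> = form_mat n 1 * (E_mat n k (- c) * E_mat n k c)"
    unfolding F_form[OF k] by (rule mult_sq_assoc[where N = "2 * n"]) simp_all
  also have "\<dots> = form_mat n 1"
    unfolding E_mat_inverse'[OF k] by (rule right_mult_one_mat[OF form_mat_carrier])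
  finally show "transpose_mat (E_mat n k c) * (form_mat n 1 * E_mat n k c) = form_mat n 1" .
qed simp

lemma F_mat_Sp:
  assumes k: "1 \<le> k" "k \<le> n"
  shows "F_mat n k c \<in> Sp n"
proof (rule Sp_I)
  have "transpose_mat (F_mat n k c) * (form_mat n 1 * F_mat n k c) = E_mat n k c * (E_mat n k (- c) * form_mat n 1)"
    unfolding transpose_F_mat E_form[OF k] ..
  also have "\<dots> = E_mat n k c * E_mat n k (- c) * form_mat n 1"
    by (rule mult_sq_assoc[where N = "2 * n", symmetric]) simp_all
  also have "\<dots> = form_mat n 1"
    unfolding E_mat_inverse[OF k] by (rule left_mult_one_mat[OF form_mat_carrier])
  finally show "transpose_mat (F_mat n k c) * (form_mat n 1 * F_mat n k c) = form_mat n 1" .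
qed simp

lemma torus_Sp:
  assumes c: "\<And>k. 1 \<le> k \<Longrightarrow> k \<le> n \<Longrightarrow> c k \<noteq> 0"
  shows "torus_mat n c \<in> Sp n"
proof (rule Sp_I)
  have t: "transpose_mat (torus_mat n c) = torus_mat n c"
    by (rule eq_matI) (auto simp: torus_mat_def mat_unit_def intro!: sum.cong)
  have fT: "form_mat n 1 * torus_mat n c \<in> carrier_mat (2 * n) (2 * n)" by (intro mult_sq_carrier) simp_all
  show "transpose_mat (torus_mat n c) * (form_mat n 1 * torus_mat n c) = form_mat n 1"
    unfolding t
  proof (rule mat_eqI_ent[of _ n])
    fix a b assume ab: "a \<in> {1..2 * n}" "b \<in> {1..2 * n}"
    have "torus_entry n c a * torus_entry n c (hat n a) = 1"
      using ab c[of a] c[of "hat n a"] by (auto simp: torus_entry_def hat_def)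
    then show "ent (torus_mat n c * (form_mat n 1 * torus_mat n c)) a b = ent (form_mat n 1) a b"
      unfolding ent_torus_mult[OF fT ab] ent_mult_torus[OF form_mat_carrier ab]
      using ab by (auto simp: form_mat_def)
  qed (auto intro!: mult_sq_carrier)
qed simp

lemma word_mat_Sp:
  assumes "\<And>v k. (v, k) \<in> set w \<Longrightarrow> G k v \<in> Sp n"
  shows "word_mat n G w \<in> Sp n"
  using assms by (induction w) (auto intro!: Sp_one Sp_mult)

section \<open>Uniqueness of the parameters\<close>

definition uniupper :: "nat \<Rightarrow> 'a::field mat \<Rightarrow> bool" where
  "uniupper n V \<longleftrightarrow> V \<in> carrier_mat (2 * n) (2 * n) \<and>
    (\<forall>a\<in>{1..2 * n}. \<forall>b\<in>{1..2 * n}. b \<le> a \<longrightarrow> ent V a b = (if a = b then 1 else 0))"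

lemma uniupper_E_word:
  assumes "\<And>v k. (v, k) \<in> set w \<Longrightarrow> 1 \<le> k \<and> k \<le> n"
  shows "uniupper n (E_word n x w)"
  using assms
proof (induction w)
  case (Cons y w)
  obtain v k where y: "y = (v, k)" by force
  have k: "1 \<le> k" "k \<le> n" using Cons.prems y by auto
  have IH: "uniupper n (E_word n x w)" using Cons by auto
  have C: "E_word n x w \<in> carrier_mat (2 * n) (2 * n)" by simp
  have "ent (E_mat n k (x v) * E_word n x w) a b = (if a = b then 1 else 0)"
    if ab: "a \<in> {1..2 * n}" "b \<in> {1..2 * n}" "b \<le> a" for a b
  proof -
    have "root_coeff n k (x v) a * ent (E_word n x w) (Suc a) b = 0"
    proof (cases "a < 2 * n")
      case True
      then have "Suc a \<in> {1..2 * n}" "b \<le> Suc a" "Suc a \<noteq> b" using ab by auto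
      then have "ent (E_word n x w) (Suc a) b = 0" using IH ab(2) unfolding uniupper_def by simp
      then show ?thesis by simp
    next
      case False
      then show ?thesis using root_coeff_outside[OF k, of a "x v"] by simp
    qed
    moreover have "ent (E_word n x w) a b = (if a = b then 1 else 0)"
      using IH ab unfolding uniupper_def by blast
    ultimately show ?thesis unfolding ent_E_mult[OF C ab(1,2) k] by simp
  qed
  then show ?case by (simp add: y uniupper_def mult_sq_carrier)
qed (simp add: uniupper_def)

lemma uniupper_mult:
  assumes A: "uniupper n A" and B: "uniupper n B"
  shows "uniupper n (A * B)"
  unfolding uniupper_def
proof (intro conjI ballI impI)
  have C: "A \<in> carrier_mat (2 * n) (2 * n)" "B \<in> carrier_mat (2 * n) (2 * n)"
    using A B by (simp_all add: uniupper_def)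
  show "A * B \<in> carrier_mat (2 * n) (2 * n)" by (intro mult_sq_carrier C)
  fix a b assume ab: "a \<in> {1..2 * n}" "b \<in> {1..2 * n}" "b \<le> a"
  have "(\<Sum>c=1..2 * n. ent A a c * ent B c b) = (\<Sum>c=1..2 * n. if c = a then (if a = b then 1 else 0) else 0)"
  proof (rule sum.cong[OF refl])
    fix c assume c: "c \<in> {1..2 * n}"
    consider "a < c" | "c = a" | "c < a" by linarith
    then show "ent A a c * ent B c b = (if c = a then (if a = b then 1 else 0) else 0)"
      using A B ab c by cases (simp_all add: uniupper_def)
  qed
  then show "ent (A * B) a b = (if a = b then 1 else 0)"
    unfolding ent_mult[OF C ab(1,2)] using ab by (simp add: sum.delta)
qed

text \<open>Compare rows from the top. In columns \<open>b \<ge> a\<close>, row \<open>a\<close> of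
  the left side gets nothing from earlier rows, where \<open>V\<close> is known to be the identity,
  and nothing from later rows, as \<open>Y\<close> is lower triangular; what remains is
  \<open>T a a * V a b\<close>.\<close>

lemma triangular_factorization_unique:
  fixes c :: "nat \<Rightarrow> 'a::field"
  assumes Y: "unilower n Y" "unilower n Y'" and V: "uniupper n V"
    and T: "T \<in> carrier_mat (2 * n) (2 * n)" "diagonal_mat T"
    and c: "\<And>k. 1 \<le> k \<Longrightarrow> k \<le> n \<Longrightarrow> c k \<noteq> 0"
    and eq: "Y * (T * V) = Y' * torus_mat n c"
  shows "T = torus_mat n c" "V = 1\<^sub>m (2 * n)"
proof -
  note Yc = Y[THEN unilower_carrier]
  have Vc: "V \<in> carrier_mat (2 * n) (2 * n)" using V by (simp add: uniupper_def)
  have TV: "T * V \<in> carrier_mat (2 * n) (2 * n)" by (intro mult_sq_carrier T Vc)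
  have Td: "ent T a b = 0" if "a \<in> {1..2 * n}" "b \<in> {1..2 * n}" "a \<noteq> b" for a b
    using T that unfolding diagonal_mat_def ent_def by auto
  have TVe: "ent (T * V) a b = ent T a a * ent V a b" if "a \<in> {1..2 * n}" "b \<in> {1..2 * n}" for a b
    using that by (intro ent_mult_single[OF T(1) Vc that(1,2,1)]) (auto intro: Td)
  have row: "ent T a a = torus_entry n c a \<and> (\<forall>b\<in>{1..2 * n}. ent V a b = (if a = b then 1 else 0))"
    if "a \<in> {1..2 * n}" for a
    using that
  proof (induction a rule: less_induct)
    case (less a)
    have e: "ent T a a * ent V a b = (if a = b then torus_entry n c b else 0)"
      if b: "b \<in> {1..2 * n}" "a \<le> b" for b
    proof -
      have "ent (Y * (T * V)) a b = (\<Sum>d=1..2 * n. if d = a then ent T a a * ent V a b else 0)"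
        unfolding ent_mult[OF Yc(1) TV less.prems b(1)]
      proof (rule sum.cong[OF refl])
        fix d assume d: "d \<in> {1..2 * n}"
        consider "d < a" | "d = a" | "a < d" by linarith
        then show "ent Y a d * ent (T * V) d b = (if d = a then ent T a a * ent V a b else 0)"
        proof cases
          case 1
          have "ent V d b = 0" using less.IH[OF 1 d] b 1 by auto
          then show ?thesis using 1 unfolding TVe[OF d b(1)] by simp
        next
          case 2
          have "ent Y a a = 1" using Y(1) less.prems unfolding unilower_def by simp
          then show ?thesis unfolding 2 TVe[OF less.prems b(1)] by simp
        next
          case 3
          then have "ent Y a d = 0" using Y(1) d less.prems unfolding unilower_def by simp
          then show ?thesis using 3 by simp
        qed
      qed
      also have "\<dots> = ent T a a * ent V a b" using less.prems by (simp add: sum.delta)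
      finally have "ent T a a * ent V a b = ent (Y' * torus_mat n c) a b" by (simp add: eq)
      also have "\<dots> = (if a = b then torus_entry n c b else 0)"
        unfolding ent_mult_torus[OF Yc(2) less.prems b(1)] using Y(2) less.prems b unfolding unilower_def by simp
      finally show ?thesis .
    qed
    have "ent V a a = 1" using V less.prems by (simp add: uniupper_def)
    then have t: "ent T a a = torus_entry n c a" using e[OF less.prems order_refl] by simp
    moreover have "ent V a b = (if a = b then 1 else 0)" if b: "b \<in> {1..2 * n}" for b
    proof (cases "b \<le> a")
      case True
      then show ?thesis using V b less.prems by (simp add: uniupper_def)
    next
      case False
      then have "torus_entry n c a * ent V a b = 0" using e[OF b] t by simp
      then show ?thesis using torus_entry_nonzero[OF c less.prems] False by auto
    qed
    ultimately show ?case by blast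
  qed
  show "T = torus_mat n c"
    by (rule mat_eqI_ent[OF T(1) torus_mat_carrier]) (use row Td in \<open>auto simp: ent_torus\<close>)
  show "V = 1\<^sub>m (2 * n)"
    by (rule mat_eqI_ent[OF Vc]) (use row in auto)
qed

text \<open>The entry in column \<open>hat n l\<close> is \<open>d * prod q {i<..n}\<close> times
  the product of \<open>- p\<close> over \<open>{l<..n}\<close>: \<open>l = n\<close> gives the
  constant, and quotients of neighbouring entries give \<open>p\<close>. The columns up to
  \<open>n\<close> then give \<open>q\<close> one by one, and the constant gives \<open>d\<close>.
  All divisions are by the reference parameters.\<close>

lemma hook_entry_first_row_inj:
  fixes p q p0 q0 :: "nat \<Rightarrow> 'a::field"
  assumes i: "1 \<le> i" "i \<le> n"
    and nz: "\<And>l. i < l \<Longrightarrow> l \<le> n \<Longrightarrow> p0 l \<noteq> 0" "\<And>l. i < l \<Longrightarrow> l \<le> n \<Longrightarrow> q0 l \<noteq> 0" "d0 \<noteq> 0"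
    and eq: "\<And>b. i \<le> b \<Longrightarrow> b \<le> hat n i \<Longrightarrow> hook_entry n q p d i b = hook_entry n q0 p0 d0 i b"
  shows "(\<forall>l. i < l \<and> l \<le> n \<longrightarrow> p l = p0 l \<and> q l = q0 l) \<and> d = d0"
proof -
  have right: "d * prod q {i<..n} * (\<Prod>k\<in>{l<..n}. - p k) = d0 * prod q0 {i<..n} * (\<Prod>k\<in>{l<..n}. - p0 k)"
    if "i \<le> l" "l \<le> n" for l
  proof -
    have "i \<le> hat n l" "hat n l \<le> hat n i" "n < hat n l" "hat n (hat n l) = l"
      using that i by (auto simp: hat_def)
    then show ?thesis using eq[of "hat n l"] i by (simp add: hook_entry_def)
  qed
  have C: "d * prod q {i<..n} = d0 * prod q0 {i<..n}" using right[of n] i by simp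
  have Cnz: "d0 * prod q0 {i<..n} \<noteq> 0" using nz by auto
  have pp: "(\<Prod>k\<in>{l<..n}. - p k) = (\<Prod>k\<in>{l<..n}. - p0 k)" if "i \<le> l" "l \<le> n" for l
    using right[OF that] Cnz unfolding C by simp
  have p: "p l = p0 l" if l: "i < l" "l \<le> n" for l
  proof -
    have "{l - 1<..n} = insert l {l<..n}" using l by auto
    then have "- p l * (\<Prod>k\<in>{l<..n}. - p0 k) = - p0 l * (\<Prod>k\<in>{l<..n}. - p0 k)"
      using pp[of "l - 1"] pp[of l] l by simp
    moreover have "(\<Prod>k\<in>{l<..n}. - p0 k) \<noteq> 0" using nz(1) l by auto
    ultimately show ?thesis by simp
  qed
  have q: "q l = q0 l" if "i < l" "l \<le> n" for l
    using that
  proof (induction l rule: less_induct)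
    case (less l)
    have "hook_entry n q p d i l = hook_entry n q0 p0 d0 i l"
      using less.prems i by (intro eq) (auto simp: hat_def)
    then have "(q l + p0 l) * prod q {i<..<l} = (q0 l + p0 l) * prod q0 {i<..<l}"
      using less.prems p by (simp add: hook_entry_def)
    moreover have "prod q {i<..<l} = prod q0 {i<..<l}"
      by (rule prod.cong) (use less in auto)
    moreover have "prod q0 {i<..<l} \<noteq> 0" using nz(2) less.prems by auto
    ultimately show ?case by simp
  qed
  have "prod q {i<..n} = prod q0 {i<..n}" by (rule prod.cong) (use q in auto)
  then have "d = d0" using C nz by auto
  then show ?thesis using p q by blast
qed

text \<open>Generators above \<open>i\<close> change no row up to \<open>i\<close>; hence row
  \<open>i\<close> of a tail is row \<open>i\<close> of its last factor, from which the parameters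
  are read off.\<close>

lemma E_word_unit_rows:
  assumes "\<And>v k. (v, k) \<in> set w \<Longrightarrow> i < k \<and> k \<le> n" and a: "a \<in> {1..2 * n}" "a \<le> i" and b: "b \<in> {1..2 * n}"
  shows "ent (E_word n x w) a b = (if a = b then 1 else 0)"
  using assms(1)
proof (induction w)
  case (Cons y w)
  obtain v k where y: "y = (v, k)" by force
  have k: "i < k" "1 \<le> k" "k \<le> n" using Cons.prems y by fastforce+
  have z: "root_coeff n k (x v) a = 0" using k a by (auto simp: root_coeff_def)
  have C: "E_word n x w \<in> carrier_mat (2 * n) (2 * n)" by simp
  have "ent (E_word n x w) a b = (if a = b then 1 else 0)"
    by (rule Cons.IH) (use Cons.prems in auto)
  then show ?case
    by (simp add: y ent_E_mult[OF C a(1) b k(2,3)] z)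
qed (use a b in simp)

lemma X_tail_inj_step:
  fixes p p0 :: "param \<Rightarrow> 'a::field"
  assumes i: "1 \<le> i" "i \<le> n" and nz: "\<And>v. v \<in> params n \<Longrightarrow> p0 v \<noteq> 0"
    and eq: "E_word n p (X_tail n i) = E_word n p0 (X_tail n i)"
  shows "(\<forall>l. i < l \<and> l \<le> n \<longrightarrow> p (ParT i l) = p0 (ParT i l) \<and> p (ParS i l) = p0 (ParS i l)) \<and> p (ParD i) = p0 (ParD i)"
    and "E_word n p (X_tail n (Suc i)) = E_word n p0 (X_tail n (Suc i))"
proof -
  let ?w = "X_tail n (Suc i)" and ?r = "R_word n i"
  have bound: "i < k \<and> k \<le> n" if "(v, k) \<in> set ?w" for v k
    using that by (rule X_tail_bounds) auto
  have h: "hat n i \<le> 2 * n" "i \<le> hat n i" using i by (auto simp: hat_def)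
  have ir: "i \<in> {1..2 * n}" using i by auto
  have unit: "ent (E_word n y ?w) i d = (if i = d then 1 else 0)" if "d \<in> {1..2 * n}" for y :: "param \<Rightarrow> 'a" and d
    by (rule E_word_unit_rows[OF _ ir order_refl that]) (rule bound)
  have row: "ent (E_word n y (X_tail n i)) i b = hook_entry n (\<lambda>l. y (ParS i l)) (\<lambda>l. y (ParT i l)) (y (ParD i)) i b"
    if b: "i \<le> b" "b \<le> hat n i" for y :: "param \<Rightarrow> 'a" and b
  proof -
    have br: "b \<in> {1..2 * n}" using b i h by auto
    have C: "E_word n y ?w \<in> carrier_mat (2 * n) (2 * n)" "E_word n y ?r \<in> carrier_mat (2 * n) (2 * n)" by simp_all
    have "ent (E_word n y (X_tail n i)) i b = ent (E_word n y ?w * E_word n y ?r) i b"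
      using i by (simp add: X_tail_rec word_mat_append)
    also have "\<dots> = ent (E_word n y ?w) i i * ent (E_word n y ?r) i b"
      by (rule ent_mult_single[OF C ir br ir]) (simp add: unit)
    also have "ent (E_word n y ?w) i i = 1"
      using unit[OF ir, of y] by simp
    also have "ent (E_word n y ?r) i b = hook_entry n (\<lambda>l. y (ParS i l)) (\<lambda>l. y (ParT i l)) (y (ParD i)) i b"
      using ent_E_word_R(1)[OF i ir br, of y "\<lambda>l. y (ParS i l)" "\<lambda>l. y (ParT i l)" "y (ParD i)"] b h by simp
    finally show ?thesis by simp
  qed
  have "(\<forall>l. i < l \<and> l \<le> n \<longrightarrow> p (ParT i l) = p0 (ParT i l) \<and> p (ParS i l) = p0 (ParS i l)) \<and> p (ParD i) = p0 (ParD i)"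
  proof (rule hook_entry_first_row_inj[OF i])
    fix b assume b: "i \<le> b" "b \<le> hat n i"
    show "hook_entry n (\<lambda>l. p (ParS i l)) (\<lambda>l. p (ParT i l)) (p (ParD i)) i b =
        hook_entry n (\<lambda>l. p0 (ParS i l)) (\<lambda>l. p0 (ParT i l)) (p0 (ParD i)) i b"
      using row[OF b, of p] row[OF b, of p0] eq by simp
  qed (use nz i in \<open>auto simp: params_def\<close>)
  then show 1: "(\<forall>l. i < l \<and> l \<le> n \<longrightarrow> p (ParT i l) = p0 (ParT i l) \<and> p (ParS i l) = p0 (ParS i l)) \<and> p (ParD i) = p0 (ParD i)" .
  have R: "E_word n p ?r = E_word n p0 ?r"
  proof (rule word_mat_cong)
    fix v k assume "(v, k) \<in> set ?r"
    then have "p v = p0 v" using R_word_bounds[of v k n i] i 1 by auto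
    then show "E_mat n k (p v) = E_mat n k (p0 v)" by simp
  qed
  have inv: "E_word n p0 ?r * inv_word n p0 ?r = 1\<^sub>m (2 * n)"
    by (rule conjunct1[OF E_word_inverse]) (use R_word_bounds[of _ _ n i] i in fastforce)
  have cancel: "E_word n y ?w = E_word n y ?w * E_word n p0 ?r * inv_word n p0 ?r" for y
  proof -
    have "E_word n y ?w * E_word n p0 ?r * inv_word n p0 ?r = E_word n y ?w * (E_word n p0 ?r * inv_word n p0 ?r)"
      by (rule mult_sq_assoc[where N = "2 * n"]) simp_all
    also have "\<dots> = E_word n y ?w" unfolding inv by (rule right_mult_one_mat[where nr = "2 * n"]) simp
    finally show ?thesis ..
  qed
  have "E_word n p ?w * E_word n p ?r = E_word n p0 ?w * E_word n p0 ?r"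
    using eq i by (simp add: X_tail_rec word_mat_append)
  then show "E_word n p ?w = E_word n p0 ?w"
    using cancel[of p] cancel[of p0] by (simp add: R)
qed

text \<open>Row by row from 1 upwards: once the parameters of a row are known, its factor is
  cancelled on the right. The reference assignment must avoid zeros, since around a vanishing
  \<open>ParD i\<close> with \<open>i < n\<close> only the sum of two parameters is
  determined.\<close>

lemma X_mat_inj:
  fixes p p0 :: "param \<Rightarrow> 'a::field"
  assumes "X_mat n p = X_mat n p0" "\<And>v. v \<in> params n \<Longrightarrow> p0 v \<noteq> 0" "v \<in> params n"
  shows "p v = p0 v"
proof -
  have eq: "E_word n p (X_tail n i) = E_word n p0 (X_tail n i)" if "1 \<le> i" "i \<le> Suc n" for i
    using that
  proof (induction i rule: dec_induct)
    case base
    show ?case using assms(1) by (simp only: X_mat_word X_word_tail)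
  next
    case (step i)
    then show ?case by (intro X_tail_inj_step(2)[OF _ _ assms(2)]) auto
  qed
  have row: "(\<forall>l. i < l \<and> l \<le> n \<longrightarrow> p (ParT i l) = p0 (ParT i l) \<and> p (ParS i l) = p0 (ParS i l))
      \<and> p (ParD i) = p0 (ParD i)" if "1 \<le> i" "i \<le> n" for i
    by (rule X_tail_inj_step(1)[OF that assms(2) eq]) (use that in auto)
  show ?thesis
  proof (cases v)
    case (ParT i j)
    then show ?thesis using assms(3) row[of i] by (auto simp: params_def)
  next
    case (ParS i j)
    then show ?thesis using assms(3) row[of i] by (auto simp: params_def)
  next
    case (ParD i)
    then show ?thesis using assms(3) row[of i] by (auto simp: params_def)
  qed
qed

section \<open>Values of rational functions\<close>

definition monom_value :: "(param \<Rightarrow> real) \<Rightarrow> (param \<Rightarrow>\<^sub>0 nat) \<Rightarrow> real" where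
  "monom_value x m = (\<Prod>v\<in>Poly_Mapping.keys m. x v ^ Poly_Mapping.lookup m v)"

lemma monom_value_superset:
  assumes "finite K" "Poly_Mapping.keys m \<subseteq> K"
  shows "monom_value x m = (\<Prod>v\<in>K. x v ^ Poly_Mapping.lookup m v)"
  unfolding monom_value_def
  by (rule prod.mono_neutral_left) (use assms in \<open>auto simp: in_keys_iff\<close>)

lemma monom_value_add: "monom_value x (m + m') = monom_value x m * monom_value x m'"
proof -
  let ?K = "Poly_Mapping.keys m \<union> Poly_Mapping.keys m'"
  have "Poly_Mapping.keys (m + m') \<subseteq> ?K" by (rule Poly_Mapping.keys_add)
  then show ?thesis
    using monom_value_superset[of ?K m x] monom_value_superset[of ?K m' x] monom_value_superset[of ?K "m + m'" x]
    by (simp add: lookup_add power_add prod.distrib)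
qed

text \<open>Cancellation can make the key set of a sum smaller than the union of the key sets;
  summing over any finite superset turns additivity into a termwise statement.\<close>

lemma poly_value_superset:
  assumes "finite K" "Poly_Mapping.keys P \<subseteq> K"
  shows "poly_value x P = (\<Sum>m\<in>K. Poly_Mapping.lookup P m * monom_value x m)"
  unfolding poly_value_def monom_value_def[symmetric]
  by (rule sum.mono_neutral_left) (use assms in \<open>auto simp: in_keys_iff\<close>)

lemma poly_value_add: "poly_value x (P + Q) = poly_value x P + poly_value x Q"
proof -
  let ?K = "Poly_Mapping.keys P \<union> Poly_Mapping.keys Q"
  have "Poly_Mapping.keys (P + Q) \<subseteq> ?K" by (rule Poly_Mapping.keys_add)
  then show ?thesis
    using poly_value_superset[of ?K P x] poly_value_superset[of ?K Q x] poly_value_superset[of ?K "P + Q" x]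
    by (simp add: lookup_add algebra_simps sum.distrib)
qed

lemma poly_value_zero [simp]: "poly_value x 0 = 0"
  by (simp add: poly_value_def)

lemma poly_value_sum: "poly_value x (sum f A) = (\<Sum>a\<in>A. poly_value x (f a))"
  by (induction A rule: infinite_finite_induct) (simp_all add: poly_value_add)

lemma poly_value_single: "poly_value x (Poly_Mapping.single m c) = c * monom_value x m"
  by (subst poly_value_superset[of "{m}"]) simp_all

lemma poly_mapping_sum_single:
  "P = (\<Sum>m\<in>Poly_Mapping.keys P. Poly_Mapping.single m (Poly_Mapping.lookup P m))"
  by (rule poly_mapping_eqI) (auto simp: lookup_sum lookup_single when_def in_keys_iff sum.delta)

lemma poly_value_mult: "poly_value x (P * Q) = poly_value x P * poly_value x Q"
proof -
  have "P * Q = (\<Sum>m\<in>Poly_Mapping.keys P. Poly_Mapping.single m (Poly_Mapping.lookup P m)) *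
      (\<Sum>m\<in>Poly_Mapping.keys Q. Poly_Mapping.single m (Poly_Mapping.lookup Q m))"
    by (simp flip: poly_mapping_sum_single)
  then show ?thesis
    by (simp add: sum_product poly_value_sum poly_value_single mult_single monom_value_add
        poly_value_def[of x P] poly_value_def[of x Q] monom_value_def[symmetric] ac_simps)
qed

text \<open>The relation behind the description in \<open>ratfun_value\<close>. It passes through
  sums, products and quotients by way of representatives, so existence of a good representative is
  carried along with the value.\<close>

definition has_value :: "(param \<Rightarrow> real) \<Rightarrow> ratfun \<Rightarrow> real \<Rightarrow> bool" where
  "has_value x r y \<longleftrightarrow> (\<exists>P Q. Q \<noteq> 0 \<and> r = Fract P Q \<and> poly_value x Q \<noteq> 0 \<and>
     y = poly_value x P / poly_value x Q)"

text \<open>Two representatives satisfy \<open>P * Q' = P' * Q\<close>, and evaluation is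
  multiplicative.\<close>

lemma has_value_unique:
  assumes "has_value x r y" "has_value x r z"
  shows "y = z"
proof -
  obtain P Q where 1: "Q \<noteq> 0" "r = Fract P Q" "poly_value x Q \<noteq> 0" "y = poly_value x P / poly_value x Q"
    using assms(1) unfolding has_value_def by blast
  obtain P' Q' where 2: "Q' \<noteq> 0" "r = Fract P' Q'" "poly_value x Q' \<noteq> 0" "z = poly_value x P' / poly_value x Q'"
    using assms(2) unfolding has_value_def by blast
  have "P * Q' = P' * Q" using 1(1,2) 2(1,2) by (simp add: eq_fract)
  then have "poly_value x P * poly_value x Q' = poly_value x P' * poly_value x Q"
    by (simp flip: poly_value_mult)
  then show ?thesis using 1 2 by (simp add: frac_eq_eq)
qed

lemma ratfun_value_eq: "has_value x r y \<Longrightarrow> ratfun_value x r = y"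
  unfolding ratfun_value_def has_value_def[symmetric]
  by (rule the_equality) (auto intro: has_value_unique)

lemma poly_value_one [simp]: "poly_value x 1 = 1"
proof -
  have "poly_value x (Poly_Mapping.single 0 1) = 1"
    by (subst poly_value_single) (simp add: monom_value_def)
  then show ?thesis by simp
qed

lemma has_value_zero: "has_value x 0 0"
  unfolding has_value_def by (rule exI[of _ 0], rule exI[of _ 1]) (simp add: Zero_fract_def)

lemma has_value_one: "has_value x 1 1"
  unfolding has_value_def by (rule exI[of _ 1], rule exI[of _ 1]) (simp add: One_fract_def)

lemma has_value_Var: "has_value x (Var v) (x v)"
  unfolding has_value_def Var_def
  by (intro exI conjI) (auto simp: poly_value_single monom_value_def)

lemma has_value_add:
  assumes "has_value x r y" "has_value x s z"
  shows "has_value x (r + s) (y + z)"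
proof -
  obtain P Q where 1: "Q \<noteq> 0" "r = Fract P Q" "poly_value x Q \<noteq> 0" "y = poly_value x P / poly_value x Q"
    using assms(1) unfolding has_value_def by blast
  obtain P' Q' where 2: "Q' \<noteq> 0" "s = Fract P' Q'" "poly_value x Q' \<noteq> 0" "z = poly_value x P' / poly_value x Q'"
    using assms(2) unfolding has_value_def by blast
  show ?thesis
    unfolding has_value_def
  proof (intro exI conjI)
    show "Q * Q' \<noteq> 0" "poly_value x (Q * Q') \<noteq> 0" using 1 2 by (simp_all add: poly_value_mult)
    show "r + s = Fract (P * Q' + P' * Q) (Q * Q')" using 1 2 by simp
    show "y + z = poly_value x (P * Q' + P' * Q) / poly_value x (Q * Q')"
      using 1 2 by (simp add: poly_value_mult poly_value_add add_frac_eq)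
  qed
qed

lemma has_value_mult:
  assumes "has_value x r y" "has_value x s z"
  shows "has_value x (r * s) (y * z)"
proof -
  obtain P Q where 1: "Q \<noteq> 0" "r = Fract P Q" "poly_value x Q \<noteq> 0" "y = poly_value x P / poly_value x Q"
    using assms(1) unfolding has_value_def by blast
  obtain P' Q' where 2: "Q' \<noteq> 0" "s = Fract P' Q'" "poly_value x Q' \<noteq> 0" "z = poly_value x P' / poly_value x Q'"
    using assms(2) unfolding has_value_def by blast
  show ?thesis
    unfolding has_value_def
  proof (intro exI conjI)
    show "Q * Q' \<noteq> 0" "poly_value x (Q * Q') \<noteq> 0" using 1 2 by (simp_all add: poly_value_mult)
    show "r * s = Fract (P * P') (Q * Q')" using 1 2 by simp
    show "y * z = poly_value x (P * P') / poly_value x (Q * Q')"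
      using 1 2 by (simp add: poly_value_mult)
  qed
qed

lemma has_value_inverse:
  assumes "has_value x r y" "y \<noteq> 0"
  shows "has_value x (inverse r) (inverse y)"
proof -
  obtain P Q where 1: "Q \<noteq> 0" "r = Fract P Q" "poly_value x Q \<noteq> 0" "y = poly_value x P / poly_value x Q"
    using assms(1) unfolding has_value_def by blast
  then have "poly_value x P \<noteq> 0" using assms(2) by auto
  then have "P \<noteq> 0" by auto
  show ?thesis
    unfolding has_value_def
    using 1 \<open>P \<noteq> 0\<close> \<open>poly_value x P \<noteq> 0\<close> by (intro exI[of _ Q] exI[of _ P]) simp
qed

lemma has_value_divide:
  "has_value x r y \<Longrightarrow> has_value x s z \<Longrightarrow> z \<noteq> 0 \<Longrightarrow> has_value x (r / s) (y / z)"
  unfolding divide_inverse by (intro has_value_mult has_value_inverse)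

lemma has_value_power: "has_value x r y \<Longrightarrow> has_value x (r ^ k) (y ^ k)"
  by (induction k) (auto intro: has_value_one has_value_mult)

lemma has_value_prod:
  "(\<And>k. k \<in> A \<Longrightarrow> has_value x (f k) (g k)) \<Longrightarrow> has_value x (prod f A) (prod g A)"
  by (induction A rule: infinite_finite_induct) (auto intro: has_value_one has_value_mult)

lemma ratfun_nonzeroI: "has_value x r y \<Longrightarrow> y \<noteq> 0 \<Longrightarrow> r \<noteq> 0"
  using has_value_unique has_value_zero by blast

text \<open>A rational function with a nonzero value is nonzero; the point with all coordinates 1
  suffices for every quantity involved.\<close>

lemma parameters_Var: "parameters n Var"
proof
  fix v show "Var v \<noteq> 0" by (rule ratfun_nonzeroI[OF has_value_Var[of "\<lambda>_. 1"]]) simp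
next
  fix i j show "Var (ParT i j) + Var (ParS i j) \<noteq> 0"
    by (rule ratfun_nonzeroI[OF has_value_add[OF has_value_Var has_value_Var], of "\<lambda>_. 1"]) simp
qed

definition positive_params :: "nat \<Rightarrow> (param \<Rightarrow> real) \<Rightarrow> bool" where
  "positive_params n x \<longleftrightarrow> (\<forall>v\<in>params n. 0 < x v)"

lemma parameters_positive: "positive_params n x \<Longrightarrow> parameters n x"
  by unfold_locales (auto simp: positive_params_def params_def intro!: add_pos_pos less_imp_neq[THEN not_sym])

text \<open>Every divisor in the formula is nonzero at a positive point, so the value can be
  computed along the construction of the formula.\<close>

lemma has_value_new_param:
  assumes x: "positive_params n x" and v: "v \<in> params n"
  shows "has_value x (param_formula n Var 1 v) (param_formula n x 1 v)"
proof -
  interpret A: parameters n Var by (rule parameters_Var)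
  interpret B: parameters n x by (rule parameters_positive[OF x])
  have s: "has_value x (row_s Var i j) (row_s x i j)" and t: "has_value x (row_t Var i j) (row_t x i j)" for i j
    by (simp_all add: row_s_def row_t_def has_value_one has_value_Var)
  then have u: "has_value x (row_u Var i j) (row_u x i j)" for i j
    by (simp add: row_u_def has_value_one has_value_add)
  note hv = has_value_mult has_value_divide has_value_prod has_value_power s t u has_value_Var
  show ?thesis
  proof (cases v)
    case (ParT i j)
    then have "1 \<le> i" "i < j" "j \<le> n" using v by (auto simp: params_def)
    then show ?thesis unfolding ParT param_formula.simps
      by (intro hv) (auto simp: B.sv_nz B.tv_nz B.uv_nz)
  next
    case (ParS i j)
    then have "1 \<le> i" "i < j" "j \<le> n" using v by (auto simp: params_def)
    then show ?thesis unfolding ParS param_formula.simps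
      by (intro hv) (auto simp: B.sv_nz B.tv_nz B.uv_nz)
  next
    case (ParD i)
    then have "1 \<le> i" "i \<le> n" using v by (auto simp: params_def)
    then show ?thesis unfolding ParD param_formula.simps
      by (intro hv) (auto simp: B.sv_nz B.tv_nz B.uv_nz B.xD_nz)
  qed
qed

section \<open>The measure dx / x\<close>

definition log_line :: "real measure" where
  "log_line = density (restrict_space lborel {0<..}) (\<lambda>x. ennreal (1 / x))"

lemma log_measure_PiM: "log_measure n = PiM (params n) (\<lambda>_. log_line)"
  by (simp add: log_measure_def log_line_def)

lemma sets_log_line [measurable_cong]: "sets log_line = sets (restrict_space borel {0<..})"
  by (simp add: log_line_def sets_restrict_space)

lemma space_log_line [simp]: "space log_line = {0<..}"
  by (simp add: log_line_def space_restrict_space)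

lemma exp_interval_iff: "0 < x \<Longrightarrow> x \<in> {exp (- k)..exp k} \<longleftrightarrow> \<bar>ln x\<bar> \<le> k" for x :: real
proof -
  assume "0 < x"
  then obtain y where "x = exp y" by (metis exp_ln)
  then show ?thesis by (auto simp: abs_le_iff)
qed

text \<open>Substitution \<open>x = exp y\<close> on the compact intervals from
  \<open>exp (- k)\<close> to \<open>exp k\<close>, then monotone convergence in
  \<open>k\<close>.\<close>

lemma nn_integral_log_line:
  fixes f :: "real \<Rightarrow> ennreal"
  assumes f[measurable]: "f \<in> borel_measurable borel"
  shows "(\<integral>\<^sup>+x. f x * ennreal (1 / x) * indicator {0<..} x \<partial>lborel) = (\<integral>\<^sup>+x. f (exp x) \<partial>lborel)"
proof -
  let ?g = "\<lambda>x. f x * ennreal (1 / x)"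
  have 1: "(\<integral>\<^sup>+x. ?g x * indicator {exp (- real k)..exp (real k)} x \<partial>lborel) =
      (\<integral>\<^sup>+x. f (exp x) * indicator {- real k..real k} x \<partial>lborel)" for k
  proof (cases "k = 0")
    \<comment> \<open>The intervals degenerate to points, while the substitution rule asks for
      distinct endpoints; both integrals are zero.\<close>
    case True
    have "(\<integral>\<^sup>+x. h x * indicator {a..a} x \<partial>lborel) = 0" for h :: "real \<Rightarrow> ennreal" and a
    proof -
      have "AE x in lborel. x \<noteq> a" by (rule AE_lborel_singleton)
      then have "AE x in lborel. h x * indicator {a..a} x = 0" by eventually_elim (auto split: split_indicator)
      then have "(\<integral>\<^sup>+x. h x * indicator {a..a} x \<partial>lborel) = (\<integral>\<^sup>+x. 0 \<partial>(lborel :: real measure))"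
        by (rule nn_integral_cong_AE)
      then show ?thesis by simp
    qed
    from this[of ?g 1] this[of "\<lambda>x. f (exp x)" 0] show ?thesis using True by simp
  next
    case False
    have "(\<integral>\<^sup>+x. ?g x * indicator {exp (- real k)..exp (real k)} x \<partial>lborel) =
        (\<integral>\<^sup>+x. ?g (exp x) * ennreal (exp x) * indicator {- real k..real k} x \<partial>lborel)"
      by (rule nn_integral_substitution_aux[where g' = exp])
         (use False in \<open>auto intro!: derivative_eq_intros continuous_intros\<close>)
    also have "\<dots> = (\<integral>\<^sup>+x. f (exp x) * indicator {- real k..real k} x \<partial>lborel)"
      by (intro nn_integral_cong) (simp add: mult.assoc flip: ennreal_mult)
    finally show ?thesis .
  qed
  have mono: "incseq (\<lambda>k x. ?g x * indicator {exp (- real k)..exp (real k)} x)"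
    "incseq (\<lambda>k x. f (exp x) * indicator {- real k..real k} x)"
  proof -
    have "{exp (- real k)..exp (real k)} \<subseteq> {exp (- real l)..exp (real l)}"
      "{- real k..real k} \<subseteq> {- real l..real l}" if "k \<le> l" for k l
      using that by (simp_all add: atLeastatMost_subset_iff)
    then have "(indicator {exp (- real k)..exp (real k)} x :: ennreal) \<le> indicator {exp (- real l)..exp (real l)} x"
      "(indicator {- real k..real k} x :: ennreal) \<le> indicator {- real l..real l} x" if "k \<le> l" for k l x
      using that by (blast intro: indicator_leI)+
    then show "incseq (\<lambda>k x. ?g x * indicator {exp (- real k)..exp (real k)} x)"
      "incseq (\<lambda>k x. f (exp x) * indicator {- real k..real k} x)"
      unfolding incseq_def le_fun_def by (blast intro: mult_left_mono[OF _ zero_le])+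
  qed
  have "(\<integral>\<^sup>+x. ?g x * indicator {0<..} x \<partial>lborel) =
      (\<integral>\<^sup>+x. (SUP k. ?g x * indicator {exp (- real k)..exp (real k)} x) \<partial>lborel)"
  proof (rule nn_integral_cong)
    fix x :: real
    show "?g x * indicator {0<..} x = (SUP k. ?g x * indicator {exp (- real k)..exp (real k)} x)"
    proof (cases "0 < x")
      case True
      obtain K where K: "\<bar>ln x\<bar> \<le> real K" using real_arch_simple by blast
      have "x \<in> {exp (- real K)..exp (real K)}"
        using K True by (simp only: exp_interval_iff)
      then have "?g x \<le> (SUP k. ?g x * indicator {exp (- real k)..exp (real k)} x)"
        by (intro SUP_upper2[of K]) auto
      moreover have "(SUP k. ?g x * indicator {exp (- real k)..exp (real k)} x) \<le> ?g x"
        by (intro SUP_least) (auto split: split_indicator)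
      ultimately show ?thesis using True by (simp add: antisym)
    next
      case False
      then have "x \<notin> {exp (- real k)..exp (real k)}" for k
        using exp_gt_zero[of "- real k"] by (auto simp del: exp_gt_zero)
      then show ?thesis using False by simp
    qed
  qed
  also have "\<dots> = (SUP k. \<integral>\<^sup>+x. ?g x * indicator {exp (- real k)..exp (real k)} x \<partial>lborel)"
    by (rule nn_integral_monotone_convergence_SUP[OF mono(1)]) measurable
  also have "\<dots> = (SUP k. \<integral>\<^sup>+x. f (exp x) * indicator {- real k..real k} x \<partial>lborel)"
    by (simp only: 1)
  also have "\<dots> = (\<integral>\<^sup>+x. (SUP k. f (exp x) * indicator {- real k..real k} x) \<partial>lborel)"
    by (rule nn_integral_monotone_convergence_SUP[OF mono(2), symmetric]) measurable
  also have "\<dots> = (\<integral>\<^sup>+x. f (exp x) \<partial>lborel)"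
  proof (rule nn_integral_cong)
    fix x :: real
    obtain K where K: "\<bar>x\<bar> \<le> real K" using real_arch_simple by blast
    then have "f (exp x) \<le> (SUP k. f (exp x) * indicator {- real k..real k} x)"
      by (intro SUP_upper2[of K]) (auto simp: abs_le_iff)
    moreover have "(SUP k. f (exp x) * indicator {- real k..real k} x) \<le> f (exp x)"
      by (intro SUP_least) (auto split: split_indicator)
    ultimately show "(SUP k. f (exp x) * indicator {- real k..real k} x) = f (exp x)"
      by (rule antisym[rotated])
  qed
  finally show ?thesis .
qed

lemma exp_measurable_log_line [measurable]: "exp \<in> borel \<rightarrow>\<^sub>M log_line"
  unfolding measurable_cong_sets[OF refl sets_log_line] by (intro measurable_restrict_space2) auto

lemma log_line_eq_distr_exp: "log_line = distr lborel log_line exp"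
proof (rule measure_eqI)
  fix A assume A: "A \<in> sets log_line"
  then have Ab: "A \<in> sets borel" "A \<subseteq> {0<..}"
    unfolding sets_log_line by (auto simp: sets_restrict_space)
  have "emeasure log_line A = (\<integral>\<^sup>+x. ennreal (1 / x) * indicator A x \<partial>restrict_space lborel {0<..})"
    unfolding log_line_def
  proof (rule emeasure_density)
    show "(\<lambda>x. ennreal (1 / x)) \<in> borel_measurable (restrict_space lborel {0<..})"
      by (rule measurable_restrict_space1) measurable
    show "A \<in> sets (restrict_space lborel {0<..})" using A by (simp add: log_line_def)
  qed
  also have "\<dots> = (\<integral>\<^sup>+x. indicator A x * ennreal (1 / x) * indicator {0<..} x \<partial>lborel)"
    by (subst nn_integral_restrict_space) (auto simp: mult.commute mult.left_commute)
  also have "\<dots> = (\<integral>\<^sup>+x. indicator A (exp x) \<partial>lborel)"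
    by (rule nn_integral_log_line) (use Ab in auto)
  also have "\<dots> = (\<integral>\<^sup>+x. indicator (exp -` A) x \<partial>lborel)"
    by (intro nn_integral_cong) (simp add: indicator_def)
  also have "\<dots> = emeasure lborel (exp -` A)"
  proof (rule nn_integral_indicator)
    have "exp \<in> borel \<rightarrow>\<^sub>M (borel :: real measure)" by measurable
    from measurable_sets[OF this Ab(1)] show "exp -` A \<in> sets lborel" by simp
  qed
  also have "\<dots> = emeasure (distr lborel log_line exp) A"
    using A by (subst emeasure_distr) auto
  finally show "emeasure log_line A = emeasure (distr lborel log_line exp) A" .
qed simp

lemma log_line_measurable_borel: "f \<in> borel \<rightarrow>\<^sub>M borel \<Longrightarrow> f \<in> log_line \<rightarrow>\<^sub>M borel"
  unfolding measurable_cong_sets[OF sets_log_line refl] by (rule measurable_restrict_space1)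

lemma measurable_log_line_iff:
  "f \<in> M \<rightarrow>\<^sub>M log_line \<longleftrightarrow> f \<in> borel_measurable M \<and> (\<forall>x\<in>space M. 0 < f x)"
  unfolding measurable_cong_sets[OF refl sets_log_line]
  by (subst measurable_restrict_space2_iff) auto

text \<open>In the logarithmic coordinate this is translation by \<open>ln c\<close>; for division a
  reflection precedes the translation.\<close>

lemma distr_log_line_mult:
  assumes "0 < c"
  shows "distr log_line log_line (\<lambda>y. c * y) = log_line"
proof -
  have [measurable]: "(\<lambda>y. c * y) \<in> log_line \<rightarrow>\<^sub>M log_line"
    using assms by (auto simp: measurable_log_line_iff intro!: log_line_measurable_borel)
  have "distr log_line log_line (\<lambda>y. c * y) = distr (distr lborel log_line exp) log_line (\<lambda>y. c * y)"
    by (simp flip: log_line_eq_distr_exp)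
  also have "\<dots> = distr lborel log_line (\<lambda>x. c * exp x)"
    by (subst distr_distr) (auto simp: comp_def)
  also have "\<dots> = distr (distr lborel borel (\<lambda>x. ln c + x)) log_line exp"
    using assms by (subst distr_distr) (auto simp: comp_def exp_add)
  also have "distr lborel borel (\<lambda>x. ln c + x) = lborel"
    using lborel_distr_plus[of "ln c"] by simp
  also have "distr lborel log_line exp = log_line" by (simp flip: log_line_eq_distr_exp)
  finally show ?thesis .
qed

lemma distr_log_line_divide:
  assumes "0 < c"
  shows "distr log_line log_line (\<lambda>y. c / y) = log_line"
proof -
  have [measurable]: "(\<lambda>y. c / y) \<in> log_line \<rightarrow>\<^sub>M log_line"
    using assms by (auto simp: measurable_log_line_iff intro!: log_line_measurable_borel)
  have "distr log_line log_line (\<lambda>y. c / y) = distr (distr lborel log_line exp) log_line (\<lambda>y. c / y)"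
    by (simp flip: log_line_eq_distr_exp)
  also have "\<dots> = distr lborel log_line (\<lambda>x. c / exp x)"
    by (subst distr_distr) (auto simp: comp_def)
  also have "\<dots> = distr (distr (distr lborel borel uminus) borel (\<lambda>x. ln c + x)) log_line exp"
    using assms by (subst distr_distr) (auto simp: comp_def exp_diff distr_distr)
  also have "distr (distr lborel borel uminus) borel (\<lambda>x. ln c + x) = lborel"
    using lborel_distr_plus[of "ln c"] by (simp add: lborel_distr_uminus)
  also have "distr lborel log_line exp = log_line" by (simp flip: log_line_eq_distr_exp)
  finally show ?thesis .
qed

text \<open>Required for Fubini on the product. The exhausting intervals are pulled back by
  \<open>exp\<close> to intervals of length \<open>2 * k\<close>.\<close>

lemma sigma_finite_log_line: "sigma_finite_measure log_line"
proof
  let ?A = "\<lambda>k::nat. {exp (- real k)..exp (real k)}"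
  show "\<exists>A. countable A \<and> A \<subseteq> sets log_line \<and> \<Union> A = space log_line \<and> (\<forall>a\<in>A. emeasure log_line a \<noteq> \<infinity>)"
  proof (intro exI[of _ "range ?A"] conjI ballI)
    have A: "?A k \<in> sets log_line" for k
    proof -
      have "?A k \<subseteq> {0<..}" by (auto intro: less_le_trans[OF exp_gt_zero])
      then show ?thesis unfolding sets_log_line by (auto simp: sets_restrict_space intro!: image_eqI[of _ _ "?A k"])
    qed
    then show "range ?A \<subseteq> sets log_line" by auto
    show "\<Union> (range ?A) = space log_line"
    proof (intro equalityI subsetI)
      fix x assume "x \<in> space log_line"
      then have x: "0 < x" by simp
      obtain K where K: "\<bar>ln x\<bar> \<le> real K" using real_arch_simple by blast
      have "x \<in> {exp (- real K)..exp (real K)}"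
        using K x by (simp only: exp_interval_iff)
      then show "x \<in> \<Union> (range ?A)" by auto
    qed (auto intro: less_le_trans[OF exp_gt_zero])
    fix a assume "a \<in> range ?A"
    then obtain k where a: "a = ?A k" by auto
    have "emeasure log_line a = emeasure lborel (exp -` ?A k)"
      unfolding a by (subst log_line_eq_distr_exp, subst emeasure_distr) (use A in auto)
    also have "exp -` ?A k = {- real k..real k}" by auto
    finally show "emeasure log_line a \<noteq> \<infinity>" by simp
  qed auto
qed

section \<open>Maps preserving the measure\<close>

interpretation log_line: product_sigma_finite "\<lambda>_ :: param. log_line"
  by (rule product_sigma_finite.intro) (rule sigma_finite_log_line)

definition preserving :: "'a measure \<Rightarrow> ('a \<Rightarrow> 'a) \<Rightarrow> bool" where
  "preserving M h \<longleftrightarrow> h \<in> M \<rightarrow>\<^sub>M M \<and> distr M M h = M"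

lemma preserving_comp:
  assumes "preserving M g" "preserving M h"
  shows "preserving M (\<lambda>x. g (h x))"
proof -
  have m: "g \<in> M \<rightarrow>\<^sub>M M" "h \<in> M \<rightarrow>\<^sub>M M" using assms by (simp_all add: preserving_def)
  have "distr M M (\<lambda>x. g (h x)) = distr (distr M M h) M g"
    using m by (simp add: distr_distr comp_def)
  then show ?thesis using assms m by (simp add: preserving_def measurable_compose[OF m(2,1)])
qed

lemma preserving_cong:
  assumes "\<And>x. x \<in> space M \<Longrightarrow> g x = h x" "preserving M g"
  shows "preserving M h"
proof -
  have "h \<in> M \<rightarrow>\<^sub>M M" using assms measurable_cong[of M g h M] by (simp add: preserving_def)
  moreover have "distr M M h = distr M M g" by (rule distr_cong) (simp_all add: assms(1))
  ultimately show ?thesis using assms(2) by (simp add: preserving_def)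
qed

lemma preserving_id: "preserving M (\<lambda>x. x)"
  by (simp add: preserving_def distr_id2)

text \<open>By Fubini the coordinate \<open>v\<close> can be integrated first with the others fixed.
  On such a fibre \<open>c\<close> is constant by \<open>indep\<close>, and the map of the line
  given by \<open>g\<close> preserves \<open>dx / x\<close>.\<close>

lemma preserving_coordinate:
  fixes I :: "param set" and c :: "(param \<Rightarrow> real) \<Rightarrow> real"
  assumes I: "finite I" "v \<in> I" and P: "P = PiM I (\<lambda>_. log_line)"
    and c: "c \<in> borel_measurable P" "\<And>x. x \<in> space P \<Longrightarrow> 0 < c x"
    and indep: "\<And>x y. x \<in> space P \<Longrightarrow> 0 < y \<Longrightarrow> c (x(v := y)) = c x"
    and g: "\<And>c. 0 < c \<Longrightarrow> preserving log_line (g c)"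
    and gm: "(\<lambda>x. g (c x) (x v)) \<in> P \<rightarrow>\<^sub>M log_line"
  shows "preserving P (\<lambda>x. x(v := g (c x) (x v)))"
proof -
  define J where "J = I - {v}"
  have J: "finite J" "v \<notin> J" "I = insert v J" using I by (auto simp: J_def)
  let ?h = "\<lambda>x. x(v := g (c x) (x v))"
  have hm: "?h \<in> P \<rightarrow>\<^sub>M P"
    unfolding P by (rule measurable_fun_upd[where J = I]) (use I gm in \<open>auto simp: P\<close>)
  have "distr P P ?h = P"
  proof (rule measure_eqI)
    fix A assume "A \<in> sets (distr P P ?h)"
    then have A[measurable]: "A \<in> sets P" by simp
    have PJ: "P = PiM (insert v J) (\<lambda>_. log_line)" by (simp add: P J(3))
    have ind: "indicator A \<in> borel_measurable P" by simp
    have indh: "(\<lambda>x. indicator A (?h x) :: ennreal) \<in> borel_measurable P"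
      by (rule measurable_compose[OF hm ind])
    have "emeasure (distr P P ?h) A = (\<integral>\<^sup>+x. indicator A x \<partial>distr P P ?h)" by simp
    also have "\<dots> = (\<integral>\<^sup>+x. indicator A (?h x) \<partial>P)"
      by (rule nn_integral_distr[OF hm]) simp
    also have "\<dots> = (\<integral>\<^sup>+x. \<integral>\<^sup>+y. indicator A (?h (x(v := y))) \<partial>log_line \<partial>PiM J (\<lambda>_. log_line))"
      using indh unfolding PJ by (rule log_line.product_nn_integral_insert[OF J(1,2)])
    also have "\<dots> = (\<integral>\<^sup>+x. \<integral>\<^sup>+y. indicator A (x(v := y)) \<partial>log_line \<partial>PiM J (\<lambda>_. log_line))"
    proof (rule nn_integral_cong)
      fix x assume x: "x \<in> space (PiM J (\<lambda>_. log_line))"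
      have sp: "x(v := y) \<in> space P" if "0 < y" for y
        using x that J(2) by (auto simp: PJ space_PiM PiE_def extensional_def)
      \<comment> \<open>The constant value of \<open>c\<close> on this fibre; 1 is an arbitrary
        positive value for the missing coordinate.\<close>
      define c' where "c' = c (x(v := 1))"
      have c'pos: "0 < c'" using c(2)[OF sp[of 1]] by (simp add: c'_def)
      have c': "c (x(v := y)) = c'" if "0 < y" for y
        using indep[OF sp[of 1] that] by (simp add: c'_def)
      have upd: "(\<lambda>y. x(v := y)) \<in> log_line \<rightarrow>\<^sub>M P"
        unfolding PJ by (rule measurable_component_update[OF x J(2)])
      have gp: "g c' \<in> log_line \<rightarrow>\<^sub>M log_line" "distr log_line log_line (g c') = log_line"
        using g[OF c'pos] by (simp_all add: preserving_def)
      have "(\<integral>\<^sup>+y. indicator A (?h (x(v := y))) \<partial>log_line) = (\<integral>\<^sup>+y. indicator A (x(v := g c' y)) \<partial>log_line)"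
        by (rule nn_integral_cong) (simp add: c')
      also have "\<dots> = (\<integral>\<^sup>+y. indicator A (x(v := y)) \<partial>distr log_line log_line (g c'))"
        by (rule nn_integral_distr[OF gp(1), symmetric]) (simp add: measurable_compose[OF upd ind])
      finally show "(\<integral>\<^sup>+y. indicator A (?h (x(v := y))) \<partial>log_line) = (\<integral>\<^sup>+y. indicator A (x(v := y)) \<partial>log_line)"
        by (simp add: gp(2))
    qed
    also have "\<dots> = (\<integral>\<^sup>+x. indicator A x \<partial>P)"
      using ind unfolding PJ by (rule log_line.product_nn_integral_insert[OF J(1,2), symmetric])
    finally show "emeasure (distr P P ?h) A = emeasure P A" by simp
  qed simp
  then show ?thesis using hm by (simp add: preserving_def)
qed

lemma borel_measurable_coordinate:
  "v \<in> I \<Longrightarrow> (\<lambda>x. x v) \<in> borel_measurable (PiM I (\<lambda>_. log_line))"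
  using measurable_component_singleton[of v I "\<lambda>_. log_line"] by (simp add: measurable_log_line_iff)

lemma preserving_mult_divide:
  fixes I :: "param set" and c :: "(param \<Rightarrow> real) \<Rightarrow> real"
  assumes I: "finite I" "v \<in> I" and P: "P = PiM I (\<lambda>_. log_line)"
    and c: "c \<in> borel_measurable P" "\<And>x. x \<in> space P \<Longrightarrow> 0 < c x"
    and indep: "\<And>x y. x \<in> space P \<Longrightarrow> 0 < y \<Longrightarrow> c (x(v := y)) = c x"
  shows "preserving P (\<lambda>x. x(v := c x * x v))" "preserving P (\<lambda>x. x(v := c x / x v))"
proof -
  have pos: "0 < x v" if "x \<in> space P" for x using that I(2) by (auto simp: P space_PiM)
  have xm: "(\<lambda>x. x v) \<in> borel_measurable P" unfolding P by (rule borel_measurable_coordinate[OF I(2)])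
  show "preserving P (\<lambda>x. x(v := c x * x v))"
  proof (rule preserving_coordinate[OF I P c indep, where g = "(*)"])
    show "preserving log_line ((*) c)" if "0 < c" for c :: real
      using that distr_log_line_mult[OF that]
      by (auto simp: preserving_def measurable_log_line_iff intro!: log_line_measurable_borel)
    show "(\<lambda>x. c x * x v) \<in> P \<rightarrow>\<^sub>M log_line"
      using c pos xm by (auto simp: measurable_log_line_iff intro!: borel_measurable_times)
  qed auto
  show "preserving P (\<lambda>x. x(v := c x / x v))"
  proof (rule preserving_coordinate[OF I P c indep, where g = "(/)"])
    show "preserving log_line ((/) c)" if "0 < c" for c :: real
      using that distr_log_line_divide[OF that]
      by (auto simp: preserving_def measurable_log_line_iff intro!: log_line_measurable_borel)
    show "(\<lambda>x. c x / x v) \<in> P \<rightarrow>\<^sub>M log_line"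
      using c pos xm by (auto simp: measurable_log_line_iff intro!: borel_measurable_divide)
  qed auto
qed

section \<open>The parameter map as a sequence of elementary moves\<close>

lemma finite_params: "finite (params n)"
proof (rule finite_subset)
  show "params n \<subseteq> (\<lambda>(i, j). ParT i j) ` ({..n} \<times> {..n}) \<union> (\<lambda>(i, j). ParS i j) ` ({..n} \<times> {..n}) \<union> ParD ` {..n}"
    by (auto simp: params_def)
qed auto

lemma space_log_measure: "space (log_measure n) = {x \<in> extensional (params n). positive_params n x}"
  by (auto simp: log_measure_PiM space_PiM PiE_def positive_params_def)

lemma row_pos:
  assumes "positive_params n x" "1 \<le> i" "i \<le> j" "j \<le> n"
  shows "0 < row_s x i j" "0 < row_t x i j" "0 < row_u x i j"
  using assms by (auto simp: positive_params_def row_s_def row_t_def row_u_def params_def intro!: add_pos_pos)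

lemma row_measurable:
  assumes "1 \<le> i" "i \<le> j" "j \<le> n"
  shows "(\<lambda>x. row_s x i j) \<in> borel_measurable (log_measure n)"
    "(\<lambda>x. row_t x i j) \<in> borel_measurable (log_measure n)"
    "(\<lambda>x. row_u x i j) \<in> borel_measurable (log_measure n)"
proof -
  have "(\<lambda>x. x (ParS i j)) \<in> borel_measurable (log_measure n)"
    "(\<lambda>x. x (ParT i j)) \<in> borel_measurable (log_measure n)" if "i \<noteq> j"
    unfolding log_measure_PiM using assms that
    by (auto intro!: borel_measurable_coordinate simp: params_def)
  then show "(\<lambda>x. row_s x i j) \<in> borel_measurable (log_measure n)"
    "(\<lambda>x. row_t x i j) \<in> borel_measurable (log_measure n)"
    "(\<lambda>x. row_u x i j) \<in> borel_measurable (log_measure n)"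
    by (cases "i = j"; simp add: row_s_def row_t_def row_u_def)+
qed

text \<open>Pairs are ordered lexicographically with \<open>j\<close> first, written in base
  \<open>n + 1\<close>, and the diagonal names come after all of them. \<open>ParT i j\<close> and
  \<open>ParS i j\<close> share a key because each new value involves both old ones.\<close>

definition param_key :: "nat \<Rightarrow> param \<Rightarrow> nat" where
  "param_key n v = (case v of ParT i j \<Rightarrow> j * (n + 1) + i | ParS i j \<Rightarrow> j * (n + 1) + i
     | ParD i \<Rightarrow> (n + 1) * (n + 1) + i)"

lemma key_pair_eq_iff:
  fixes i j i' j' n :: nat
  assumes "i \<le> n" "i' \<le> n"
  shows "j * (n + 1) + i = j' * (n + 1) + i' \<longleftrightarrow> i = i' \<and> j = j'"
proof
  assume *: "j * (n + 1) + i = j' * (n + 1) + i'"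
  have "(j * (n + 1) + i) div (n + 1) = j" "(j' * (n + 1) + i') div (n + 1) = j'"
    using div_mult_self3[of "n + 1" j i] div_mult_self3[of "n + 1" j' i'] assms by simp_all
  then have "j = j'" using * by simp
  then show "i = i' \<and> j = j'" using * by simp
qed simp

lemma key_mono:
  fixes i j i' j' n :: nat
  assumes "i' \<le> i" "j' \<le> j"
  shows "j' * (n + 1) + i' \<le> j * (n + 1) + i"
  using assms by (intro add_mono mult_right_mono) auto

lemma key_pair_less:
  fixes i j n :: nat
  assumes "i \<le> n" "j \<le> n"
  shows "j * (n + 1) + i < (n + 1) * (n + 1)"
proof -
  have "j * (n + 1) + i \<le> n * (n + 1) + n" using assms by (intro key_mono) auto
  also have "\<dots> < (n + 1) * (n + 1)" by simp
  finally show ?thesis .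
qed

text \<open>The new value of a coordinate involves no coordinate of larger key, so that the coordinates
  can be replaced one after the other, in the order of decreasing keys.\<close>

lemma param_formula_local:
  fixes x y :: "param \<Rightarrow> real"
  assumes v: "v \<in> params n" and eq: "\<And>w. w \<in> params n \<Longrightarrow> param_key n w \<le> param_key n v \<Longrightarrow> x w = y w"
  shows "param_formula n x 1 v = param_formula n y 1 v"
proof (cases v)
  case (ParD i)
  then have i: "1 \<le> i" "i \<le> n" using v by (auto simp: params_def)
  have "x w = y w" if "w = ParS k l \<or> w = ParT k l" "1 \<le> k" "k < l" "l \<le> n" for w k l
  proof (rule eq)
    show "w \<in> params n" using that by (auto simp: params_def)
    show "param_key n w \<le> param_key n v" using that key_pair_less[of k n l] by (auto simp: param_key_def ParD)
  qed
  then have R: "row_s x k l = row_s y k l" "row_t x k l = row_t y k l" "row_u x k l = row_u y k l"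
    if "1 \<le> k" "k \<le> l" "l \<le> n" for k l
    using that by (cases "k = l"; simp add: row_s_def row_t_def row_u_def)+
  have "(\<Prod>k=1..<i. (row_t x k n)\<^sup>2 / (row_s x k n)\<^sup>2) = (\<Prod>k=1..<i. (row_t y k n)\<^sup>2 / (row_s y k n)\<^sup>2)"
    by (rule prod.cong) (use R i in auto)
  moreover have "x (ParD i) = y (ParD i)" using v by (intro eq) (simp_all add: ParD)
  moreover have "row_u x i n = row_u y i n" "row_s x i n = row_s y i n"
    using i by (auto intro!: R)
  ultimately show ?thesis unfolding ParD param_formula.simps by (simp only:)
next
  case (ParT i j)
  then have i: "1 \<le> i" "i < j" "j \<le> n" using v by (auto simp: params_def)
  have "x w = y w" if "w = ParS k l \<or> w = ParT k l" "1 \<le> k" "k < l" "k \<le> i" "l \<le> j" for w k l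
    using that i key_mono[of k i l j n] by (intro eq) (auto simp: params_def param_key_def ParT)
  then have R: "row_s x k l = row_s y k l" "row_t x k l = row_t y k l" "row_u x k l = row_u y k l"
    if "1 \<le> k" "k \<le> l" "k \<le> i" "l \<le> j" for k l
    using that by (cases "k = l"; simp add: row_s_def row_t_def row_u_def)+
  have "(\<Prod>k=1..<i. row_t x k (j - 1) / row_s x k (j - 1)) = (\<Prod>k=1..<i. row_t y k (j - 1) / row_s y k (j - 1))"
    by (rule prod.cong) (use R i in auto)
  moreover have "(\<Prod>k=1..<i. row_s x k j / row_t x k j) = (\<Prod>k=1..<i. row_s y k j / row_t y k j)"
    by (rule prod.cong) (use R i in auto)
  moreover have "row_u x i (j - 1) = row_u y i (j - 1)" "row_u x i j = row_u y i j" "row_s x i (j - 1) = row_s y i (j - 1)"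
    using i by (auto intro!: R)
  ultimately show ?thesis unfolding ParT param_formula.simps by (simp only:)
next
  case (ParS i j)
  then have i: "1 \<le> i" "i < j" "j \<le> n" using v by (auto simp: params_def)
  have "x w = y w" if "w = ParS k l \<or> w = ParT k l" "1 \<le> k" "k < l" "k \<le> i" "l \<le> j" for w k l
    using that i key_mono[of k i l j n] by (intro eq) (auto simp: params_def param_key_def ParS)
  then have R: "row_s x k l = row_s y k l" "row_t x k l = row_t y k l" "row_u x k l = row_u y k l"
    if "1 \<le> k" "k \<le> l" "k \<le> i" "l \<le> j" for k l
    using that by (cases "k = l"; simp add: row_s_def row_t_def row_u_def)+
  have "(\<Prod>k=1..<i. row_t x k (j - 1) / row_s x k (j - 1)) = (\<Prod>k=1..<i. row_t y k (j - 1) / row_s y k (j - 1))"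
    by (rule prod.cong) (use R i in auto)
  moreover have "(\<Prod>k=1..i. row_s x k j / row_t x k j) = (\<Prod>k=1..i. row_s y k j / row_t y k j)"
    by (rule prod.cong) (use R i in auto)
  moreover have "row_u x i (j - 1) = row_u y i (j - 1)" "row_u x i j = row_u y i j" "row_s x i (j - 1) = row_s y i (j - 1)"
    using i by (auto intro!: R)
  ultimately show ?thesis unfolding ParS param_formula.simps by (simp only:)
qed

text \<open>The selected coordinates are replaced simultaneously, all computed from the old values;
  selecting every key gives the full map.\<close>

definition update_at :: "nat \<Rightarrow> (nat \<Rightarrow> bool) \<Rightarrow> (param \<Rightarrow> real) \<Rightarrow> param \<Rightarrow> real" where
  "update_at n Q x = (\<lambda>v\<in>params n. if Q (param_key n v) then param_formula n x 1 v else x v)"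

lemma update_at_none:
  assumes "x \<in> space (log_measure n)" "\<And>w. w \<in> params n \<Longrightarrow> \<not> Q (param_key n w)"
  shows "update_at n Q x = x"
  using assms by (auto simp: update_at_def space_log_measure extensional_def fun_eq_iff)

lemma preserving_diagonal:
  assumes i: "1 \<le> i" "i \<le> n"
  shows "preserving (log_measure n) (update_at n (\<lambda>k. k = param_key n (ParD i)))"
proof (rule preserving_cong)
  define c where "c x = (row_u x i n)\<^sup>2 / (row_s x i n)\<^sup>2 * (\<Prod>k=1..<i. (row_t x k n)\<^sup>2 / (row_s x k n)\<^sup>2)"
    for x :: "param \<Rightarrow> real"
  have v: "ParD i \<in> params n" using i by (simp add: params_def)
  show "preserving (log_measure n) (\<lambda>x. x(ParD i := c x / x (ParD i)))"
  proof (rule preserving_mult_divide(2)[OF finite_params v log_measure_PiM])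
    show "c \<in> borel_measurable (log_measure n)"
      unfolding c_def using i
      by (intro borel_measurable_times borel_measurable_divide borel_measurable_power borel_measurable_prod row_measurable) auto
    show "0 < c x" if "x \<in> space (log_measure n)" for x
      unfolding c_def using that i
      by (intro mult_pos_pos divide_pos_pos zero_less_power prod_pos row_pos[of n x] ballI) (auto simp: space_log_measure)
    have r: "row_s (x(ParD i := y)) = row_s x" "row_t (x(ParD i := y)) = row_t x"
      "row_u (x(ParD i := y)) = row_u x" for x :: "param \<Rightarrow> real" and y
      by (simp_all add: row_s_def row_t_def row_u_def fun_eq_iff)
    show "c (x(ParD i := y)) = c x" for x y
      unfolding c_def r ..
  qed
  fix x assume x: "x \<in> space (log_measure n)"
  have "param_key n w = param_key n (ParD i) \<longleftrightarrow> w = ParD i" if "w \<in> params n" for w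
    using that i key_pair_less[of _ n] by (cases w) (fastforce simp: param_key_def params_def)+
  then show "x(ParD i := c x / x (ParD i)) = update_at n (\<lambda>k. k = param_key n (ParD i)) x"
    using x v by (auto simp: update_at_def c_def space_log_measure extensional_def fun_eq_iff)
qed

text \<open>Through the sum \<open>u\<close> each new value involves both old ones, hence a detour
  by the ratio: \<open>s\<close> becomes \<open>s / t\<close>; then \<open>t\<close> becomes
  \<open>c / (1 + s / t) / t = c / u\<close>, which is the new \<open>p\<close>; finally the ratio
  is multiplied by \<open>p\<close>, which gives \<open>q\<close>.\<close>

lemma preserving_pair:
  assumes i: "1 \<le> i" "i < j" "j \<le> n"
  shows "preserving (log_measure n) (update_at n (\<lambda>k. k = param_key n (ParT i j)))"
proof (rule preserving_cong)
  let ?T = "ParT i j" and ?S = "ParS i j"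
  define c where "c x = row_u x i (j - 1) / row_s x i (j - 1) * (\<Prod>k=1..<i. row_t x k (j - 1) / row_s x k (j - 1))
     * (\<Prod>k=1..<i. row_s x k j / row_t x k j)" for x :: "param \<Rightarrow> real"
  have v: "?T \<in> params n" "?S \<in> params n" using i by (auto simp: params_def)
  have cm: "c \<in> borel_measurable (log_measure n)"
    unfolding c_def using i
    by (intro borel_measurable_times borel_measurable_divide borel_measurable_prod row_measurable) auto
  have cpos: "0 < c x" if "x \<in> space (log_measure n)" for x
    unfolding c_def using that i
    by (intro mult_pos_pos divide_pos_pos prod_pos row_pos[of n x] ballI) (auto simp: space_log_measure)
  \<comment> \<open>Every entry occurring in \<open>c\<close> has its row before \<open>i\<close> or
    its column before \<open>j\<close>, so neither coordinate of the pair enters.\<close>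
  have ci: "c (x(w := y)) = c x" if w: "w = ?T \<or> w = ?S" for x w y
  proof -
    have r: "row_s (x(w := y)) k l = row_s x k l" "row_t (x(w := y)) k l = row_t x k l"
      "row_u (x(w := y)) k l = row_u x k l" if "k < i \<or> l < j" for k l
      using w that by (auto simp: row_s_def row_t_def row_u_def)
    have "(\<Prod>k=1..<i. row_t (x(w := y)) k (j - 1) / row_s (x(w := y)) k (j - 1)) =
        (\<Prod>k=1..<i. row_t x k (j - 1) / row_s x k (j - 1))"
      by (rule prod.cong) (auto simp: r)
    moreover have "(\<Prod>k=1..<i. row_s (x(w := y)) k j / row_t (x(w := y)) k j) = (\<Prod>k=1..<i. row_s x k j / row_t x k j)"
      by (rule prod.cong) (auto simp: r)
    moreover have "j - 1 < j" using i by simp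
    ultimately show ?thesis unfolding c_def by (simp only: r simp_thms)
  qed
  have pos: "0 < x ?T" "0 < x ?S" if "x \<in> space (log_measure n)" for x
    using that v by (auto simp: space_log_measure positive_params_def)
  have m: "(\<lambda>x. x ?T) \<in> borel_measurable (log_measure n)" "(\<lambda>x. x ?S) \<in> borel_measurable (log_measure n)"
    unfolding log_measure_PiM by (intro borel_measurable_coordinate v)+
  let ?h1 = "\<lambda>x :: param \<Rightarrow> real. x(?S := 1 / x ?T * x ?S)"
  let ?h2 = "\<lambda>x. x(?T := (c x / (1 + x ?S)) / x ?T)"
  let ?h3 = "\<lambda>x :: param \<Rightarrow> real. x(?S := x ?T * x ?S)"
  have h1: "preserving (log_measure n) ?h1"
  proof (rule preserving_mult_divide(1)[OF finite_params v(2) log_measure_PiM])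
    show "(\<lambda>x. 1 / x ?T) \<in> borel_measurable (log_measure n)"
      by (rule borel_measurable_divide[OF borel_measurable_const m(1)])
  qed (use pos in auto)
  have h2: "preserving (log_measure n) ?h2"
  proof (rule preserving_mult_divide(2)[OF finite_params v(1) log_measure_PiM])
    show "(\<lambda>x. c x / (1 + x ?S)) \<in> borel_measurable (log_measure n)"
      by (rule borel_measurable_divide[OF cm borel_measurable_add[OF borel_measurable_const m(2)]])
    show "0 < c x / (1 + x ?S)" if "x \<in> space (log_measure n)" for x
      using cpos[OF that] pos(2)[OF that] by simp
    show "c (x(?T := y)) / (1 + (x(?T := y)) ?S) = c x / (1 + x ?S)" for x y
      using ci[of ?T x y] by simp
  qed
  have h3: "preserving (log_measure n) ?h3"
    by (rule preserving_mult_divide(1)[OF finite_params v(2) log_measure_PiM m(1)]) (use pos in auto)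
  show "preserving (log_measure n) (\<lambda>x. ?h3 (?h2 (?h1 x)))"
    by (rule preserving_comp[OF h3 preserving_comp[OF h2 h1]])
  fix x assume x: "x \<in> space (log_measure n)"
  have param_key: "param_key n w = param_key n ?T \<longleftrightarrow> w = ?T \<or> w = ?S" if "w \<in> params n" for w
  proof (cases w)
    case (ParD k)
    then show ?thesis using key_pair_less[of i n j] i by (simp add: param_key_def)
  next
    case (ParT k l)
    then have "k \<le> n" using that by (auto simp: params_def)
    then show ?thesis using key_pair_eq_iff[of k n i l j] i ParT unfolding param_key_def by simp
  next
    case (ParS k l)
    then have "k \<le> n" using that by (auto simp: params_def)
    then show ?thesis using key_pair_eq_iff[of k n i l j] i ParS unfolding param_key_def by simp
  qed
  have T: "param_formula n x 1 ?T = c x / (1 + 1 / x ?T * x ?S) / x ?T"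
  proof -
    have "param_formula n x 1 ?T = c x / row_u x i j" by (simp add: c_def ac_simps)
    also have "row_u x i j = (1 + 1 / x ?T * x ?S) * x ?T"
      using pos[OF x] i by (simp add: row_u_def row_s_def row_t_def field_simps)
    finally show ?thesis by simp
  qed
  have "{1..i} = insert i {1..<i}" using i by auto
  then have S: "param_formula n x 1 ?S = param_formula n x 1 ?T * (1 / x ?T * x ?S)"
    using i by (simp add: row_s_def[of x i j] row_t_def[of x i j])
  show "?h3 (?h2 (?h1 x)) = update_at n (\<lambda>k. k = param_key n ?T) x"
  proof
    fix w
    have upd: "update_at n (\<lambda>k. k = param_key n ?T) x w = param_formula n x 1 w" if "w = ?T \<or> w = ?S"
      using that v param_key[of w] by (auto simp: update_at_def simp del: param_formula.simps One_nat_def)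
    consider "w = ?T" | "w = ?S" | "w \<noteq> ?T" "w \<noteq> ?S" by blast
    then show "(?h3 (?h2 (?h1 x))) w = update_at n (\<lambda>k. k = param_key n ?T) x w"
    proof cases
      case 1
      have "(?h3 (?h2 (?h1 x))) w = param_formula n x 1 w"
        unfolding 1 T by (simp add: ci)
      then show ?thesis unfolding upd[OF disjI1[OF 1]] .
    next
      case 2
      have "(?h3 (?h2 (?h1 x))) w = param_formula n x 1 w"
        unfolding 2 S T by (simp add: ci)
      then show ?thesis unfolding upd[OF disjI2[OF 2]] .
    next
      case 3
      then have "update_at n (\<lambda>k. k = param_key n ?T) x w = x w"
        using x param_key[of w] by (auto simp: update_at_def space_log_measure extensional_def)
      then show ?thesis using 3 by simp
    qed
  qed
qed

text \<open>The induction measure comes from the largest key, \<open>(n + 1) * (n + 1) + n\<close>.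
  Keys carried by no parameter contribute the identity.\<close>

lemma preserving_update_ge: "preserving (log_measure n) (update_at n (\<lambda>k. N \<le> k))"
proof (induction "(n + 1) * (n + 1) + n + 1 - N" arbitrary: N)
  case 0
  have "param_key n w < N" if "w \<in> params n" for w
    using that 0 key_pair_less[of _ n] by (cases w) (fastforce simp: params_def param_key_def)+
  then have "update_at n (\<lambda>k. N \<le> k) x = x" if "x \<in> space (log_measure n)" for x
    using that by (intro update_at_none) (simp_all add: not_le)
  then show ?case by (intro preserving_cong[OF _ preserving_id]) auto
next
  case (Suc d)
  have IH: "preserving (log_measure n) (update_at n (\<lambda>k. Suc N \<le> k))"
    using Suc(2) by (intro Suc(1)) simp
  have step: "preserving (log_measure n) (update_at n (\<lambda>k. k = N))"
  proof (cases "\<exists>v\<in>params n. param_key n v = N")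
    case True
    then obtain v where v: "v \<in> params n" "N = param_key n v" by auto
    show ?thesis
    proof (cases v)
      case (ParD i)
      then show ?thesis using v preserving_diagonal[of i n] by (auto simp: params_def)
    next
      case (ParT i j)
      then show ?thesis using v preserving_pair[of i j n] by (auto simp: params_def)
    next
      case (ParS i j)
      moreover have "param_key n (ParS i j) = param_key n (ParT i j)" by (simp add: param_key_def)
      ultimately show ?thesis using v preserving_pair[of i j n] by (auto simp: params_def)
    qed
  next
    case False
    then have "update_at n (\<lambda>k. k = N) x = x" if "x \<in> space (log_measure n)" for x
      using that by (intro update_at_none) auto
    then show ?thesis by (intro preserving_cong[OF _ preserving_id]) auto
  qed
  show ?case
  proof (rule preserving_cong[OF _ preserving_comp[OF step IH]])
    fix x assume "x \<in> space (log_measure n)"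
    show "update_at n (\<lambda>k. k = N) (update_at n (\<lambda>k. Suc N \<le> k) x) = update_at n (\<lambda>k. N \<le> k) x"
    proof
      fix v
      consider "v \<notin> params n" | "v \<in> params n" "param_key n v = N" | "v \<in> params n" "param_key n v \<noteq> N" by blast
      then show "update_at n (\<lambda>k. k = N) (update_at n (\<lambda>k. Suc N \<le> k) x) v = update_at n (\<lambda>k. N \<le> k) x v"
      proof cases
        case 2
        \<comment> \<open>After the replacement of all larger keys, the coordinates that enter this
          new value still have their original values.\<close>
        have "param_formula n (update_at n (\<lambda>k. Suc N \<le> k) x) 1 v = param_formula n x 1 v"
          by (rule param_formula_local[OF 2(1)]) (use 2 in \<open>simp add: update_at_def\<close>)
        then show ?thesis using 2 by (simp add: update_at_def[of n "\<lambda>k. k = N"] update_at_def[of n "\<lambda>k. N \<le> k"])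
      qed (auto simp: update_at_def)
    qed
  qed
qed

lemma preserving_param_formula:
  "preserving (log_measure n) (\<lambda>x. \<lambda>v\<in>params n. param_formula n x 1 v)"
  by (rule preserving_cong[OF _ preserving_update_ge[of n 0]]) (simp add: update_at_def)

section \<open>The theorem\<close>

lemma X_word_range: "(v, k) \<in> set (X_word n) \<Longrightarrow> 1 \<le> k \<and> k \<le> n"
  using X_word_bounds[of v k n] by blast

lemma X_mat_Sp: "X_mat n x \<in> Sp n"
  unfolding X_mat_word by (rule word_mat_Sp) (use X_word_range in \<open>auto intro!: E_mat_Sp\<close>)

lemma w0_mat_Sp: "w0_mat n \<in> Sp n"
  unfolding w0_mat_word S_mat_def
  by (rule word_mat_Sp) (use X_word_range in \<open>auto intro!: E_mat_Sp F_mat_Sp Sp_mult\<close>)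

lemma inv_word_Sp: "inv_word n x (X_word n) \<in> Sp n"
  unfolding inv_word_def by (rule word_mat_Sp) (use X_word_range in \<open>auto intro!: E_mat_Sp\<close>)

lemma X_mat_inverse:
  "X_mat n x * inv_word n x (X_word n) = 1\<^sub>m (2 * n)" "inv_word n x (X_word n) * X_mat n x = 1\<^sub>m (2 * n)"
  unfolding X_mat_word using E_word_inverse[of "X_word n" n x] X_word_range by blast+

context parameters
begin

lemma torus_coeff_one_nz: "1 \<le> k \<Longrightarrow> k \<le> n \<Longrightarrow> torus_coeff 1 k \<noteq> 0"
  by (rule torus_coeff_nz) auto

text \<open>The elimination controls only the shape of \<open>Y\<close>. Solving the equation for
  \<open>Y\<close> exhibits it as a product of symplectic matrices.\<close>

lemma symplectic_factorization_exists:
  "\<exists>Y \<in> Sp n. unilower n Y \<and>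
    X_mat n (\<lambda>v. - x v) * w0_mat n = Y * torus_mat n (torus_coeff 1) * X_mat n (new_param 1)"
proof -
  let ?T = "torus_mat n (torus_coeff 1)" and ?T' = "torus_mat n (\<lambda>k. inverse (torus_coeff 1 k))"
  let ?X = "X_mat n (new_param 1)" and ?V = "inv_word n (new_param 1) (X_word n)"
  obtain Y where Y: "unilower n Y" "X_mat n (\<lambda>v. - x v) * w0_mat n = Y * ?T * ?X"
    using X_factor by blast
  have C: "Y \<in> carrier_mat (2 * n) (2 * n)" "?X \<in> carrier_mat (2 * n) (2 * n)" "?V \<in> carrier_mat (2 * n) (2 * n)"
    using unilower_carrier[OF Y(1)] X_mat_Sp[THEN Sp_carrier] by simp_all
  have YT: "Y * ?T \<in> carrier_mat (2 * n) (2 * n)" by (intro mult_sq_carrier C torus_mat_carrier)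
  have "Y * ?T * ?X * ?V = Y * ?T * (?X * ?V)" by (rule mult_sq_assoc[OF YT C(2,3)])
  also have "\<dots> = Y * ?T" unfolding X_mat_inverse by (rule right_mult_one_mat[OF YT])
  finally have "Y * ?T * ?X * ?V * ?T' = Y * ?T * ?T'" by simp
  also have "\<dots> = Y * (?T * ?T')" by (rule mult_sq_assoc[OF C(1)]) simp_all
  also have "?T * ?T' = 1\<^sub>m (2 * n)" by (rule torus_inverse(1)) (rule torus_coeff_one_nz)
  also have "Y * \<dots> = Y" by (rule right_mult_one_mat[OF C(1)])
  finally have "Y = X_mat n (\<lambda>v. - x v) * w0_mat n * ?V * ?T'" by (simp add: Y(2))
  also have "\<dots> \<in> Sp n"
    using torus_coeff_one_nz by (intro Sp_mult X_mat_Sp w0_mat_Sp inv_word_Sp torus_Sp) simp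
  finally show ?thesis using Y by blast
qed

text \<open>Multiplying on the right by the inverse of the known upper factor leaves the upper
  unitriangular quotient \<open>X_mat n p * ?V\<close>, which uniqueness of the triangular
  factorization forces to be 1. Then \<open>X_mat_inj\<close> applies, the known parameters being
  nonzero.\<close>

lemma factorization_determined:
  assumes Y: "unilower n Y" and T: "T \<in> carrier_mat (2 * n) (2 * n)" "diagonal_mat T"
    and eq: "X_mat n (\<lambda>v. - x v) * w0_mat n = Y * T * X_mat n p"
  shows "T = torus_mat n (torus_coeff 1)" "v \<in> params n \<Longrightarrow> p v = new_param 1 v"
proof -
  let ?T = "torus_mat n (torus_coeff 1)"
  let ?X = "X_mat n (new_param 1)" and ?V = "inv_word n (new_param 1) (X_word n)"
  obtain Y' where Y': "unilower n Y'" "X_mat n (\<lambda>v. - x v) * w0_mat n = Y' * ?T * ?X"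
    using X_factor by blast
  have C: "Y \<in> carrier_mat (2 * n) (2 * n)" "Y' \<in> carrier_mat (2 * n) (2 * n)" "?X \<in> carrier_mat (2 * n) (2 * n)"
    "?V \<in> carrier_mat (2 * n) (2 * n)" "X_mat n p \<in> carrier_mat (2 * n) (2 * n)"
    using unilower_carrier[OF Y(1)] unilower_carrier[OF Y'(1)] X_mat_Sp[THEN Sp_carrier] by simp_all
  have P: "Y * T \<in> carrier_mat (2 * n) (2 * n)" "Y' * ?T \<in> carrier_mat (2 * n) (2 * n)"
    by (intro mult_sq_carrier C T torus_mat_carrier)+
  have "Y * (T * (X_mat n p * ?V)) = Y * T * (X_mat n p * ?V)"
    by (rule mult_sq_assoc[OF C(1) T(1) mult_sq_carrier[OF C(5,4)], symmetric])
  also have "\<dots> = Y * T * X_mat n p * ?V" by (rule mult_sq_assoc[OF P(1) C(5,4), symmetric])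
  also have "\<dots> = Y' * ?T * ?X * ?V" by (simp only: Y'(2) flip: eq)
  also have "\<dots> = Y' * ?T * (?X * ?V)" by (rule mult_sq_assoc[OF P(2) C(3,4)])
  also have "\<dots> = Y' * ?T" unfolding X_mat_inverse by (rule right_mult_one_mat[OF P(2)])
  finally have e: "Y * (T * (X_mat n p * ?V)) = Y' * ?T" .
  have u: "uniupper n (X_mat n p * ?V)"
    unfolding X_mat_word inv_word_def
    by (intro uniupper_mult uniupper_E_word) (use X_word_range in auto)
  have unique: "T = ?T" "X_mat n p * ?V = 1\<^sub>m (2 * n)"
    using triangular_factorization_unique[OF Y Y'(1) u T _ e] torus_coeff_one_nz by blast+
  show "T = ?T" by (rule unique(1))
  have "X_mat n p = X_mat n p * (?V * ?X)"
    unfolding X_mat_inverse by (rule right_mult_one_mat[OF C(5), symmetric])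
  also have "\<dots> = X_mat n p * ?V * ?X" by (rule mult_sq_assoc[OF C(5,4,3), symmetric])
  also have "\<dots> = ?X" unfolding unique(2) by (rule left_mult_one_mat[OF C(3)])
  finally have "X_mat n p = ?X" .
  then show "p v = new_param 1 v" if "v \<in> params n"
    by (rule X_mat_inj[OF _ _ that]) (rule new_param_nz)
qed

end

lemma var_rows: "s_var = row_s Var" "t_var = row_t Var" "u_fun = row_u Var"
  by (auto simp: fun_eq_iff s_var_def t_var_def u_fun_def row_s_def row_t_def row_u_def)

text \<open>On the positive orthant the values of the rational functions are given by the same
  formulas over the reals, so the composition of elementary moves is this map.\<close>

lemma param_map_preserving:
  assumes p: "\<And>v. v \<in> params n \<Longrightarrow> p v = param_formula n Var 1 v"
  shows "preserving (log_measure n) (param_map n p)"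
proof (rule preserving_cong[OF _ preserving_param_formula])
  fix x assume "x \<in> space (log_measure n)"
  then have x: "positive_params n x" by (simp add: space_log_measure)
  show "(\<lambda>v\<in>params n. param_formula n x 1 v) = param_map n p x"
    unfolding param_map_def
  proof (rule restrict_ext)
    fix v assume v: "v \<in> params n"
    show "param_formula n x 1 v = ratfun_value x (p v)"
      unfolding p[OF v] by (rule ratfun_value_eq[OF has_value_new_param[OF x v], symmetric])
  qed
qed

theorem theorem6p1:
  fixes n :: nat
  assumes "n \<ge> 1"
  shows "(\<exists>Y T p. factorization n Y T p) \<and>
    (\<forall>Y T p. factorization n Y T p \<longrightarrow>
      (\<forall>i j. 1 \<le> i \<and> i < j \<and> j \<le> n \<longrightarrow>
        p (ParT i j) = r_fun i j * (\<Prod>k=1..<i. t_var k (j - 1) / s_var k (j - 1))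
                                 * (\<Prod>k=1..<i. s_var k j / t_var k j) \<and>
        p (ParS i j) = r_fun i j * (\<Prod>k=1..<i. t_var k (j - 1) / s_var k (j - 1))
                                 * (\<Prod>k=1..i. s_var k j / t_var k j)) \<and>
      (\<forall>i. 1 \<le> i \<and> i \<le> n \<longrightarrow>
        p (ParD i) = (u_fun i n)\<^sup>2 / (Var (ParD i) * (s_var i n)\<^sup>2)
                       * (\<Prod>k=1..<i. (t_var k n)\<^sup>2 / (s_var k n)\<^sup>2)) \<and>
      T = torus_mat n (\<lambda>k. Var (ParD k) * (\<Prod>j=1..<k. s_var j k / t_var j k)
                             * (\<Prod>j=k+1..n. s_var k j * t_var k j)) \<and>
      param_map n p \<in> measurable (log_measure n) (log_measure n) \<and>
      distr (log_measure n) (log_measure n) (param_map n p) = log_measure n)"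
proof (intro conjI allI impI)
  interpret parameters n Var by (rule parameters_Var)
  have diag: "diagonal_mat (torus_mat n c)" for c :: "nat \<Rightarrow> ratfun"
    by (auto simp: diagonal_mat_def torus_mat_def mat_unit_def intro!: sum.neutral)
  obtain Y where "Y \<in> Sp n" "unilower n Y" "X_mat n (\<lambda>v. - Var v) * w0_mat n =
      Y * torus_mat n (torus_coeff 1) * X_mat n (new_param 1)"
    using symplectic_factorization_exists by blast
  moreover from this have "lower_unitriangular Y"
    using unilower_lower_unitriangular[OF Sp_carrier[of Y n]] by blast
  moreover have "torus_mat n (torus_coeff 1) \<in> Sp n" by (rule torus_Sp) (rule torus_coeff_one_nz)
  ultimately have "factorization n Y (torus_mat n (torus_coeff 1)) (new_param 1)"
    unfolding factorization_def using diag by blast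
  then show "\<exists>Y T p. factorization n Y T p" by blast
  fix Y T p assume F: "factorization n Y T p"
  have F': "unilower n Y" "T \<in> carrier_mat (2 * n) (2 * n)" "diagonal_mat T"
    "X_mat n (\<lambda>v. - Var v) * w0_mat n = Y * T * X_mat n p"
    using F unilower_lower_unitriangular[OF Sp_carrier, of Y n] Sp_carrier[of T n]
    by (simp_all add: factorization_def)
  note T = factorization_determined(1)[OF F'] and p = factorization_determined(2)[OF F']
  show "T = torus_mat n (\<lambda>k. Var (ParD k) * (\<Prod>j=1..<k. s_var j k / t_var j k)
      * (\<Prod>j=k+1..n. s_var k j * t_var k j))"
    unfolding T by (rule torus_cong) (simp add: torus_formula_def var_rows)
  show "param_map n p \<in> measurable (log_measure n) (log_measure n)"
    "distr (log_measure n) (log_measure n) (param_map n p) = log_measure n"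
    using param_map_preserving[of n p] p by (simp_all add: preserving_def)
  show "p (ParD i) = (u_fun i n)\<^sup>2 / (Var (ParD i) * (s_var i n)\<^sup>2)
      * (\<Prod>k=1..<i. (t_var k n)\<^sup>2 / (s_var k n)\<^sup>2)" if "1 \<le> i \<and> i \<le> n" for i
    using that by (subst p) (auto simp: params_def var_rows)
  show "p (ParT i j) = r_fun i j * (\<Prod>k=1..<i. t_var k (j - 1) / s_var k (j - 1))
      * (\<Prod>k=1..<i. s_var k j / t_var k j)" if "1 \<le> i \<and> i < j \<and> j \<le> n" for i j
    using that by (subst p) (auto simp: params_def var_rows r_fun_def)
  show "p (ParS i j) = r_fun i j * (\<Prod>k=1..<i. t_var k (j - 1) / s_var k (j - 1))
      * (\<Prod>k=1..i. s_var k j / t_var k j)" if "1 \<le> i \<and> i < j \<and> j \<le> n" for i j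
    using that by (subst p) (auto simp: params_def var_rows r_fun_def)
qed

end
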